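(* Suppose that $q\in(-1,1)$ and $x\in H$ with $\|x\|=1$ and $\overline{x}=x$ or $\overline{x}=-x$. Then the probability distribution of $G_q(x)=d_q(x)+d_q^\ast(x)$ with respect to the vacuum state $\langle\Omega,\,\cdot\,\Omega\rangle_q$ is $\mu_q$, where $\mu_q$ is the probability measure on $\mathbb{R}$ whose monic orthogonal polynomials $(P_n^{(q)}(t))_{n\ge0}$ are determined by $$P_0^{(q)}(t)=1,\quad P_1^{(q)}(t)=t,\quad P_2^{(q)}(t)=t^2-1,\quad tP_n^{(q)}(t)=P_{n+1}^{(q)}(t)+[n]_q(1+q^{n-1})P_{n-1}^{(q)}(t)\quad (n\ge2).$$
   Context: Fock space. $H$ is a complex Hilbert space with inner product $\langle\cdot,\cdot\rangle$ linear in the right argument and antilinear in the left one; $x\mapsto\overline{x}$ is a fixed selfadjoint involution on $H$, i.e. a bounded selfadjoint linear operator whose square is the identity. Let $B(n)$ be the group of permutations $\sigma$ of $\{\pm1,\dots,\pm n\}$ with $\sigma(-k)=-\sigma(k)$; put $\pi_i=(i,i+1)(-i,-i-1)$ for $1\le i\le n-1$, $\overline{\pi}_n=(n,-n)$ and $\widehat{\pi}_{n-1}=\overline{\pi}_n\pi_{n-1}\overline{\pi}_n$. The Coxeter group $D(n)$ of type D is $D(1)=\{e\}$ and, for $n\ge2$, the subgroup of $B(n)$ generated by $\pi_1,\dots,\pi_{n-1},\widehat{\pi}_{n-1}$; $\ell(\sigma)$ is the minimal number of these generators in a product expression of $\sigma\in D(n)$. For $n\ge 2$, $D(n)$ acts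 on $H^{\otimes n}$ by $\pi_i(x_1\otimes\cdots\otimes x_n)=x_1\otimes\cdots\otimes x_{i-1}\otimes x_{i+1}\otimes x_i\otimes x_{i+2}\otimes\cdots\otimes x_n$ and $\widehat{\pi}_{n-1}(x_1\otimes\cdots\otimes x_n)=x_1\otimes\cdots\otimes x_{n-2}\otimes\overline{x}_n\otimes\overline{x}_{n-1}$; $D(1)$ acts trivially on $H$. Put $\widehat{P}_q^{(n)}=\sum_{\sigma\in D(n)}q^{\ell(\sigma)}\sigma$ for $n\ge1$ and $\widehat P_q^{(0)}=I$ (convention $0^0=1$). Let $\mathcal{F}_{\rm fin}(H)=\bigoplus_{n\ge0}H^{\otimes n}$ be the algebraic direct sum, $H^{\otimes0}=\mathbb{C}\Omega$ with $\Omega$ a unit vector, with the usual inner product $\langle x_1\otimes\cdots\otimes x_m,y_1\otimes\cdots\otimes y_n\rangle_0=\delta_{m,n}\prod_i\langle x_i,y_i\rangle$, and $\widehat P_q=\bigoplus_n\widehat P_q^{(n)}$. For $q\in(-1,1)$, $\widehat P_q$ is known to be strictly positive, so $\langle f,g\rangle_q:=\langle f,\widehat P_q g\rangle_0$ is an inner product. The creation operator is $d_q^\ast(x)(x_1\otimes\cdots\otimes x_n)=x\otimes x_1\otimes\cdots\otimes x_n$, $d_q^\ast(x)\Omega=x$, and $d_q(x)$ is its adjoint with respect to $\langle\cdot,\cdot\rangle_q$. These operators are bounded for $\|\cdot\|_q$, so $G_q(x)$ is a bounded selfadjoint operator. Conventions. $[n]_q=1+q+\cdots+q^{n-1}$.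 The distribution of a bounded selfadjoint operator $G$ with respect to the vacuum state is the probability measure $\mu$ on $\mathbb{R}$ with $\langle\Omega,G^n\Omega\rangle_q=\int t^n\,d\mu(t)$ for all $n\ge0$. Since the Jacobi parameters $\beta_n=0$, $\gamma_0=1$, $\gamma_{n-1}=[n]_q(1+q^{n-1})$ ($n\ge2$) of the recursion are nonnegative and bounded, $\mu_q$ exists and is unique. *)

theory Defs
  imports
    "HOL-Probability.Probability"
    "HOL-Library.Poly_Mapping"
    "HOL-Combinatorics.Combinatorics"
    "HOL-Algebra.Generated_Groups"
    "HOL-Computational_Algebra.Polynomial"
begin

section \<open>Complex vector spaces and complex Hilbert spaces\<close>

class complex_vector = ab_group_add +
  fixes scaleC :: "complex \<Rightarrow> 'a \<Rightarrow> 'a"  (infixr \<open>*\<^sub>C\<close> 75)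
  assumes scaleC_add_right: "c *\<^sub>C (x + y) = c *\<^sub>C x + c *\<^sub>C y"
    and scaleC_add_left: "(c + d) *\<^sub>C x = c *\<^sub>C x + d *\<^sub>C x"
    and scaleC_scaleC: "c *\<^sub>C (d *\<^sub>C x) = (c * d) *\<^sub>C x"
    and scaleC_one: "1 *\<^sub>C x = x"

global_interpretation complex_vector:
  vector_space "scaleC :: complex \<Rightarrow> 'a \<Rightarrow> 'a::complex_vector"
  by unfold_locales (simp_all add: scaleC_add_right scaleC_add_left scaleC_scaleC scaleC_one)

abbreviation clinear :: "('a::complex_vector \<Rightarrow> 'b::complex_vector) \<Rightarrow> bool"
  where "clinear \<equiv> Vector_Spaces.linear scaleC scaleC"

lemma clinearI:
  assumes "\<And>x y. f (x + y) = f x + f y" and "\<And>c x. f (c *\<^sub>C x) = c *\<^sub>C f x"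
  shows "clinear f"
  using assms
  by (simp add: Vector_Spaces.linear_iff complex_vector.vector_space_axioms)

lemma clinear_add: "clinear f \<Longrightarrow> f (x + y) = f x + f y"
  by (simp add: Vector_Spaces.linear_iff)

lemma clinear_scale: "clinear f \<Longrightarrow> f (c *\<^sub>C x) = c *\<^sub>C f x"
  by (simp add: Vector_Spaces.linear_iff)

instantiation complex :: complex_vector
begin
definition scaleC_complex :: "complex \<Rightarrow> complex \<Rightarrow> complex"
  where "scaleC_complex = (*)"
instance by standard (simp_all add: scaleC_complex_def algebra_simps)
end

text \<open>The inner product is linear in the right argument and antilinear in the left one.
  Completeness, and the facts that the norm is definite and homogeneous, come from \<^class>\<open>banach\<close>.\<close>

class complex_hilbert = complex_vector + banach +
  fixes cinner :: "'a \<Rightarrow> 'a \<Rightarrow> complex"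
  assumes scaleR_scaleC: "r *\<^sub>R x = complex_of_real r *\<^sub>C x"
    and cinner_commute: "cinner x y = cnj (cinner y x)"
    and cinner_add_right: "cinner x (y + z) = cinner x y + cinner x z"
    and cinner_scaleC_right: "cinner x (c *\<^sub>C y) = c * cinner x y"
    and cinner_self: "cinner x x = complex_of_real ((norm x)\<^sup>2)"

definition selfadjoint_involution :: "('h::complex_hilbert \<Rightarrow> 'h) \<Rightarrow> bool"
  where "selfadjoint_involution J \<longleftrightarrow>
    clinear J \<and> (\<exists>K. \<forall>x. norm (J x) \<le> K * norm x) \<and>
    (\<forall>x y. cinner (J x) y = cinner x (J y)) \<and> (\<forall>x. J (J x) = x)"


section \<open>The algebraic full Fock space\<close>

text \<open>The space of finitely supported functions on words over \<open>'h\<close> is the complex vector space with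
  basis the words; \<open>free_extend \<phi>\<close> is the linear extension to it of a map \<open>\<phi>\<close> on basis elements.\<close>

instantiation poly_mapping :: (type, complex_vector) complex_vector
begin
definition scaleC_poly_mapping :: "complex \<Rightarrow> ('a \<Rightarrow>\<^sub>0 'b) \<Rightarrow> ('a \<Rightarrow>\<^sub>0 'b)"
  where "scaleC_poly_mapping c = Poly_Mapping.map (scaleC c)"

lemma lookup_scaleC [simp]:
  "Poly_Mapping.lookup (c *\<^sub>C f) k = c *\<^sub>C Poly_Mapping.lookup (f :: 'a \<Rightarrow>\<^sub>0 'b) k"
  by (auto simp: scaleC_poly_mapping_def Poly_Mapping.map.rep_eq when_def)

instance
  by standard
    (auto intro!: poly_mapping_eqI
      simp: lookup_add scaleC_add_right scaleC_add_left scaleC_scaleC scaleC_one)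
end

definition free_extend :: "('k \<Rightarrow> 'b::complex_vector) \<Rightarrow> ('k \<Rightarrow>\<^sub>0 complex) \<Rightarrow> 'b"
  where "free_extend \<phi> f = (\<Sum>k\<in>Poly_Mapping.keys f. Poly_Mapping.lookup f k *\<^sub>C \<phi> k)"

lemma free_extend_superset:
  assumes "finite A" "Poly_Mapping.keys f \<subseteq> A"
  shows "free_extend \<phi> f = (\<Sum>k\<in>A. Poly_Mapping.lookup f k *\<^sub>C \<phi> k)"
  unfolding free_extend_def using assms
  by (intro sum.mono_neutral_left) (auto simp: in_keys_iff)

lemma clinear_free_extend:
  fixes \<phi> :: "'k \<Rightarrow> 'b::complex_vector"
  shows "clinear (free_extend \<phi>)"
proof (rule clinearI)
  fix f g :: "'k \<Rightarrow>\<^sub>0 complex"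
  let ?A = "Poly_Mapping.keys f \<union> Poly_Mapping.keys g"
  have "free_extend \<phi> (f + g) = (\<Sum>k\<in>?A. Poly_Mapping.lookup (f + g) k *\<^sub>C \<phi> k)"
    by (rule free_extend_superset) (auto simp: Poly_Mapping.keys_add)
  also have "\<dots> = (\<Sum>k\<in>?A. Poly_Mapping.lookup f k *\<^sub>C \<phi> k) + (\<Sum>k\<in>?A. Poly_Mapping.lookup g k *\<^sub>C \<phi> k)"
    by (simp add: lookup_add scaleC_add_left sum.distrib)
  also have "\<dots> = free_extend \<phi> f + free_extend \<phi> g"
    by (simp add: free_extend_superset[of ?A])
  finally show "free_extend \<phi> (f + g) = free_extend \<phi> f + free_extend \<phi> g" .
next
  fix c and f :: "'k \<Rightarrow>\<^sub>0 complex"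
  have "free_extend \<phi> (c *\<^sub>C f) = (\<Sum>k\<in>Poly_Mapping.keys f. Poly_Mapping.lookup (c *\<^sub>C f) k *\<^sub>C \<phi> k)"
    by (rule free_extend_superset)
      (auto simp: in_keys_iff scaleC_complex_def)
  also have "\<dots> = c *\<^sub>C free_extend \<phi> f"
    by (simp add: free_extend_def complex_vector.scale_sum_right scaleC_complex_def)
  finally show "free_extend \<phi> (c *\<^sub>C f) = c *\<^sub>C free_extend \<phi> f" .
qed

lemma free_extend_single [simp]: "free_extend \<phi> (Poly_Mapping.single k c) = c *\<^sub>C \<phi> k"
  by (cases "c = 0") (simp_all add: free_extend_def)

lemma free_extend_basis: "free_extend (\<lambda>k. Poly_Mapping.single k 1) f = f"
proof (rule poly_mapping_eqI)
  fix k
  have "Poly_Mapping.lookup (free_extend (\<lambda>k. Poly_Mapping.single k 1) f) k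
      = (\<Sum>j\<in>Poly_Mapping.keys f. Poly_Mapping.lookup (Poly_Mapping.lookup f j *\<^sub>C Poly_Mapping.single j (1::complex)) k)"
    by (simp only: free_extend_def lookup_sum)
  also have "\<dots> = (\<Sum>j\<in>Poly_Mapping.keys f. if j = k then Poly_Mapping.lookup f j else 0)"
    by (intro sum.cong) (auto simp: lookup_single when_def scaleC_complex_def)
  also have "\<dots> = Poly_Mapping.lookup f k"
    by (auto simp: in_keys_iff)
  finally show "Poly_Mapping.lookup (free_extend (\<lambda>k. Poly_Mapping.single k 1) f) k = Poly_Mapping.lookup f k" .
qed

text \<open>The tensor algebra: words modulo multilinearity in each letter. The relations are homogeneous
  in the length of the words, so this is the algebraic direct sum over \<open>n\<close> of the algebraic tensor
  powers of \<open>'h\<close>; words of length \<open>n\<close> span the \<open>n\<close>-th power, and the empty word is the vacuum.\<close>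

definition tensor_relators :: "('h::complex_vector list \<Rightarrow>\<^sub>0 complex) set"
  where "tensor_relators =
    {Poly_Mapping.single (us @ [x + y] @ vs) 1
       - (Poly_Mapping.single (us @ [x] @ vs) 1 + Poly_Mapping.single (us @ [y] @ vs) 1)
     | us vs x y. True} \<union>
    {Poly_Mapping.single (us @ [c *\<^sub>C x] @ vs) 1 - c *\<^sub>C Poly_Mapping.single (us @ [x] @ vs) 1
     | us vs c x. True}"

definition tensor_eq :: "('h::complex_vector list \<Rightarrow>\<^sub>0 complex) \<Rightarrow> ('h list \<Rightarrow>\<^sub>0 complex) \<Rightarrow> bool"
  where "tensor_eq f g \<longleftrightarrow> f - g \<in> complex_vector.span tensor_relators"

lemma equivp_tensor_eq:
  "equivp (tensor_eq :: ('h::complex_vector list \<Rightarrow>\<^sub>0 complex) \<Rightarrow> _)"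
proof (rule equivpI)
  show "reflp (tensor_eq :: ('h list \<Rightarrow>\<^sub>0 complex) \<Rightarrow> _)"
    by (auto intro!: reflpI simp: tensor_eq_def complex_vector.span_zero)
  show "symp (tensor_eq :: ('h list \<Rightarrow>\<^sub>0 complex) \<Rightarrow> _)"
    unfolding symp_def tensor_eq_def by (metis complex_vector.span_neg minus_diff_eq)
  show "transp (tensor_eq :: ('h list \<Rightarrow>\<^sub>0 complex) \<Rightarrow> _)"
  proof (rule transpI)
    fix f g h :: "'h list \<Rightarrow>\<^sub>0 complex"
    assume "tensor_eq f g" "tensor_eq g h"
    then have "(f - g) + (g - h) \<in> complex_vector.span tensor_relators"
      unfolding tensor_eq_def by (rule complex_vector.span_add)
    then show "tensor_eq f h" by (simp add: tensor_eq_def)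
  qed
qed

quotient_type (overloaded) 'h fock = "'h::complex_vector list \<Rightarrow>\<^sub>0 complex" / tensor_eq
  by (rule equivp_tensor_eq)

instantiation fock :: (complex_vector) complex_vector
begin

lift_definition zero_fock :: "'a fock" is 0 .

lift_definition plus_fock :: "'a fock \<Rightarrow> 'a fock \<Rightarrow> 'a fock" is "(+)"
  unfolding tensor_eq_def by (auto simp: add_diff_add intro: complex_vector.span_add)

lift_definition uminus_fock :: "'a fock \<Rightarrow> 'a fock" is uminus
  unfolding tensor_eq_def by (auto simp: algebra_simps dest: complex_vector.span_neg)

lift_definition minus_fock :: "'a fock \<Rightarrow> 'a fock \<Rightarrow> 'a fock" is "(-)"
  unfolding tensor_eq_def
  by (auto simp: diff_diff_eq2 algebra_simps dest: complex_vector.span_diff)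

lift_definition scaleC_fock :: "complex \<Rightarrow> 'a fock \<Rightarrow> 'a fock" is scaleC
  unfolding tensor_eq_def
  by (metis complex_vector.scale_right_diff_distrib complex_vector.span_scale)

instance
  by standard
    (transfer;
      simp add: tensor_eq_def complex_vector.span_zero scaleC_add_right scaleC_add_left
        scaleC_scaleC scaleC_one algebra_simps)+

end

lift_definition tensor :: "'h::complex_vector list \<Rightarrow> 'h fock"
  is "\<lambda>xs. Poly_Mapping.single xs 1" .

abbreviation vacuum :: "'h::complex_vector fock"  (\<open>\<Omega>\<close>)
  where "\<Omega> \<equiv> tensor []"

definition multilinear :: "('h::complex_vector list \<Rightarrow> 'b::complex_vector) \<Rightarrow> bool"
  where "multilinear \<phi> \<longleftrightarrow> (\<forall>us vs. clinear (\<lambda>x. \<phi> (us @ [x] @ vs)))"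

lemma multilinear_tensor: "multilinear tensor"
  unfolding multilinear_def
proof (intro allI clinearI)
  fix us vs :: "'a list" and x y :: 'a and c
  show "tensor (us @ [x + y] @ vs) = tensor (us @ [x] @ vs) + tensor (us @ [y] @ vs)"
    by transfer
      (force simp: tensor_eq_def tensor_relators_def intro!: complex_vector.span_base)
  show "tensor (us @ [c *\<^sub>C x] @ vs) = c *\<^sub>C tensor (us @ [x] @ vs)"
    by transfer
      (force simp: tensor_eq_def tensor_relators_def intro!: complex_vector.span_base)
qed

text \<open>The linear map determined by its values \<open>\<phi>\<close> on simple tensors, independent of the chosen
  representative when \<open>\<phi>\<close> is multilinear (\<open>fock_extend_tensor\<close>, \<open>clinear_fock_extend\<close>).\<close>

definition fock_extend :: "('h::complex_vector list \<Rightarrow> 'b::complex_vector) \<Rightarrow> 'h fock \<Rightarrow> 'b"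
  where "fock_extend \<phi> f = free_extend \<phi> (rep_fock f)"

lemma free_extend_cong_tensor_eq:
  assumes "multilinear \<phi>" "tensor_eq f g"
  shows "free_extend \<phi> f = free_extend \<phi> g"
proof -
  interpret L: Vector_Spaces.linear scaleC scaleC "free_extend \<phi>"
    by (rule clinear_free_extend)
  have rel: "free_extend \<phi> r = 0" if "r \<in> tensor_relators" for r
  proof -
    have "\<phi> (us @ [x + y] @ vs) = \<phi> (us @ [x] @ vs) + \<phi> (us @ [y] @ vs)"
      and "\<phi> (us @ [c *\<^sub>C x] @ vs) = c *\<^sub>C \<phi> (us @ [x] @ vs)" for us vs x y c
      using assms(1) unfolding multilinear_def
      by (blast dest: clinear_add, blast dest: clinear_scale)
    then show ?thesis
      using that
      by (auto simp: tensor_relators_def L.diff L.add L.scale scaleC_one)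
  qed
  have "free_extend \<phi> (f - g) = 0"
    using assms(2) unfolding tensor_eq_def
    by (induction rule: complex_vector.span_induct_alt) (simp_all add: L.zero L.add L.scale rel)
  then show ?thesis by (simp add: L.diff)
qed

lemma fock_extend_abs:
  assumes "multilinear \<phi>"
  shows "fock_extend \<phi> (abs_fock f) = free_extend \<phi> f"
  unfolding fock_extend_def
  by (rule free_extend_cong_tensor_eq[OF assms])
    (rule Quotient3_rep_abs[OF Quotient3_fock], simp add: tensor_eq_def complex_vector.span_zero)

lemma fock_extend_tensor:
  assumes "multilinear \<phi>"
  shows "fock_extend \<phi> (tensor xs) = \<phi> xs"
  by (simp add: tensor.abs_eq fock_extend_abs[OF assms] scaleC_one)

lemma clinear_fock_extend:
  assumes "multilinear \<phi>"
  shows "clinear (fock_extend \<phi>)"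
proof (rule clinearI)
  fix f g :: "'a fock" and c
  obtain f' where f: "f = abs_fock f'" by (metis fock.abs_eq_iff Quotient3_abs_rep[OF Quotient3_fock])
  obtain g' where g: "g = abs_fock g'" by (metis fock.abs_eq_iff Quotient3_abs_rep[OF Quotient3_fock])
  show "fock_extend \<phi> (f + g) = fock_extend \<phi> f + fock_extend \<phi> g"
    by (simp add: f g plus_fock.abs_eq fock_extend_abs[OF assms] clinear_add[OF clinear_free_extend])
  show "fock_extend \<phi> (c *\<^sub>C f) = c *\<^sub>C fock_extend \<phi> f"
    by (simp add: f scaleC_fock.abs_eq fock_extend_abs[OF assms] clinear_scale[OF clinear_free_extend])
qed

lemma fock_eq_combination: "\<exists>r. f = free_extend tensor r"
proof -
  obtain r where r: "f = abs_fock r" by (metis Quotient3_abs_rep[OF Quotient3_fock])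
  have *: "clinear (abs_fock :: ('a list \<Rightarrow>\<^sub>0 complex) \<Rightarrow> _)"
    by (rule clinearI) (simp_all add: plus_fock.abs_eq scaleC_fock.abs_eq)
  then interpret A: Vector_Spaces.linear scaleC scaleC "abs_fock :: ('a list \<Rightarrow>\<^sub>0 complex) \<Rightarrow> _" .
  have "f = abs_fock (free_extend (\<lambda>k. Poly_Mapping.single k 1) r)"
    by (simp add: r free_extend_basis)
  also have "\<dots> = free_extend tensor r"
    by (simp add: free_extend_def A.sum A.scale tensor.abs_eq)
  finally show ?thesis by blast
qed


subsection \<open>The undeformed inner product\<close>

definition inner_words :: "'h::complex_hilbert list \<Rightarrow> 'h list \<Rightarrow> complex"
  where "inner_words xs ys =
    (if length xs = length ys then \<Prod>i<length xs. cinner (xs ! i) (ys ! i) else 0)"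

text \<open>The inner \<^const>\<open>fock_extend\<close> is linear in \<open>f\<close> and conjugated, so \<open>inner0\<close> is antilinear in \<open>f\<close>.\<close>

definition inner0 :: "'h::complex_hilbert fock \<Rightarrow> 'h fock \<Rightarrow> complex"
  where "inner0 f g = fock_extend (\<lambda>ys. cnj (fock_extend (\<lambda>xs. inner_words ys xs) f)) g"

lemma inner_words_commute: "inner_words xs ys = cnj (inner_words ys xs)"
  by (auto simp: inner_words_def cnj_prod intro!: prod.cong cinner_commute)

lemma inner_words_insert:
  "inner_words ws (us @ [x] @ vs) =
    (if length ws = length us + 1 + length vs
     then (\<Prod>i\<in>{..<length ws} - {length us}. cinner (ws ! i) ((us @ [0] @ vs) ! i))
       * cinner (ws ! length us) x else 0)"
proof (cases "length ws = length us + 1 + length vs")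
  case True
  have "inner_words ws (us @ [x] @ vs)
      = (\<Prod>i<length ws. cinner (ws ! i) ((us @ [x] @ vs) ! i))"
    using True by (simp add: inner_words_def)
  also have "\<dots> = cinner (ws ! length us) ((us @ [x] @ vs) ! length us)
      * (\<Prod>i\<in>{..<length ws} - {length us}. cinner (ws ! i) ((us @ [x] @ vs) ! i))"
    using True by (intro prod.remove) auto
  also have "(\<Prod>i\<in>{..<length ws} - {length us}. cinner (ws ! i) ((us @ [x] @ vs) ! i))
      = (\<Prod>i\<in>{..<length ws} - {length us}. cinner (ws ! i) ((us @ [0] @ vs) ! i))"
    by (intro prod.cong) (auto simp: nth_append nth_Cons')
  finally show ?thesis using True by (simp add: mult.commute)
qed (simp add: inner_words_def)

lemma multilinear_inner_words: "multilinear (inner_words ws)"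
  unfolding multilinear_def inner_words_insert
  by (intro allI clinearI)
    (auto simp: cinner_add_right cinner_scaleC_right scaleC_complex_def algebra_simps)

lemma multilinear_inner0: "multilinear (\<lambda>ys. cnj (fock_extend (inner_words ys) f))"
proof -
  obtain r where r: "f = free_extend tensor r" using fock_eq_combination by blast
  have ext: "cnj (fock_extend (inner_words ys) f) = (\<Sum>k\<in>Poly_Mapping.keys r. cnj (Poly_Mapping.lookup r k) * inner_words k ys)"
    for ys
  proof -
    interpret L: Vector_Spaces.linear scaleC scaleC "fock_extend (inner_words ys)"
      by (rule clinear_fock_extend[OF multilinear_inner_words])
    have "fock_extend (inner_words ys) f = (\<Sum>k\<in>Poly_Mapping.keys r. Poly_Mapping.lookup r k * inner_words ys k)"
      by (simp add: r free_extend_def[of tensor] L.sum L.scale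
          fock_extend_tensor[OF multilinear_inner_words] scaleC_complex_def)
    then show ?thesis
      by (simp add: cnj_sum inner_words_commute[of _ ys])
  qed
  have "clinear (\<lambda>x. inner_words k (us @ [x] @ vs))" for k us vs
    using multilinear_inner_words unfolding multilinear_def by blast
  note lin = clinear_add[OF this] clinear_scale[OF this]
  show ?thesis
    unfolding multilinear_def ext
    by (intro allI clinearI)
      (simp_all only: lin scaleC_complex_def distrib_left sum.distrib sum_distrib_left
        mult.left_commute)
qed

lemma inner0_tensor:
  "inner0 (tensor xs) (tensor ys) =
    (if length xs = length ys then \<Prod>i<length xs. cinner (xs ! i) (ys ! i) else 0)"
  by (simp add: inner0_def fock_extend_tensor[OF multilinear_inner0]
      fock_extend_tensor[OF multilinear_inner_words] inner_words_commute[of ys, symmetric]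
      inner_words_commute[of xs, symmetric] inner_words_def[symmetric]
      flip: inner_words_commute[of xs ys])

lemma clinear_inner0_right: "clinear (inner0 f)"
  unfolding inner0_def[abs_def] by (rule clinear_fock_extend[OF multilinear_inner0])

lemma inner0_commute: "inner0 f g = cnj (inner0 g f)"
proof -
  have *: "inner0 (free_extend tensor r) (free_extend tensor s)
    = (\<Sum>k\<in>Poly_Mapping.keys s. \<Sum>j\<in>Poly_Mapping.keys r. Poly_Mapping.lookup s k * (cnj (Poly_Mapping.lookup r j) * inner_words j k))"
    for r s :: "'a list \<Rightarrow>\<^sub>0 complex"
  proof -
    interpret M: Vector_Spaces.linear scaleC scaleC "inner0 (free_extend tensor r)"
      by (rule clinear_inner0_right)
    have "inner0 (free_extend tensor r) (tensor k)
        = (\<Sum>j\<in>Poly_Mapping.keys r. cnj (Poly_Mapping.lookup r j) * inner_words j k)" for k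
    proof -
      interpret L: Vector_Spaces.linear scaleC scaleC "fock_extend (inner_words k)"
        by (rule clinear_fock_extend[OF multilinear_inner_words])
      show ?thesis
        by (simp add: inner0_def fock_extend_tensor[OF multilinear_inner0]
            free_extend_def[of tensor] L.sum L.scale
            fock_extend_tensor[OF multilinear_inner_words] scaleC_complex_def
            cnj_sum inner_words_commute[of _ k])
    qed
    then show ?thesis
      by (simp add: free_extend_def[of tensor s] M.sum M.scale scaleC_complex_def sum_distrib_left)
  qed
  obtain r s where "f = free_extend tensor r" "g = free_extend tensor s"
    using fock_eq_combination by metis
  then show ?thesis
    by (simp add: * cnj_sum mult.left_commute flip: inner_words_commute)
       (rule sum.swap)
qed


section \<open>The Coxeter groups of type D\<close>

text \<open>Permutations of \<open>{\<plusminus>1,\<dots>,\<plusminus>n}\<close> are extended to all integers by the identity.\<close>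

definition signed_perms :: "nat \<Rightarrow> (int \<Rightarrow> int) monoid"
  where "signed_perms n =
    \<lparr>carrier = {\<sigma>. \<sigma> permutes ({- int n..int n} - {0}) \<and> (\<forall>k. \<sigma> (- k) = - \<sigma> k)},
     monoid.mult = (\<circ>), one = id\<rparr>"

definition pi_gen :: "nat \<Rightarrow> int \<Rightarrow> int"
  where "pi_gen i = Transposition.transpose (int i) (int i + 1) \<circ> Transposition.transpose (- int i) (- int i - 1)"

definition pi_bar :: "nat \<Rightarrow> int \<Rightarrow> int"
  where "pi_bar n = Transposition.transpose (int n) (- int n)"

definition pi_hat :: "nat \<Rightarrow> int \<Rightarrow> int"
  where "pi_hat n = pi_bar n \<circ> pi_gen (n - 1) \<circ> pi_bar n"

text \<open>The generator written \<open>\<pi>\<close>-hat with index \<open>n - 1\<close> is \<open>pi_hat n\<close>. The groups for \<open>n \<le> 1\<close>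
  have no generators and are trivial.\<close>

definition type_D_generators :: "nat \<Rightarrow> (int \<Rightarrow> int) set"
  where "type_D_generators n = (if n \<ge> 2 then pi_gen ` {1..n - 1} \<union> {pi_hat n} else {})"

definition type_D :: "nat \<Rightarrow> (int \<Rightarrow> int) set"
  where "type_D n = generate (signed_perms n) (type_D_generators n)"

definition type_D_length :: "nat \<Rightarrow> (int \<Rightarrow> int) \<Rightarrow> nat"
  where "type_D_length n \<sigma> =
    (LEAST k. \<exists>ws. length ws = k \<and> set ws \<subseteq> type_D_generators n \<and> foldr (\<circ>) ws id = \<sigma>)"

text \<open>The left action on simple tensors: the letter in position \<open>i\<close> of the result is
  \<open>x\<^sub>k\<close> with \<open>k = \<sigma>\<inverse> i\<close>, where \<open>x\<close> at a negative index \<open>- k\<close> stands for \<open>J x\<^sub>k\<close>.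
  The lemmas \<open>act_word_pi_gen\<close>, \<open>act_word_pi_hat\<close>, \<open>act_word_id\<close> and \<open>act_word_comp\<close> show that this is
  the action determined by the prescribed action of the generators.\<close>

definition signed_letter :: "('h \<Rightarrow> 'h) \<Rightarrow> 'h list \<Rightarrow> int \<Rightarrow> 'h"
  where "signed_letter J xs k = (if k > 0 then xs ! (nat k - 1) else J (xs ! (nat (- k) - 1)))"

definition act_word :: "('h \<Rightarrow> 'h) \<Rightarrow> (int \<Rightarrow> int) \<Rightarrow> 'h list \<Rightarrow> 'h list"
  where "act_word J \<sigma> xs =
    map (\<lambda>i. signed_letter J xs (inv_into UNIV \<sigma> (int i + 1))) [0..<length xs]"

lemma length_act_word [simp]: "length (act_word J \<sigma> xs) = length xs"
  by (simp add: act_word_def)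

lemma act_word_id: "act_word J id xs = xs"
  by (rule nth_equalityI) (simp_all add: act_word_def signed_letter_def inv_id nat_add_distrib)

lemma signed_perm_inv:
  assumes "\<sigma> \<in> carrier (signed_perms n)"
  shows "inv_into UNIV \<sigma> \<in> carrier (signed_perms n)"
proof -
  have p: "\<sigma> permutes ({- int n..int n} - {0})" and o: "\<sigma> (- k) = - \<sigma> k" for k
    using assms by (auto simp: signed_perms_def)
  have "inv_into UNIV \<sigma> (- k) = - inv_into UNIV \<sigma> k" for k
    by (metis p o permutes_inverses)
  then show ?thesis using permutes_inv[OF p] by (simp add: signed_perms_def)
qed

lemma group_signed_perms: "group (signed_perms n)"
proof (rule groupI)
  fix \<sigma> assume "\<sigma> \<in> carrier (signed_perms n)"
  then show "\<exists>\<tau>\<in>carrier (signed_perms n). \<tau> \<otimes>\<^bsub>signed_perms n\<^esub> \<sigma> = \<one>\<^bsub>signed_perms n\<^esub>"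
    by (intro bexI[OF _ signed_perm_inv])
      (auto simp: signed_perms_def dest: permutes_inv_o)
qed (auto simp: signed_perms_def permutes_id comp_assoc intro: permutes_compose)

lemma signed_letter_uminus:
  assumes "\<And>x. J (J x) = x" "k \<noteq> 0"
  shows "signed_letter J xs (- k) = J (signed_letter J xs k)"
  using assms by (auto simp: signed_letter_def)

lemma signed_letter_act_word:
  assumes J: "\<And>x. J (J x) = x" and \<tau>: "\<tau> \<in> carrier (signed_perms (length xs))"
    and k: "k \<in> {- int (length xs)..int (length xs)} - {0}"
  shows "signed_letter J (act_word J \<tau> xs) k = signed_letter J xs (inv_into UNIV \<tau> k)"
proof -
  let ?i = "inv_into UNIV \<tau>"
  have i: "?i permutes ({- int (length xs)..int (length xs)} - {0})" "\<And>k. ?i (- k) = - ?i k"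
    using signed_perm_inv[OF \<tau>] by (auto simp: signed_perms_def)
  have pos: "signed_letter J (act_word J \<tau> xs) l = signed_letter J xs (?i l)"
    if "0 < l" "l \<le> int (length xs)" for l
  proof -
    have m: "nat l - 1 < length xs" "int (nat l - 1) + 1 = l" using that by linarith+
    have "signed_letter J (act_word J \<tau> xs) l = act_word J \<tau> xs ! (nat l - 1)"
      using that by (simp add: signed_letter_def)
    also have "\<dots> = signed_letter J xs (?i (int (nat l - 1) + 1))"
      using m(1) by (simp add: act_word_def del: of_nat_diff)
    finally show ?thesis by (simp only: m(2))
  qed
  show ?thesis
  proof (cases "k > 0")
    case True
    then show ?thesis using pos k by simp
  next
    case False
    then have n: "0 < - k" "- k \<le> int (length xs)" using k by auto
    have "?i k \<noteq> 0"
      using permutes_in_image[OF i(1), of k] k by auto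
    then show ?thesis
      using pos[OF n] n signed_letter_uminus[OF J, where k = k and xs = "act_word J \<tau> xs"]
        signed_letter_uminus[OF J, where k = "?i k" and xs = xs]
      by (metis J i(2) neg_equal_0_iff_equal less_irrefl)
  qed
qed

lemma act_word_comp:
  assumes J: "\<And>x. J (J x) = x"
    and \<sigma>: "\<sigma> \<in> carrier (signed_perms (length xs))"
    and \<tau>: "\<tau> \<in> carrier (signed_perms (length xs))"
  shows "act_word J (\<sigma> \<circ> \<tau>) xs = act_word J \<sigma> (act_word J \<tau> xs)"
proof (rule nth_equalityI)
  fix i assume "i < length (act_word J (\<sigma> \<circ> \<tau>) xs)"
  then have i: "i < length xs" by simp
  have "bij \<sigma>" "bij \<tau>" using \<sigma> \<tau> by (auto simp: signed_perms_def permutes_bij)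
  then have "inv_into UNIV (\<sigma> \<circ> \<tau>) = inv_into UNIV \<tau> \<circ> inv_into UNIV \<sigma>" by (rule o_inv_distrib)
  moreover have "inv_into UNIV \<sigma> (int i + 1) \<in> {- int (length xs)..int (length xs)} - {0}"
  proof -
    have "inv_into UNIV \<sigma> permutes ({- int (length xs)..int (length xs)} - {0})"
      using signed_perm_inv[OF \<sigma>] by (simp add: signed_perms_def)
    moreover have "int i + 1 \<in> {- int (length xs)..int (length xs)} - {0}" using i by simp
    ultimately show ?thesis by (simp only: permutes_in_image)
  qed
  ultimately show "act_word J (\<sigma> \<circ> \<tau>) xs ! i = act_word J \<sigma> (act_word J \<tau> xs) ! i"
    using i signed_letter_act_word[OF J \<tau>]
    by (simp add: act_word_def[of _ "\<sigma> \<circ> \<tau>"] act_word_def[of _ \<sigma>])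
qed simp

lemma pi_gen_apply:
  assumes "i \<ge> 1"
  shows "pi_gen i k = (if k = int i then int i + 1 else if k = int i + 1 then int i
    else if k = - int i then - int i - 1 else if k = - int i - 1 then - int i else k)"
proof -
  have i: "int i \<ge> 1" using assms by simp
  consider "k = int i" | "k = int i + 1" | "k = - int i" | "k = - int i - 1"
    | "k \<noteq> int i" "k \<noteq> int i + 1" "k \<noteq> - int i" "k \<noteq> - int i - 1"
    by blast
  then show ?thesis
    using i by cases (simp_all add: pi_gen_def Transposition.transpose_def)
qed

lemma pi_gen_idem:
  assumes "i \<ge> 1"
  shows "pi_gen i \<circ> pi_gen i = id"
proof
  fix k
  have i: "int i \<ge> 1" using assms by simp
  consider "k = int i" | "k = int i + 1" | "k = - int i" | "k = - int i - 1"
    | "k \<noteq> int i" "k \<noteq> int i + 1" "k \<noteq> - int i" "k \<noteq> - int i - 1"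
    by blast
  then show "(pi_gen i \<circ> pi_gen i) k = id k"
    using i by cases (simp_all add: pi_gen_apply[OF assms])
qed

lemma act_word_pi_gen:
  assumes "1 \<le> i" "i < length xs"
  shows "act_word J (pi_gen i) xs = xs[i - 1 := xs ! i, i := xs ! (i - 1)]"
proof (rule nth_equalityI)
  have inv: "inv_into UNIV (pi_gen i) = pi_gen i"
    using pi_gen_idem[OF assms(1)] by (metis inv_unique_comp)
  fix j assume "j < length (act_word J (pi_gen i) xs)"
  then have j: "j < length xs" by simp
  have nth: "act_word J (pi_gen i) xs ! j = signed_letter J xs (pi_gen i (int j + 1))"
    using j by (simp add: act_word_def inv)
  consider "j = i" | "j = i - 1" | "j \<noteq> i" "j \<noteq> i - 1" by blast
  then show "act_word J (pi_gen i) xs ! j = xs[i - 1 := xs ! i, i := xs ! (i - 1)] ! j"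
  proof cases
    case 1
    then have "pi_gen i (int j + 1) = int i" using assms by (simp add: pi_gen_apply)
    with 1 j assms show ?thesis unfolding nth by (simp add: signed_letter_def)
  next
    case 2
    then have "int j + 1 = int i" using assms by simp
    then have "pi_gen i (int j + 1) = int i + 1" using assms by (simp add: pi_gen_apply)
    with 2 j assms show ?thesis unfolding nth by (simp add: signed_letter_def nat_add_distrib)
  next
    case 3
    then have "int j + 1 \<noteq> int i" "int j + 1 \<noteq> int i + 1" using assms by linarith+
    then have "pi_gen i (int j + 1) = int j + 1" using assms by (simp add: pi_gen_apply)
    with 3 j assms show ?thesis unfolding nth by (simp add: signed_letter_def nat_add_distrib)
  qed
qed simp

lemma pi_hat_apply:
  assumes "n \<ge> 2"
  shows "pi_hat n k = (if k = int n then 1 - int n else if k = int n - 1 then - int n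
    else if k = - int n then int n - 1 else if k = 1 - int n then int n else k)"
proof -
  have n: "int n \<ge> 2" using assms by simp
  have pg: "pi_gen (n - Suc 0) l = (if l = int n - 1 then int n else if l = int n then int n - 1
      else if l = 1 - int n then - int n else if l = - int n then 1 - int n else l)" for l
    using pi_gen_apply[of "n - 1" l] assms by simp
  consider "k = int n" | "k = int n - 1" | "k = - int n" | "k = 1 - int n"
    | "k \<noteq> int n" "k \<noteq> int n - 1" "k \<noteq> - int n" "k \<noteq> 1 - int n"
    by blast
  then show ?thesis
    using n
    by cases (simp_all add: pi_hat_def pg pi_bar_def Transposition.transpose_def)
qed

lemma pi_hat_idem:
  assumes "n \<ge> 2"
  shows "pi_hat n \<circ> pi_hat n = id"
proof -
  have "pi_bar n \<circ> pi_bar n = id" by (simp add: pi_bar_def)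
  moreover have "pi_gen (n - 1) \<circ> pi_gen (n - 1) = id"
    using assms by (intro pi_gen_idem) simp
  ultimately show ?thesis
    unfolding pi_hat_def by (metis comp_assoc comp_id)
qed

lemma act_word_pi_hat:
  assumes n: "n = length xs" "n \<ge> 2"
  shows "act_word J (pi_hat n) xs = xs[n - 2 := J (xs ! (n - 1)), n - 1 := J (xs ! (n - 2))]"
proof (rule nth_equalityI)
  have "pi_hat n \<circ> pi_hat n = id" using n(2) by (rule pi_hat_idem)
  then have inv: "inv_into UNIV (pi_hat n) = pi_hat n"
    by (metis inv_unique_comp)
  fix j assume "j < length (act_word J (pi_hat n) xs)"
  then have j: "j < n" using n by simp
  have nth: "act_word J (pi_hat n) xs ! j = signed_letter J xs (pi_hat n (int j + 1))"
    using j n(1)[symmetric] by (simp add: act_word_def inv)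
  consider "j = n - 1" | "j = n - 2" | "j \<noteq> n - 1" "j \<noteq> n - 2" by blast
  then show "act_word J (pi_hat n) xs ! j
      = xs[n - 2 := J (xs ! (n - 1)), n - 1 := J (xs ! (n - 2))] ! j"
  proof cases
    case 1
    then have "int j + 1 = int n" using n by linarith
    then have "pi_hat n (int j + 1) = - int (n - 1)" using n(2) by (simp add: pi_hat_apply)
    moreover have "n - 1 - 1 = n - 2" by simp
    ultimately show ?thesis unfolding nth using 1 j n by (simp add: signed_letter_def del: of_nat_diff)
  next
    case 2
    then have "int j + 1 = int n - 1" using n by linarith
    then have "pi_hat n (int j + 1) = - int n" using n(2) by (simp add: pi_hat_apply)
    then show ?thesis unfolding nth using 2 j n by (simp add: signed_letter_def)
  next
    case 3
    then have "int j + 1 \<noteq> int n" "int j + 1 \<noteq> int n - 1" using n by linarith+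
    then have "pi_hat n (int j + 1) = int j + 1" using n(2) by (simp add: pi_hat_apply)
    with 3 j n show ?thesis unfolding nth by (simp add: signed_letter_def nat_add_distrib)
  qed
qed simp


lemma pi_gen_in_signed_perms:
  assumes "1 \<le> i" "i < n"
  shows "pi_gen i \<in> carrier (signed_perms n)"
proof -
  have "pi_gen i permutes ({- int n..int n} - {0})"
    unfolding pi_gen_def using assms
    by (intro permutes_compose permutes_swap_id) auto
  moreover have "pi_gen i (- k) = - pi_gen i k" for k
    using assms by (auto simp: pi_gen_apply)
  ultimately show ?thesis by (simp add: signed_perms_def)
qed

lemma pi_hat_in_signed_perms:
  assumes "n \<ge> 2"
  shows "pi_hat n \<in> carrier (signed_perms n)"
proof -
  have "pi_gen (n - 1) permutes ({- int n..int n} - {0})"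
    using pi_gen_in_signed_perms[of "n - 1" n] assms by (simp add: signed_perms_def)
  moreover have "pi_bar n permutes ({- int n..int n} - {0})"
    unfolding pi_bar_def using assms by (intro permutes_swap_id) auto
  ultimately have "pi_hat n permutes ({- int n..int n} - {0})"
    unfolding pi_hat_def by (intro permutes_compose)
  moreover have "pi_hat n (- k) = - pi_hat n k" for k
    using assms by (auto simp: pi_hat_apply)
  ultimately show ?thesis by (simp add: signed_perms_def)
qed

lemma type_D_subset: "type_D n \<subseteq> carrier (signed_perms n)"
  unfolding type_D_def
  by (rule group.generate_incl[OF group_signed_perms])
    (auto simp: type_D_generators_def intro!: pi_gen_in_signed_perms pi_hat_in_signed_perms)

lemma finite_type_D: "finite (type_D n)"
proof (rule finite_subset[OF type_D_subset])
  have "finite {\<sigma>. \<sigma> permutes ({- int n..int n} - {0})}"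
    by (rule finite_permutations) simp
  then show "finite (carrier (signed_perms n))"
    by (rule rev_finite_subset) (auto simp: signed_perms_def)
qed

lemma act_word_insert:
  assumes "\<sigma> \<in> carrier (signed_perms (length us + 1 + length vs))"
  shows "\<exists>as bs. (\<forall>x. act_word J \<sigma> (us @ [x] @ vs) = as @ [x] @ bs) \<or>
    (\<forall>x. act_word J \<sigma> (us @ [x] @ vs) = as @ [J x] @ bs)"
proof -
  define n where "n = length us + 1 + length vs"
  define p where "p = int (length us) + 1"
  define i where "i = nat \<bar>\<sigma> p\<bar> - 1"
  define s where "s = (\<sigma> p > 0)"
  let ?\<tau> = "inv_into UNIV \<sigma>"
  let ?w = "act_word J \<sigma> (us @ [undefined] @ vs)"
  have \<sigma>: "\<sigma> permutes ({- int n..int n} - {0})" "\<And>k. \<sigma> (- k) = - \<sigma> k"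
    using assms by (auto simp: signed_perms_def n_def)
  have \<tau>: "?\<tau> permutes ({- int n..int n} - {0})" "\<And>k. ?\<tau> (- k) = - ?\<tau> k"
    using signed_perm_inv[OF assms] by (auto simp: signed_perms_def n_def)
  have p: "p > 0" "p \<in> {- int n..int n} - {0}" by (auto simp: p_def n_def)
  have "\<sigma> p \<in> {- int n..int n} - {0}"
    using p(2) by (simp only: permutes_in_image[OF \<sigma>(1)])
  then have i: "i < n" "int i + 1 = \<bar>\<sigma> p\<bar>" by (auto simp: i_def)
  have inv: "?\<tau> (\<sigma> k) = k" for k by (rule permutes_inverses(2)[OF \<sigma>(1)])
  have \<tau>i: "?\<tau> (int i + 1) = (if s then p else - p)"
    using i(2) inv[of p] \<tau>(2)[of "\<sigma> p"] by (auto simp: s_def abs_if)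
  have upd: "act_word J \<sigma> (us @ [x] @ vs) = ?w[i := (if s then x else J x)]" for x
  proof (rule nth_equalityI)
    fix j assume "j < length (act_word J \<sigma> (us @ [x] @ vs))"
    then have j: "j < n" by (simp add: n_def)
    have nth: "act_word J \<sigma> (us @ [y] @ vs) ! j = signed_letter J (us @ [y] @ vs) (?\<tau> (int j + 1))"
      for y using j by (simp add: act_word_def n_def del: upt_Suc)
    show "act_word J \<sigma> (us @ [x] @ vs) ! j = ?w[i := (if s then x else J x)] ! j"
    proof (cases "j = i")
      case True
      have "signed_letter J (us @ [x] @ vs) (if s then p else - p) = (if s then x else J x)"
        using p(1) by (simp add: signed_letter_def p_def nat_add_distrib)
      then show ?thesis using True i(1) nth[of x] by (simp add: \<tau>i n_def)
    next
      case False
      have neq: "?\<tau> (int j + 1) \<noteq> p" "?\<tau> (int j + 1) \<noteq> - p"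
      proof -
        have "\<sigma> (?\<tau> (int j + 1)) = int j + 1" by (rule permutes_inverses(1)[OF \<sigma>(1)])
        then show "?\<tau> (int j + 1) \<noteq> p" "?\<tau> (int j + 1) \<noteq> - p"
          using False i(2) \<sigma>(2)[of p] by auto
      qed
      have "?\<tau> (int j + 1) \<in> {- int n..int n} - {0}"
        using j by (simp only: permutes_in_image[OF \<tau>(1)]) simp
      then have "signed_letter J (us @ [x] @ vs) (?\<tau> (int j + 1))
          = signed_letter J (us @ [undefined] @ vs) (?\<tau> (int j + 1))"
        using neq unfolding signed_letter_def p_def
        by (auto simp: nth_append nth_Cons')
      then show ?thesis using False nth[of x] nth[of undefined] by simp
    qed
  qed (simp add: n_def)
  define as where "as = take i ?w"
  define bs where "bs = drop (Suc i) ?w"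
  have "?w[i := y] = as @ [y] @ bs" for y
    using i(1) by (simp add: upd_conv_take_nth_drop n_def as_def bs_def)
  then have "act_word J \<sigma> (us @ [x] @ vs) = as @ [if s then x else J x] @ bs" for x
    by (rule trans[OF upd])
  then show ?thesis by (cases s) (simp_all only: if_True if_False, blast+)
qed


section \<open>The deformed inner product and the operators on Fock space\<close>

text \<open>\<open>type_D_symmetrizer q J\<close> is the direct sum over \<open>n\<close> of the sums over \<open>\<sigma>\<close> in \<open>D(n)\<close> of
  \<open>q\<close> to the power of the length of \<open>\<sigma>\<close>, times \<open>\<sigma>\<close>; here \<open>n = length xs\<close>.\<close>

definition type_D_symmetrizer ::
    "real \<Rightarrow> ('h::complex_hilbert \<Rightarrow> 'h) \<Rightarrow> 'h fock \<Rightarrow> 'h fock"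
  where "type_D_symmetrizer q J = fock_extend (\<lambda>xs. \<Sum>\<sigma>\<in>type_D (length xs).
    complex_of_real (q ^ type_D_length (length xs) \<sigma>) *\<^sub>C tensor (act_word J \<sigma> xs))"

lemma multilinear_symmetrizer:
  assumes "clinear J"
  shows "multilinear (\<lambda>xs. \<Sum>\<sigma>\<in>type_D (length xs).
    complex_of_real (q ^ type_D_length (length xs) \<sigma>) *\<^sub>C tensor (act_word J \<sigma> xs))"
  unfolding multilinear_def
proof (intro allI)
  fix us vs :: "'a list"
  let ?n = "length us + 1 + length vs"
  have lin: "clinear (\<lambda>x. tensor (act_word J \<sigma> (us @ [x] @ vs)))" if \<sigma>: "\<sigma> \<in> type_D ?n" for \<sigma>
  proof -
    have t: "clinear (\<lambda>x. tensor (as @ [x] @ bs))" for as bs :: "'a list"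
      using multilinear_tensor unfolding multilinear_def by blast
    have tJ: "clinear (\<lambda>x. tensor (as @ [J x] @ bs))" for as bs :: "'a list"
      by (rule clinearI)
        (simp_all only: clinear_add[OF assms] clinear_scale[OF assms]
          clinear_add[OF t] clinear_scale[OF t])
    have "\<sigma> \<in> carrier (signed_perms ?n)" using \<sigma> type_D_subset by blast
    from act_word_insert[OF this, of J] show ?thesis
      using t tJ by auto
  qed
  have len: "length (us @ [x] @ vs) = ?n" for x by simp
  show "clinear (\<lambda>x. \<Sum>\<sigma>\<in>type_D (length (us @ [x] @ vs)).
    complex_of_real (q ^ type_D_length (length (us @ [x] @ vs)) \<sigma>) *\<^sub>C
      tensor (act_word J \<sigma> (us @ [x] @ vs)))"
    unfolding len
  proof (rule clinearI)
    fix x y :: 'a and c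
    show "(\<Sum>\<sigma>\<in>type_D ?n. complex_of_real (q ^ type_D_length ?n \<sigma>) *\<^sub>C
        tensor (act_word J \<sigma> (us @ [x + y] @ vs)))
      = (\<Sum>\<sigma>\<in>type_D ?n. complex_of_real (q ^ type_D_length ?n \<sigma>) *\<^sub>C
          tensor (act_word J \<sigma> (us @ [x] @ vs)))
        + (\<Sum>\<sigma>\<in>type_D ?n. complex_of_real (q ^ type_D_length ?n \<sigma>) *\<^sub>C
          tensor (act_word J \<sigma> (us @ [y] @ vs)))"
      unfolding sum.distrib[symmetric]
      by (rule sum.cong[OF refl]) (simp only: clinear_add[OF lin] scaleC_add_right)
    show "(\<Sum>\<sigma>\<in>type_D ?n. complex_of_real (q ^ type_D_length ?n \<sigma>) *\<^sub>C
        tensor (act_word J \<sigma> (us @ [c *\<^sub>C x] @ vs)))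
      = c *\<^sub>C (\<Sum>\<sigma>\<in>type_D ?n. complex_of_real (q ^ type_D_length ?n \<sigma>) *\<^sub>C
          tensor (act_word J \<sigma> (us @ [x] @ vs)))"
      unfolding complex_vector.scale_sum_right
      by (rule sum.cong[OF refl])
        (simp only: clinear_scale[OF lin] scaleC_scaleC mult.commute)
  qed
qed

lemma type_D_symmetrizer_tensor:
  assumes "clinear J"
  shows "type_D_symmetrizer q J (tensor xs) = (\<Sum>\<sigma>\<in>type_D (length xs).
    complex_of_real (q ^ type_D_length (length xs) \<sigma>) *\<^sub>C tensor (act_word J \<sigma> xs))"
  unfolding type_D_symmetrizer_def by (rule fock_extend_tensor[OF multilinear_symmetrizer[OF assms]])

definition inner_q :: "real \<Rightarrow> ('h::complex_hilbert \<Rightarrow> 'h) \<Rightarrow> 'h fock \<Rightarrow> 'h fock \<Rightarrow> complex"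
  where "inner_q q J f g = inner0 f (type_D_symmetrizer q J g)"

definition creation :: "'h::complex_hilbert \<Rightarrow> 'h fock \<Rightarrow> 'h fock"
  where "creation x = fock_extend (\<lambda>xs. tensor (x # xs))"

lemma multilinear_creation: "multilinear (\<lambda>xs. tensor (x # xs))"
  unfolding multilinear_def
proof (intro allI)
  fix us vs :: "'a list"
  show "clinear (\<lambda>y. tensor (x # us @ [y] @ vs))"
    using multilinear_tensor[unfolded multilinear_def, rule_format, of "x # us" vs] by simp
qed

lemma creation_tensor: "creation x (tensor xs) = tensor (x # xs)"
  by (simp add: creation_def fock_extend_tensor[OF multilinear_creation])

text \<open>The adjoint of \<^term>\<open>creation x\<close> on the algebraic Fock space; it is unique when \<^term>\<open>\<bar>q\<bar> < 1\<close>,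
  because \<^term>\<open>inner_q q J\<close> is then positive definite.\<close>

definition annihilation :: "real \<Rightarrow> ('h::complex_hilbert \<Rightarrow> 'h) \<Rightarrow> 'h \<Rightarrow> 'h fock \<Rightarrow> 'h fock"
  where "annihilation q J x =
    (SOME d. \<forall>f g. inner_q q J (d f) g = inner_q q J f (creation x g))"

definition gaussian :: "real \<Rightarrow> ('h::complex_hilbert \<Rightarrow> 'h) \<Rightarrow> 'h \<Rightarrow> 'h fock \<Rightarrow> 'h fock"
  where "gaussian q J x f = annihilation q J x f + creation x f"

text \<open>The vacuum moments of an operator only involve the vectors \<open>G\<^sup>n \<Omega>\<close>, which for
  \<^term>\<open>gaussian q J x\<close> lie in the algebraic Fock space.\<close>

definition is_vacuum_distribution ::
    "real \<Rightarrow> ('h::complex_hilbert \<Rightarrow> 'h) \<Rightarrow> ('h fock \<Rightarrow> 'h fock) \<Rightarrow> real measure \<Rightarrow> bool"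
  where "is_vacuum_distribution q J G \<mu> \<longleftrightarrow>
    prob_space \<mu> \<and> sets \<mu> = sets borel \<and>
    (\<forall>n. integrable \<mu> (\<lambda>t. t ^ n) \<and>
      inner_q q J \<Omega> ((G ^^ n) \<Omega>) = complex_of_real (\<integral>t. t ^ n \<partial>\<mu>))"


section \<open>The orthogonal polynomials and their measure\<close>

definition q_number :: "real \<Rightarrow> nat \<Rightarrow> real"
  where "q_number q n = (\<Sum>k<n. q ^ k)"

fun orth_poly :: "real \<Rightarrow> nat \<Rightarrow> real poly"
  where
    "orth_poly q 0 = 1"
  | "orth_poly q (Suc 0) = [:0, 1:]"
  | "orth_poly q (Suc (Suc 0)) = [:0, 1:] ^ 2 - 1"
  | "orth_poly q (Suc (Suc (Suc n))) = [:0, 1:] * orth_poly q (n + 2)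
      - smult (q_number q (n + 2) * (1 + q ^ (n + 1))) (orth_poly q (n + 1))"

lemma orth_poly_recursion:
  assumes "n \<ge> 2"
  shows "[:0, 1:] * orth_poly q n =
    orth_poly q (n + 1) + smult (q_number q n * (1 + q ^ (n - 1))) (orth_poly q (n - 1))"
proof -
  obtain m where "n = m + 2" using assms by (metis le_add_diff_inverse2)
  then show ?thesis by simp
qed

definition monic_orthogonal_polynomials :: "real measure \<Rightarrow> (nat \<Rightarrow> real poly) \<Rightarrow> bool"
  where "monic_orthogonal_polynomials \<mu> p \<longleftrightarrow>
    (\<forall>n. degree (p n) = n \<and> lead_coeff (p n) = 1) \<and>
    (\<forall>n. integrable \<mu> (\<lambda>t. t ^ n)) \<and>
    (\<forall>m n. m \<noteq> n \<longrightarrow> (\<integral>t. poly (p m) t * poly (p n) t \<partial>\<mu>) = 0) \<and>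
    (\<forall>n. (\<integral>t. (poly (p n) t)\<^sup>2 \<partial>\<mu>) > 0)"

text \<open>For \<^term>\<open>\<bar>q\<bar> < 1\<close> the Jacobi parameters of \<^term>\<open>orth_poly q\<close> are positive and bounded, so
  there is exactly one such measure.\<close>

definition mu_q :: "real \<Rightarrow> real measure"
  where "mu_q q = (THE \<mu>. prob_space \<mu> \<and> sets \<mu> = sets borel \<and>
    monic_orthogonal_polynomials \<mu> (orth_poly q))"

end

theory Submission
  imports Defs "HOL-Real_Asymp.Real_Asymp"
begin

text \<open>Both sides of the theorem have the same moments, because both obey one three-term recursion. Let
\<open>a\<^sub>1 = 1\<close> and \<open>a\<^sub>n = [n]\<^sub>q (1 + q\<^bsup>n-1\<^esup>)\<close> for \<open>n \<ge> 2\<close> (\<open>jacobi_q\<close>), and let \<open>U\<^sub>n\<close> be the \<open>n\<close>-fold tensor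
power of \<open>x\<close>. On Fock space \<open>G U\<^sub>n = U\<^sub>n\<^sub>+\<^sub>1 + a\<^sub>n U\<^sub>n\<^sub>-\<^sub>1\<close>, and the orthogonal polynomials satisfy
\<open>t P\<^sub>n = P\<^sub>n\<^sub>+\<^sub>1 + a\<^sub>n P\<^sub>n\<^sub>-\<^sub>1\<close>, where the last term is absent for \<open>n = 0\<close>. Hence \<open>G\<^sup>n \<Omega>\<close> has the same coefficients with respect to the \<open>U\<^sub>k\<close> as \<open>t\<^sup>n\<close> with
respect to the \<open>P\<^sub>k\<close>, namely weighted counts of nearest-neighbour paths (\<open>path_weight\<close>). Pairing with
the vacuum, respectively integrating against \<open>\<mu>\<^sub>q\<close>, leaves only the coefficient at \<open>k = 0\<close>.

The recursion on Fock space comes from the Coxeter group. The permutations in \<open>D(n)\<close> that fix \<open>1\<close> form a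
copy of \<open>D(n-1)\<close>, and each left coset has a unique representative \<open>w\<^sub>k\<close> of minimal length, determined by
\<open>k = w\<^sub>k(1)\<close>, which ranges over \<open>\<plusminus>1,\<dots>,\<plusminus>n\<close> if \<open>n \<ge> 2\<close>. Lengths add along \<open>\<sigma> = w\<^sub>k \<tau>\<close> (\<open>type_D_length_coset\<close>). Expanding
\<open>\<langle>y\<^sub>1 \<otimes> \<dots> \<otimes> y\<^sub>n, x \<otimes> g\<rangle>\<^sub>q\<close> along this decomposition gives an explicit adjoint of the creation operator as a sum
over these \<open>k\<close> (\<open>inner_q_adjoint_word\<close>): the term of \<open>k > 0\<close> removes \<open>y\<^sub>k\<close>; the term of \<open>k < 0\<close> removes
\<open>y\<^sub>-\<^sub>k\<close>, pairs \<open>x\<close> with its conjugate \<open>J y\<^sub>-\<^sub>k\<close>, and conjugates the last remaining letter. If all letters are \<open>x\<close> and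
\<open>J x = \<plusminus>x\<close>, the two signs of a term with \<open>k < 0\<close> cancel, so that every term is \<open>U\<^sub>n\<^sub>-\<^sub>1\<close> times \<open>q\<close> to the
length of \<open>w\<^sub>k\<close>, and these powers add up to \<open>a\<^sub>n\<close> (\<open>adjoint_word_replicate\<close>). The annihilation operator is
some adjoint of the creation operator; the moments are computed with \<open>G\<close> moved across the inner
product only, so that the result depends on nothing but the adjoint relation.

It remains to see that \<open>\<mu>\<^sub>q\<close>, defined by a description operator, exists and is unique: Favard's theorem
for bounded Jacobi parameters (\<open>favard\<close>). Let \<open>L\<close> be the functional on polynomials that reads off the coefficient of
\<open>P\<^sub>0\<close>. It is positive on squares, and \<open>L(t\<^sup>2 s\<^sup>2) \<le> C\<^sup>2 L(s\<^sup>2)\<close> with \<open>C\<^sup>2\<close> a bound of \<open>4 a\<^sub>n\<close>, because a Jacobi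
matrix is then bounded by \<open>C\<close>. So \<open>L\<close> is nonnegative on all products of powers of \<open>C + t\<close> and \<open>C - t\<close>. After
rescaling to \<open>[0, 1]\<close> these are the Bernstein polynomials; they turn \<open>L\<close> into discrete probability
measures, and a weak limit of these represents \<open>L\<close> (\<open>hausdorff_moment_problem\<close>). Uniqueness holds since the
even moments are at most \<open>C\<^bsup>2n\<^esup>\<close>, so that the characteristic function is the sum of its moment series
(\<open>moment_determinate\<close>).\<close>


section \<open>Generators acting on minimal coset representatives\<close>

text \<open>The embedding of signed permutations of \<open>{\<plusminus>1,\<dots>,\<plusminus>m}\<close> as the signed permutations of
\<open>{\<plusminus>1,\<dots>,\<plusminus>(m+1)}\<close> that fix \<open>\<plusminus>1\<close>: all other indices move one step away from zero.\<close>

definition tail_shift :: "(int \<Rightarrow> int) \<Rightarrow> int \<Rightarrow> int"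
  where "tail_shift v j = (if j \<in> {-1, 0, 1} then j
    else v (j - sgn j) + sgn (v (j - sgn j)))"

definition coset_tail :: "nat \<Rightarrow> int \<Rightarrow> int \<Rightarrow> int"
  where "coset_tail n k j =
    (if j \<le> \<bar>k\<bar> then if k < 0 \<and> j = int n then 1 - j else j - 1
     else if k < 0 \<and> j = int n then - j else j)"

text \<open>The shortest element of the coset of all \<open>\<sigma>\<close> in \<open>D(n)\<close> with \<open>\<sigma>(1) = k\<close>. It lists the absolute values other
than \<open>\<bar>k\<bar>\<close> in increasing order at the positions \<open>2,\<dots>,n\<close>. Elements of \<open>D(n)\<close> change an even number of
signs, so for negative \<open>k\<close> exactly one more sign is needed, and it costs nothing at the last position.\<close>

definition coset_rep :: "nat \<Rightarrow> int \<Rightarrow> int \<Rightarrow> int"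
  where "coset_rep n k j =
    (if 1 < j then coset_tail n k j else if j < - 1 then - coset_tail n k (- j) else j * k)"

lemma eq_if_odd_and_eq_on_pos:
  fixes f g :: "int \<Rightarrow> int"
  assumes "\<And>j. f (- j) = - f j" "\<And>j. g (- j) = - g j" "\<And>j. 0 < j \<Longrightarrow> f j = g j"
  shows "f = g"
proof
  fix j
  have "f 0 = 0" "g 0 = 0" using assms(1)[of 0] assms(2)[of 0] by simp_all
  then show "f j = g j"
    using assms(1)[of "-j"] assms(2)[of "-j"] assms(3)[of "-j"] assms(3)[of j] by (cases j "0::int" rule: linorder_cases) auto
qed

lemma coset_rep_odd: "coset_rep n k (- j) = - coset_rep n k j"
  by (auto simp: coset_rep_def)

lemma pi_gen_odd: "i \<ge> 1 \<Longrightarrow> pi_gen i (- j) = - pi_gen i j"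
  by (auto simp: pi_gen_apply)

lemma pi_hat_odd: "n \<ge> 2 \<Longrightarrow> pi_hat n (- j) = - pi_hat n j"
  by (auto simp: pi_hat_apply)

lemma coset_rep_pos:
  "0 < j \<Longrightarrow> coset_rep n k j = (if j = 1 then k else coset_tail n k j)"
  by (auto simp: coset_rep_def)

text \<open>Here and in the next lemma the generator leads from one representative to one whose length is greater by
one. The image of \<open>1\<close> climbs from \<open>1\<close> to \<open>n\<close> and from \<open>- n\<close> to \<open>- 1\<close>; in between, \<open>pi_hat n\<close> takes \<open>n - 1\<close> to \<open>- n\<close>
and \<open>n\<close> to \<open>1 - n\<close>, which is the fork of the Coxeter diagram. In the lemmas after that the generator leaves \<open>k\<close> alone and can be moved to the right of the
representative, where it becomes a generator fixing \<open>1\<close>.\<close>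

lemma pi_gen_coset_rep_step:
  assumes "1 \<le> i" "i < n" "k = int i \<or> k = - int i - 1"
  shows "pi_gen i \<circ> coset_rep n k = coset_rep n (k + 1)"
proof (rule eq_if_odd_and_eq_on_pos)
  fix j :: int assume "0 < j"
  show "(pi_gen i \<circ> coset_rep n k) j = coset_rep n (k + 1) j"
  proof -
    consider "j = 1" | "1 < j" "j \<le> int i" | "j = int i + 1" | "int i + 1 < j" using \<open>0 < j\<close> by linarith
    then show ?thesis
      using assms by cases (elim disjE; simp add: coset_rep_pos coset_tail_def pi_gen_apply)+
  qed
qed (use assms in \<open>simp_all add: coset_rep_odd pi_gen_odd\<close>)

lemma pi_hat_coset_rep_step:
  assumes "n \<ge> 2" "k = int n - 1 \<or> k = int n"
  shows "pi_hat n \<circ> coset_rep n k = coset_rep n (k + 1 - 2 * int n)"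
proof (rule eq_if_odd_and_eq_on_pos)
  fix j :: int assume "0 < j"
  show "(pi_hat n \<circ> coset_rep n k) j = coset_rep n (k + 1 - 2 * int n) j"
  proof -
    consider "j = 1" | "1 < j" "j < int n" | "j = int n" "1 < j" | "int n < j" using \<open>0 < j\<close> by linarith
    then show ?thesis
      using assms by cases (elim disjE; simp add: coset_rep_pos coset_tail_def pi_hat_apply)+
  qed
qed (use assms in \<open>simp_all add: coset_rep_odd pi_hat_odd\<close>)

lemma pi_gen_coset_rep_below:
  assumes "1 \<le> i" "\<bar>k\<bar> \<le> int n" "int i + 1 < \<bar>k\<bar>" "0 < k \<or> i + 2 < n"
  shows "pi_gen i \<circ> coset_rep n k = coset_rep n k \<circ> pi_gen (i + 1)"
proof (rule eq_if_odd_and_eq_on_pos)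
  fix j :: int assume j: "0 < j"
  consider "j = 1" | "1 < j" "j \<le> int i" | "j = int i + 1" | "j = int i + 2" | "int i + 2 < j"
    using j by linarith
  then show "(pi_gen i \<circ> coset_rep n k) j = (coset_rep n k \<circ> pi_gen (i + 1)) j"
    using assms(4)
  proof (cases; elim disjE)
  qed (use assms(1-3) in \<open>auto simp add: coset_rep_def coset_tail_def pi_gen_apply\<close>)+
qed (use assms in \<open>simp_all add: coset_rep_odd pi_gen_odd\<close>)

text \<open>For \<open>k = - n\<close> the swap of the two largest remaining absolute values, \<open>n - 2\<close> and \<open>n - 1\<close>, involves the
sign that the representative puts at the last position, and so becomes \<open>pi_hat n\<close>. The same exchange of
the two generators at the fork of the Coxeter diagram occurs in the lemmas on \<open>k < 0\<close> below.\<close>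

lemma pi_gen_coset_rep_below_neg:
  assumes "1 \<le> i" "k = - int (i + 2)"
  shows "pi_gen i \<circ> coset_rep (i + 2) k = coset_rep (i + 2) k \<circ> pi_hat (i + 2)"
proof (rule eq_if_odd_and_eq_on_pos)
  fix j :: int assume j: "0 < j"
  consider "j = 1" | "1 < j" "j \<le> int i" | "j = int i + 1" | "j = int i + 2" | "int i + 2 < j"
    using j by linarith
  then show "(pi_gen i \<circ> coset_rep (i + 2) k) j = (coset_rep (i + 2) k \<circ> pi_hat (i + 2)) j"
  proof cases
  qed (use assms in \<open>simp add: coset_rep_def coset_tail_def pi_gen_apply pi_hat_apply\<close>)+
qed (use assms in \<open>simp_all add: coset_rep_odd pi_gen_odd pi_hat_odd\<close>)

lemma pi_gen_coset_rep_above: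
  assumes "1 \<le> i" "i < n" "k \<noteq> 0" "\<bar>k\<bar> < int i" "0 < k \<or> i + 1 < n"
  shows "pi_gen i \<circ> coset_rep n k = coset_rep n k \<circ> pi_gen i"
proof (rule eq_if_odd_and_eq_on_pos)
  fix j :: int assume j: "0 < j"
  obtain m where m: "0 < m" "m < int i" "k = m \<or> k = - m \<and> int i + 1 < int n"
    by (rule that[of "\<bar>k\<bar>"]) (use assms in auto)
  consider "j = 1" | "1 < j" "j \<le> m" | "m < j" "j < int i" "1 < j" | "j = int i" | "j = int i + 1" | "int i + 1 < j"
    using j by linarith
  then show "(pi_gen i \<circ> coset_rep n k) j = (coset_rep n k \<circ> pi_gen i) j"
    using m(3)
  proof (cases; elim disjE conjE)
  qed (use m(1,2) assms(1,2) in \<open>simp add: coset_rep_def coset_tail_def pi_gen_apply\<close>)+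
qed (use assms in \<open>simp_all add: coset_rep_odd pi_gen_odd\<close>)

lemma pi_gen_last_coset_rep_neg:
  assumes "k < 0" "\<bar>k\<bar> < int i"
  shows "pi_gen i \<circ> coset_rep (i + 1) k = coset_rep (i + 1) k \<circ> pi_hat (i + 1)"
proof (rule eq_if_odd_and_eq_on_pos)
  fix j :: int assume j: "0 < j"
  obtain m where m: "0 < m" "m < int i" "k = - m"
    using assms by (metis abs_of_neg neg_0_less_iff_less add.inverse_inverse)
  consider "j = 1" | "1 < j" "j \<le> m" | "m < j" "j < int i" "1 < j" | "j = int i" | "j = int i + 1" | "int i + 1 < j"
    using j by linarith
  then show "(pi_gen i \<circ> coset_rep (i + 1) k) j = (coset_rep (i + 1) k \<circ> pi_hat (i + 1)) j"
  proof cases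
  qed (use m in \<open>simp add: coset_rep_def coset_tail_def pi_gen_apply pi_hat_apply\<close>)+
qed (use assms in \<open>simp_all add: coset_rep_odd pi_gen_odd pi_hat_odd\<close>)

lemma pi_hat_coset_rep_above:
  assumes "n \<ge> 2" "k \<noteq> 0" "\<bar>k\<bar> < int n - 1"
  shows "pi_hat n \<circ> coset_rep n k = coset_rep n k \<circ>
    (if k < 0 then pi_gen (n - 1) else pi_hat n)"
proof (rule eq_if_odd_and_eq_on_pos)
  fix j :: int assume j: "0 < j"
  obtain m where m: "0 < m" "m < int n - 1" "k = m \<or> k = - m"
    using assms by (metis abs_if neg_0_less_iff_less linorder_neqE_linordered_idom add.inverse_inverse)
  consider "j = 1" | "1 < j" "j \<le> m" | "m < j" "j < int n - 1" "1 < j" | "j = int n - 1" | "j = int n" | "int n < j"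
    using j by linarith
  then show "(pi_hat n \<circ> coset_rep n k) j = (coset_rep n k \<circ>
    (if k < 0 then pi_gen (n - 1) else pi_hat n)) j"
    using m(3)
  proof (cases; elim disjE)
  qed (use m(1,2) assms(1) in \<open>simp add: coset_rep_def coset_tail_def pi_gen_apply pi_hat_apply\<close>)+
qed (use assms in \<open>simp_all add: coset_rep_odd pi_gen_odd pi_hat_odd\<close>)

lemma tail_shift_odd:
  assumes "\<And>j. v (- j) = - v j"
  shows "tail_shift v (- j) = - tail_shift v j"
proof -
  have "v (- j - sgn (- j)) = - v (j - sgn j)" using assms[of "j - sgn j"] by (simp add: sgn_minus)
  then show ?thesis by (auto simp: tail_shift_def)
qed

lemma tail_shift_pi_gen: "1 \<le> i \<Longrightarrow> tail_shift (pi_gen i) = pi_gen (i + 1)"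
proof (rule eq_if_odd_and_eq_on_pos)
  fix j :: int assume j: "0 < j" and "1 \<le> i"
  then show "tail_shift (pi_gen i) j = pi_gen (i + 1) j"
    by (auto simp: tail_shift_def pi_gen_apply)
qed (simp_all add: pi_gen_odd tail_shift_odd)

lemma tail_shift_pi_hat: "2 \<le> n \<Longrightarrow> tail_shift (pi_hat n) = pi_hat (n + 1)"
proof (rule eq_if_odd_and_eq_on_pos)
  fix j :: int assume j: "0 < j" and "2 \<le> n"
  then show "tail_shift (pi_hat n) j = pi_hat (n + 1) j"
    by (auto simp: tail_shift_def pi_hat_apply)
qed (simp_all add: pi_hat_odd tail_shift_odd)


section \<open>Reduced words and the coset decomposition of D(n)\<close>

lemma type_D_generators_signed: "s \<in> type_D_generators n \<Longrightarrow> s \<in> carrier (signed_perms n)"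
  by (auto simp: type_D_generators_def split: if_splits intro!: pi_gen_in_signed_perms pi_hat_in_signed_perms)

lemma type_D_generators_involution: "s \<in> type_D_generators n \<Longrightarrow> s \<circ> s = id"
  by (auto simp: type_D_generators_def pi_hat_idem pi_gen_idem split: if_splits)

definition gen_prod :: "(int \<Rightarrow> int) list \<Rightarrow> int \<Rightarrow> int"
  where "gen_prod ws = foldr (\<circ>) ws id"

lemma gen_prod_Nil [simp]: "gen_prod [] = id"
  by (simp add: gen_prod_def)

lemma gen_prod_Cons [simp]: "gen_prod (s # ws) = s \<circ> gen_prod ws"
  by (simp add: gen_prod_def)

lemma gen_prod_append [simp]: "gen_prod (us @ vs) = gen_prod us \<circ> gen_prod vs"
  by (induction us) (simp_all add: comp_assoc)

text \<open>All generators are involutions, so inverses add nothing to the monoid that they generate.\<close>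

lemma type_D_iff_word:
  "\<sigma> \<in> type_D n \<longleftrightarrow> (\<exists>ws. set ws \<subseteq> type_D_generators n \<and> gen_prod ws = \<sigma>)"
proof
  assume "\<sigma> \<in> type_D n"
  then show "\<exists>ws. set ws \<subseteq> type_D_generators n \<and> gen_prod ws = \<sigma>"
    unfolding type_D_def
  proof (induction rule: generate.induct)
    case one
    show ?case by (intro exI[of _ "[]"]) (simp add: signed_perms_def)
  next
    case (incl s)
    then show ?case by (intro exI[of _ "[s]"]) simp
  next
    case (inv s)
    have "inv\<^bsub>signed_perms n\<^esub> s = s"
      using type_D_generators_signed[OF inv] type_D_generators_involution[OF inv]
      by (intro group.inv_equality[OF group_signed_perms]) (auto simp: signed_perms_def)
    with inv show ?case by (intro exI[of _ "[s]"]) simp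
  next
    case (eng h1 h2)
    then obtain us vs where "set us \<subseteq> type_D_generators n" "gen_prod us = h1"
      "set vs \<subseteq> type_D_generators n" "gen_prod vs = h2" by blast
    moreover have "h1 \<otimes>\<^bsub>signed_perms n\<^esub> h2 = h1 \<circ> h2" by (simp add: signed_perms_def)
    ultimately show ?case
      by (intro exI[of _ "us @ vs"]) (simp only: gen_prod_append set_append Un_least simp_thms)
  qed
next
  assume "\<exists>ws. set ws \<subseteq> type_D_generators n \<and> gen_prod ws = \<sigma>"
  then obtain ws where "set ws \<subseteq> type_D_generators n" "gen_prod ws = \<sigma>" by blast
  then show "\<sigma> \<in> type_D n"
  proof (induction ws arbitrary: \<sigma>)
    case Nil
    then have "\<sigma> = id" by (simp only: gen_prod_Nil)
    then have "\<sigma> = \<one>\<^bsub>signed_perms n\<^esub>" by (simp only: signed_perms_def monoid.simps)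
    then show ?case
      using generate.one[of "signed_perms n"] by (simp only: type_D_def)
  next
    case (Cons s ws)
    then have "s \<in> type_D n" "gen_prod ws \<in> type_D n"
      by (auto simp: type_D_def intro: generate.incl)
    then have "s \<otimes>\<^bsub>signed_perms n\<^esub> gen_prod ws \<in> type_D n"
      unfolding type_D_def by (rule generate.eng)
    moreover have "s \<otimes>\<^bsub>signed_perms n\<^esub> gen_prod ws = \<sigma>"
      using Cons.prems(2) by (simp only: signed_perms_def monoid.simps gen_prod_Cons)
    ultimately show ?case by (simp only:)
  qed
qed

lemma type_D_id: "id \<in> type_D n"
  unfolding type_D_iff_word by (intro exI[of _ "[]"]) simp

lemma type_D_generator_comp:
  assumes "s \<in> type_D_generators n" "\<sigma> \<in> type_D n"
  shows "s \<circ> \<sigma> \<in> type_D n"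
proof -
  obtain ws where "set ws \<subseteq> type_D_generators n" "gen_prod ws = \<sigma>"
    using assms(2) type_D_iff_word by blast
  then show ?thesis
    unfolding type_D_iff_word using assms(1) by (intro exI[of _ "s # ws"]) auto
qed

lemma type_D_length_le:
  "set ws \<subseteq> type_D_generators n \<Longrightarrow> type_D_length n (gen_prod ws) \<le> length ws"
  unfolding type_D_length_def gen_prod_def by (rule Least_le) blast

lemma type_D_reduced_word:
  assumes "\<sigma> \<in> type_D n"
  obtains ws where "length ws = type_D_length n \<sigma>" "set ws \<subseteq> type_D_generators n"
    "gen_prod ws = \<sigma>"
proof -
  have "\<exists>k ws. length ws = k \<and> set ws \<subseteq> type_D_generators n \<and> gen_prod ws = \<sigma>"
    using assms type_D_iff_word by blast
  then have "\<exists>k ws. length ws = k \<and> set ws \<subseteq> type_D_generators n \<and> foldr (\<circ>) ws id = \<sigma>"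
    by (simp add: gen_prod_def)
  from LeastI_ex[OF this] show ?thesis
    using that unfolding type_D_length_def gen_prod_def by blast
qed

lemma type_D_length_id: "type_D_length n id = 0"
  using type_D_length_le[of "[]" n] by simp

lemma type_D_length_generator_comp:
  assumes "s \<in> type_D_generators n" "\<sigma> \<in> type_D n"
  shows "type_D_length n (s \<circ> \<sigma>) \<le> Suc (type_D_length n \<sigma>)"
proof -
  obtain ws where "length ws = type_D_length n \<sigma>" "set ws \<subseteq> type_D_generators n"
    "gen_prod ws = \<sigma>"
    using assms(2) by (rule type_D_reduced_word)
  then show ?thesis using type_D_length_le[of "s # ws" n] assms(1) by simp
qed

lemma gen_prod_rev_inverse:
  assumes "set ws \<subseteq> type_D_generators n"
  shows "gen_prod (rev ws) \<circ> gen_prod ws = id"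
  using assms
proof (induction ws)
  case (Cons s ws)
  have "gen_prod (rev (s # ws)) \<circ> gen_prod (s # ws)
      = gen_prod (rev ws) \<circ> (s \<circ> s) \<circ> gen_prod ws"
    by (simp only: rev.simps gen_prod_append gen_prod_Cons gen_prod_Nil comp_id comp_assoc)
  also have "s \<circ> s = id" using Cons.prems type_D_generators_involution[of s n] by simp
  also have "gen_prod (rev ws) \<circ> id \<circ> gen_prod ws = id"
    unfolding comp_id using Cons by (intro Cons.IH) simp
  finally show ?case .
qed simp

lemma type_D_bij: "\<sigma> \<in> type_D n \<Longrightarrow> bij \<sigma>"
  using type_D_subset[of n] by (auto simp: signed_perms_def intro: permutes_bij)

lemma
  assumes "\<sigma> \<in> type_D n"
  shows type_D_inv: "inv_into UNIV \<sigma> \<in> type_D n"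
    and type_D_length_inv: "type_D_length n (inv_into UNIV \<sigma>) = type_D_length n \<sigma>"
proof -
  have *: "inv_into UNIV \<sigma> \<in> type_D n \<and> type_D_length n (inv_into UNIV \<sigma>) \<le> type_D_length n \<sigma>"
    if \<sigma>: "\<sigma> \<in> type_D n" for \<sigma>
  proof -
    obtain ws where ws: "length ws = type_D_length n \<sigma>" "set ws \<subseteq> type_D_generators n"
      "gen_prod ws = \<sigma>"
      using \<sigma> by (rule type_D_reduced_word)
    have "gen_prod (rev ws) \<circ> \<sigma> = id" "\<sigma> \<circ> gen_prod (rev ws) = id"
      using gen_prod_rev_inverse[of ws n] gen_prod_rev_inverse[of "rev ws" n] ws by auto
    then have "inv_into UNIV \<sigma> = gen_prod (rev ws)" by (metis inv_unique_comp)
    then show ?thesis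
      using type_D_length_le[of "rev ws" n] ws unfolding type_D_iff_word by (metis length_rev set_rev)
  qed
  have "inv_into UNIV (inv_into UNIV \<sigma>) = \<sigma>" using type_D_bij[OF assms] by (rule inv_inv_eq)
  with *[OF assms] *[of "inv_into UNIV \<sigma>"]
  show "inv_into UNIV \<sigma> \<in> type_D n" "type_D_length n (inv_into UNIV \<sigma>) = type_D_length n \<sigma>" by auto
qed

lemma signed_perm_zero:
  assumes "\<sigma> \<in> carrier (signed_perms n)"
  shows "\<sigma> j = 0 \<longleftrightarrow> j = 0"
proof -
  have "inj \<sigma>" "\<sigma> 0 = 0"
    using assms by (auto simp: signed_perms_def permutes_inj permutes_not_in)
  then show ?thesis by (metis injD)
qed

lemma tail_shift_comp:
  assumes "\<tau> \<in> carrier (signed_perms n)"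
  shows "tail_shift (\<sigma> \<circ> \<tau>) = tail_shift \<sigma> \<circ> tail_shift \<tau>"
proof
  fix j
  show "tail_shift (\<sigma> \<circ> \<tau>) j = (tail_shift \<sigma> \<circ> tail_shift \<tau>) j"
  proof (cases "j \<in> {-1, 0, 1}")
    case False
    define t where "t = \<tau> (j - sgn j)"
    have "t \<noteq> 0" using False signed_perm_zero[OF assms] by (auto simp: t_def sgn_if split: if_splits)
    then have "t + sgn t \<notin> {-1, 0, 1}" "t + sgn t - sgn (t + sgn t) = t"
      by (auto simp: sgn_if)
    moreover have "tail_shift \<tau> j = t + sgn t" using False by (simp add: tail_shift_def t_def)
    moreover have "tail_shift (\<sigma> \<circ> \<tau>) j = \<sigma> t + sgn (\<sigma> t)"
      using False by (simp add: tail_shift_def t_def)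
    ultimately show ?thesis by (simp add: tail_shift_def)
  qed (auto simp: tail_shift_def)
qed

lemma tail_shift_id: "tail_shift id = id"
  by (rule ext) (auto simp: tail_shift_def sgn_if)

lemma inj_tail_shift:
  assumes "\<sigma> \<in> carrier (signed_perms n)" "\<tau> \<in> carrier (signed_perms m)"
    "tail_shift \<sigma> = tail_shift \<tau>"
  shows "\<sigma> = \<tau>"
proof
  fix j
  show "\<sigma> j = \<tau> j"
  proof (cases "j = 0")
    case False
    have *: "j + sgn j \<notin> {-1, 0, 1}" "j + sgn j - sgn (j + sgn j) = j"
      using False by (auto simp: sgn_if)
    have "\<sigma> j + sgn (\<sigma> j) = \<tau> j + sgn (\<tau> j)"
      using fun_cong[OF assms(3), of "j + sgn j"] * by (simp add: tail_shift_def)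
    moreover have "\<sigma> j \<noteq> 0" "\<tau> j \<noteq> 0" using False assms signed_perm_zero by auto
    ultimately show ?thesis by (auto simp: sgn_if split: if_splits)
  qed (use signed_perm_zero[OF assms(1), of 0] signed_perm_zero[OF assms(2), of 0] in auto)
qed

lemma tail_shift_generators:
  assumes "s \<in> type_D_generators n"
  shows "tail_shift s \<in> type_D_generators (Suc n)"
  using assms
  by (auto simp: type_D_generators_def tail_shift_pi_gen tail_shift_pi_hat split: if_splits)

lemma tail_shift_gen_prod:
  assumes "set ws \<subseteq> type_D_generators n"
  shows "tail_shift (gen_prod ws) = gen_prod (map tail_shift ws)"
  using assms
proof (induction ws)
  case (Cons s ws)
  have "gen_prod ws \<in> type_D n" using Cons.prems type_D_iff_word by auto
  then have "gen_prod ws \<in> carrier (signed_perms n)" using type_D_subset by blast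
  then have "tail_shift (s \<circ> gen_prod ws) = tail_shift s \<circ> tail_shift (gen_prod ws)"
    by (rule tail_shift_comp)
  also have "tail_shift (gen_prod ws) = gen_prod (map tail_shift ws)"
    using Cons by (intro Cons.IH) simp
  finally show ?case by (simp only: gen_prod_Cons list.map)
qed (simp add: tail_shift_id)

text \<open>The type D group of rank one is trivial, so \<open>1\<close> can only be mapped to itself there.\<close>

definition coset_index :: "nat \<Rightarrow> int set"
  where "coset_index n = (if n = 1 then {1} else {- int n..int n} - {0})"

definition coset_length :: "nat \<Rightarrow> int \<Rightarrow> nat"
  where "coset_length n k = nat (if 0 < k then k - 1 else 2 * int n - 1 + k)"

text \<open>Deodhar's lemma for this parabolic subgroup: multiplied by a generator from the left, a minimal
representative turns into a neighbouring one or absorbs the generator into the subgroup. It is the only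
point at which the relations of the group enter; the decomposition and the additivity of lengths follow from it formally.\<close>

lemma generator_coset_rep:
  assumes s: "s \<in> type_D_generators (Suc m)" and k: "k \<in> coset_index (Suc m)"
  shows "(\<exists>k'\<in>coset_index (Suc m). s \<circ> coset_rep (Suc m) k = coset_rep (Suc m) k' \<and>
      coset_length (Suc m) k' \<le> Suc (coset_length (Suc m) k)) \<or>
    (\<exists>s'\<in>type_D_generators m. s \<circ> coset_rep (Suc m) k = coset_rep (Suc m) k \<circ> tail_shift s')"
proof -
  define n where "n = Suc m"
  have n: "n \<ge> 2" and k': "- int n \<le> k" "k \<le> int n" "k \<noteq> 0"
    using s k by (auto simp: type_D_generators_def n_def coset_index_def split: if_splits)
  have idx: "l \<in> coset_index n" if "- int n \<le> l" "l \<le> int n" "l \<noteq> 0" for l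
    using that n by (auto simp: coset_index_def)
  have gen: "pi_gen i \<in> tail_shift ` type_D_generators m" if "2 \<le> i" "i < n" for i
  proof -
    have "pi_gen i = tail_shift (pi_gen (i - 1))" using that by (simp add: tail_shift_pi_gen)
    moreover have "i - 1 \<in> {1..m - 1}" "2 \<le> m" using that by (auto simp: n_def)
    then have "pi_gen (i - 1) \<in> type_D_generators m" by (simp add: type_D_generators_def)
    ultimately show ?thesis by blast
  qed
  have hat: "pi_hat n \<in> tail_shift ` type_D_generators m" if "3 \<le> n"
  proof -
    have "pi_hat n = tail_shift (pi_hat m)" using that by (simp add: tail_shift_pi_hat n_def)
    moreover have "pi_hat m \<in> type_D_generators m"
      using that by (auto simp: type_D_generators_def n_def)
    ultimately show ?thesis by blast
  qed
  consider i where "s = pi_gen i" "1 \<le> i" "i < n" | "s = pi_hat n"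
    using s by (auto simp: type_D_generators_def n_def split: if_splits)
  then have "(\<exists>k'\<in>coset_index n. s \<circ> coset_rep n k = coset_rep n k' \<and>
      coset_length n k' \<le> Suc (coset_length n k)) \<or>
    (\<exists>t\<in>tail_shift ` type_D_generators m. s \<circ> coset_rep n k = coset_rep n k \<circ> t)"
  proof cases
    case (1 i)
    have undo: "pi_gen i \<circ> coset_rep n (l + 1) = coset_rep n l" if "l = int i \<or> l = - int i - 1" for l
    proof -
      have "pi_gen i \<circ> coset_rep n (l + 1) = pi_gen i \<circ> pi_gen i \<circ> coset_rep n l"
        using pi_gen_coset_rep_step[OF 1(2,3) that] by (simp add: comp_assoc)
      then show ?thesis using pi_gen_idem[OF 1(2)] by simp
    qed
    consider "k = int i \<or> k = - int i - 1" | "k = int i + 1 \<or> k = - int i"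
      | "int i + 1 < \<bar>k\<bar>" "0 < k \<or> i + 2 < n" | "int i + 1 < \<bar>k\<bar>" "k < 0" "n \<le> i + 2"
      | "\<bar>k\<bar> < int i" "0 < k \<or> i + 1 < n" | "\<bar>k\<bar> < int i" "k < 0" "n \<le> i + 1"
      using k'(3) by linarith
    then show ?thesis
    proof cases
      case a: 1
      then have "k + 1 \<in> coset_index n" using 1 k' by (intro idx) auto
      moreover have "coset_length n (k + 1) \<le> Suc (coset_length n k)"
        using a 1 by (auto simp: coset_length_def)
      ultimately show ?thesis using pi_gen_coset_rep_step[OF 1(2,3) a] 1(1) by blast
    next
      case a: 2
      then have "k - 1 \<in> coset_index n" using 1 k' by (intro idx) auto
      moreover have "coset_length n (k - 1) \<le> Suc (coset_length n k)"
        using a 1 by (auto simp: coset_length_def)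
      moreover have "pi_gen i \<circ> coset_rep n k = coset_rep n (k - 1)"
        using undo[of "k - 1"] a by auto
      ultimately show ?thesis using 1(1) by blast
    next
      case a: 3
      then have "i + 1 < n" "\<bar>k\<bar> \<le> int n" using k' by linarith+
      then have "s \<circ> coset_rep n k = coset_rep n k \<circ> pi_gen (i + 1)"
        unfolding 1(1) by (intro pi_gen_coset_rep_below[OF 1(2) _ a])
      moreover have "pi_gen (i + 1) \<in> tail_shift ` type_D_generators m"
        using 1(2) \<open>i + 1 < n\<close> by (intro gen) simp_all
      ultimately show ?thesis by blast
    next
      case a: 4
      then have "n = i + 2" "k = - int (i + 2)" using k' by auto
      then show ?thesis using pi_gen_coset_rep_below_neg[OF 1(2)] hat 1 by auto
    next
      case a: 5
      then have "2 \<le> i" using k'(3) by linarith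
      then show ?thesis
        using pi_gen_coset_rep_above[OF 1(2,3) k'(3) a] gen[of i] 1 by auto
    next
      case a: 6
      then have "n = i + 1" "2 \<le> i" using k' 1 by linarith+
      then show ?thesis using pi_gen_last_coset_rep_neg[OF a(2,1)] hat 1(1) by auto
    qed
  next
    case 2
    have undo: "pi_hat n \<circ> coset_rep n (l + 1 - 2 * int n) = coset_rep n l"
      if "l = int n - 1 \<or> l = int n" for l
    proof -
      have "pi_hat n \<circ> coset_rep n (l + 1 - 2 * int n) = pi_hat n \<circ> pi_hat n \<circ> coset_rep n l"
        using pi_hat_coset_rep_step[OF n that] by (simp add: comp_assoc)
      then show ?thesis using pi_hat_idem[OF n] by simp
    qed
    consider "k = int n - 1 \<or> k = int n" | "k = - int n \<or> k = 1 - int n" | "\<bar>k\<bar> < int n - 1"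
      using k' by linarith
    then show ?thesis
    proof cases
      case a: 1
      then have "k + 1 - 2 * int n \<in> coset_index n" using n k' by (intro idx) auto
      moreover have "coset_length n (k + 1 - 2 * int n) \<le> Suc (coset_length n k)"
        using a n by (auto simp: coset_length_def)
      ultimately show ?thesis using pi_hat_coset_rep_step[OF n a] 2 by blast
    next
      case a: 2
      then have "k - 1 + 2 * int n \<in> coset_index n" using n k' by (intro idx) auto
      moreover have "coset_length n (k - 1 + 2 * int n) \<le> Suc (coset_length n k)"
        using a n by (auto simp: coset_length_def)
      moreover have "pi_hat n \<circ> coset_rep n k = coset_rep n (k - 1 + 2 * int n)"
        using undo[of "k - 1 + 2 * int n"] a by auto
      ultimately show ?thesis using 2 by blast
    next
      case a: 3
      then have "3 \<le> n" using k'(3) by linarith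
      then have "(if k < 0 then pi_gen (n - 1) else pi_hat n) \<in> tail_shift ` type_D_generators m"
        using gen[of "n - 1"] hat by simp
      then show ?thesis using pi_hat_coset_rep_above[OF n k'(3) a] unfolding 2 by blast
    qed
  qed
  then show ?thesis by (auto simp: n_def)
qed

lemma coset_rep_one: "coset_rep n 1 = id"
proof
  fix j show "coset_rep n 1 j = id j"
    by (auto simp: coset_rep_def coset_tail_def)
qed

lemma coset_rep_word:
  assumes "k \<in> coset_index n"
  shows "\<exists>ws. length ws = coset_length n k \<and> set ws \<subseteq> type_D_generators n \<and>
    gen_prod ws = coset_rep n k"
proof -
  let ?W = "\<lambda>k. \<exists>ws. length ws = coset_length n k \<and> set ws \<subseteq> type_D_generators n \<and>
    gen_prod ws = coset_rep n k"
  have one: "?W 1"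
    by (intro exI[of _ "[]"]) (simp add: coset_length_def coset_rep_one)
  have step: "?W l'" if l: "?W l" and s: "s \<in> type_D_generators n" "s \<circ> coset_rep n l = coset_rep n l'"
    "coset_length n l' = Suc (coset_length n l)" for l l' s
  proof -
    obtain ws where "length ws = coset_length n l" "set ws \<subseteq> type_D_generators n"
      "gen_prod ws = coset_rep n l" using l by blast
    then show ?thesis using s by (intro exI[of _ "s # ws"]) auto
  qed
  have pos: "?W (int i)" if "1 \<le> i" "i \<le> n" for i
    using that
  proof (induction i rule: nat_induct_at_least)
    case base
    show ?case using one by simp
  next
    case (Suc i)
    show ?case
    proof (rule step)
      show "?W (int i)" using Suc by simp
      show "pi_gen i \<in> type_D_generators n" using Suc by (auto simp: type_D_generators_def)
      show "pi_gen i \<circ> coset_rep n (int i) = coset_rep n (int (Suc i))"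
        using pi_gen_coset_rep_step[of i n "int i"] Suc by (simp add: add.commute)
      show "coset_length n (int (Suc i)) = Suc (coset_length n (int i))"
        using Suc by (simp add: coset_length_def)
    qed
  qed
  show ?thesis
  proof (cases "0 < k")
    case True
    then have "1 \<le> nat k" "nat k \<le> n" using assms by (auto simp: coset_index_def split: if_splits)
    from pos[OF this] True show ?thesis by simp
  next
    case False
    then have k: "k < 0" "- int n \<le> k" "2 \<le> n"
      using assms by (auto simp: coset_index_def split: if_splits)
    have neg: "?W (int d - int n)" if "d < n" for d
      using that
    proof (induction d)
      case 0
      show ?case
      proof (rule step)
        show "?W (int (n - 1))" using k by (intro pos) auto
        show "pi_hat n \<in> type_D_generators n" using k by (auto simp: type_D_generators_def)
        show "pi_hat n \<circ> coset_rep n (int (n - 1)) = coset_rep n (int 0 - int n)"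
          using pi_hat_coset_rep_step[of n "int (n - 1)"] k by (simp add: of_nat_diff)
        show "coset_length n (int 0 - int n) = Suc (coset_length n (int (n - 1)))"
          using k by (simp add: coset_length_def)
      qed
    next
      case (Suc d)
      define i where "i = n - Suc d"
      have i: "1 \<le> i" "i < n" "int d - int n = - int i - 1" "int (Suc d) - int n = - int i"
        using Suc by (auto simp: i_def)
      show ?case
      proof (rule step)
        show "?W (int d - int n)" using Suc by simp
        show "pi_gen i \<in> type_D_generators n" using i by (auto simp: type_D_generators_def)
        show "pi_gen i \<circ> coset_rep n (int d - int n) = coset_rep n (int (Suc d) - int n)"
          unfolding i(3,4) using pi_gen_coset_rep_step[of i n "- int i - 1"] i(1,2) by simp
        show "coset_length n (int (Suc d) - int n) = Suc (coset_length n (int d - int n))"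
          unfolding i(3,4) using i(1,2) by (simp add: coset_length_def)
      qed
    qed
    from neg[of "nat (k + int n)"] k show ?thesis by simp
  qed
qed

lemma coset_rep_in_type_D: "k \<in> coset_index n \<Longrightarrow> coset_rep n k \<in> type_D n"
  using coset_rep_word[of k n] type_D_iff_word by blast

lemma coset_decomposition_upper:
  assumes "k \<in> coset_index (Suc m)" "\<tau> \<in> type_D m"
  shows "coset_rep (Suc m) k \<circ> tail_shift \<tau> \<in> type_D (Suc m)"
    and "type_D_length (Suc m) (coset_rep (Suc m) k \<circ> tail_shift \<tau>)
      \<le> coset_length (Suc m) k + type_D_length m \<tau>"
proof -
  obtain us where us: "length us = coset_length (Suc m) k" "set us \<subseteq> type_D_generators (Suc m)"
    "gen_prod us = coset_rep (Suc m) k" using coset_rep_word[OF assms(1)] by blast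
  obtain vs where vs: "length vs = type_D_length m \<tau>" "set vs \<subseteq> type_D_generators m"
    "gen_prod vs = \<tau>" using assms(2) by (rule type_D_reduced_word)
  let ?ws = "us @ map tail_shift vs"
  have ws: "set ?ws \<subseteq> type_D_generators (Suc m)"
    "gen_prod ?ws = coset_rep (Suc m) k \<circ> tail_shift \<tau>"
    using us vs tail_shift_generators tail_shift_gen_prod[OF vs(2)]
    by (auto simp:)
  then show "coset_rep (Suc m) k \<circ> tail_shift \<tau> \<in> type_D (Suc m)"
    unfolding type_D_iff_word by (intro exI conjI)
  show "type_D_length (Suc m) (coset_rep (Suc m) k \<circ> tail_shift \<tau>)
      \<le> coset_length (Suc m) k + type_D_length m \<tau>"
    using type_D_length_le[OF ws(1)] ws(2) us(1) vs(1) by simp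
qed

text \<open>Reading a word from right to left keeps the product in the form \<open>w\<^sub>k \<tau>\<close>, and each letter raises the
sum of the two lengths by at most one. Besides existence this gives the lower bound for the length.\<close>

lemma coset_decomposition_exists:
  assumes "set ws \<subseteq> type_D_generators (Suc m)"
  shows "\<exists>k\<in>coset_index (Suc m). \<exists>\<tau>\<in>type_D m.
    gen_prod ws = coset_rep (Suc m) k \<circ> tail_shift \<tau> \<and>
    coset_length (Suc m) k + type_D_length m \<tau> \<le> length ws"
  using assms
proof (induction ws)
  case Nil
  have "1 \<in> coset_index (Suc m)" "coset_length (Suc m) 1 = 0"
    by (auto simp: coset_index_def coset_length_def)
  moreover have "gen_prod [] = coset_rep (Suc m) 1 \<circ> tail_shift id"
    by (simp only: coset_rep_one tail_shift_id gen_prod_Nil comp_id)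
  ultimately show ?case
    using type_D_id[of m] type_D_length_id[of m] by (metis add.right_neutral le_refl list.size(3))
next
  case (Cons s ws)
  then obtain k \<tau> where k: "k \<in> coset_index (Suc m)" and \<tau>: "\<tau> \<in> type_D m"
    and eq: "gen_prod ws = coset_rep (Suc m) k \<circ> tail_shift \<tau>"
    and le: "coset_length (Suc m) k + type_D_length m \<tau> \<le> length ws"
    by (metis insert_subset list.simps(15))
  have s: "s \<in> type_D_generators (Suc m)" using Cons.prems by simp
  have fold: "gen_prod (s # ws) = (s \<circ> coset_rep (Suc m) k) \<circ> tail_shift \<tau>"
    using eq by (simp add: comp_assoc)
  from generator_coset_rep[OF s k] show ?case
  proof (elim disjE bexE conjE)
    fix k' assume k': "k' \<in> coset_index (Suc m)" "s \<circ> coset_rep (Suc m) k = coset_rep (Suc m) k'"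
      "coset_length (Suc m) k' \<le> Suc (coset_length (Suc m) k)"
    then show ?thesis
      unfolding fold using \<tau> le by (intro bexI[OF _ k'(1)] bexI[OF _ \<tau>]) auto
  next
    fix s' assume s': "s' \<in> type_D_generators m"
      "s \<circ> coset_rep (Suc m) k = coset_rep (Suc m) k \<circ> tail_shift s'"
    have "\<tau> \<in> carrier (signed_perms m)" using \<tau> type_D_subset by blast
    then have "tail_shift (s' \<circ> \<tau>) = tail_shift s' \<circ> tail_shift \<tau>" by (rule tail_shift_comp)
    then have "gen_prod (s # ws) = coset_rep (Suc m) k \<circ> tail_shift (s' \<circ> \<tau>)"
      unfolding fold s'(2) by (simp only: comp_assoc)
    moreover have "coset_length (Suc m) k + type_D_length m (s' \<circ> \<tau>) \<le> length (s # ws)"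
      using le type_D_length_generator_comp[OF s'(1) \<tau>] by (simp only: list.size)
    ultimately show ?thesis
      by (intro bexI[OF _ k] bexI[OF _ type_D_generator_comp[OF s'(1) \<tau>]] conjI)
  qed
qed

lemma coset_decomposition_unique:
  assumes "k \<in> coset_index (Suc m)" "\<tau> \<in> type_D m" "k' \<in> coset_index (Suc m)" "\<tau>' \<in> type_D m"
    and eq: "coset_rep (Suc m) k \<circ> tail_shift \<tau> = coset_rep (Suc m) k' \<circ> tail_shift \<tau>'"
  shows "k = k' \<and> \<tau> = \<tau>'"
proof
  show k: "k = k'"
    using fun_cong[OF eq, of 1] by (simp add: tail_shift_def coset_rep_def)
  have "inj (coset_rep (Suc m) k)"
    using coset_rep_in_type_D[OF assms(1)] type_D_bij bij_is_inj by blast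
  then have "tail_shift \<tau> = tail_shift \<tau>'"
    using eq unfolding k by (metis fun.inj_map injD)
  then show "\<tau> = \<tau>'" using assms(2,4) type_D_subset inj_tail_shift by blast
qed

lemma type_D_length_coset:
  assumes "k \<in> coset_index (Suc m)" "\<tau> \<in> type_D m"
  shows "type_D_length (Suc m) (coset_rep (Suc m) k \<circ> tail_shift \<tau>)
      = coset_length (Suc m) k + type_D_length m \<tau>"
proof (rule antisym[OF coset_decomposition_upper(2)[OF assms]])
  obtain ws where ws: "length ws = type_D_length (Suc m) (coset_rep (Suc m) k \<circ> tail_shift \<tau>)"
    "set ws \<subseteq> type_D_generators (Suc m)" "gen_prod ws = coset_rep (Suc m) k \<circ> tail_shift \<tau>"
    using coset_decomposition_upper(1)[OF assms] by (rule type_D_reduced_word)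
  \<comment> \<open>A reduced word cannot be shorter than the sum of lengths in the decomposition that it produces, which is the given one.\<close>
  obtain k' \<tau>' where *: "k' \<in> coset_index (Suc m)" "\<tau>' \<in> type_D m"
    "gen_prod ws = coset_rep (Suc m) k' \<circ> tail_shift \<tau>'"
    "coset_length (Suc m) k' + type_D_length m \<tau>' \<le> length ws"
    using coset_decomposition_exists[OF ws(2)] by blast
  then have "k = k' \<and> \<tau> = \<tau>'"
    using coset_decomposition_unique[OF assms *(1,2)] ws(3) by simp
  then show "coset_length (Suc m) k + type_D_length m \<tau>
      \<le> type_D_length (Suc m) (coset_rep (Suc m) k \<circ> tail_shift \<tau>)"
    using *(4) ws(1) by simp
qed

lemma bij_betw_coset_decomposition:
  "bij_betw (\<lambda>(k, \<tau>). coset_rep (Suc m) k \<circ> tail_shift \<tau>)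
     (coset_index (Suc m) \<times> type_D m) (type_D (Suc m))"
proof (rule bij_betw_imageI)
  show "inj_on (\<lambda>(k, \<tau>). coset_rep (Suc m) k \<circ> tail_shift \<tau>) (coset_index (Suc m) \<times> type_D m)"
    by (rule inj_onI) (use coset_decomposition_unique in fastforce)
  show "(\<lambda>(k, \<tau>). coset_rep (Suc m) k \<circ> tail_shift \<tau>) ` (coset_index (Suc m) \<times> type_D m)
      = type_D (Suc m)"
  proof (intro equalityI subsetI)
    fix \<sigma> assume "\<sigma> \<in> type_D (Suc m)"
    then obtain ws where "set ws \<subseteq> type_D_generators (Suc m)" "gen_prod ws = \<sigma>"
      using type_D_iff_word by blast
    then show "\<sigma> \<in> (\<lambda>(k, \<tau>). coset_rep (Suc m) k \<circ> tail_shift \<tau>) ` (coset_index (Suc m) \<times> type_D m)"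
      using coset_decomposition_exists[of ws m] by force
  qed (use coset_decomposition_upper in auto)
qed

lemma sum_type_D_Suc:
  fixes F :: "(int \<Rightarrow> int) \<Rightarrow> complex"
  shows "(\<Sum>\<sigma>\<in>type_D (Suc m). of_real (q ^ type_D_length (Suc m) \<sigma>) * F \<sigma>) =
    (\<Sum>k\<in>coset_index (Suc m). of_real (q ^ coset_length (Suc m) k) *
      (\<Sum>\<tau>\<in>type_D m. of_real (q ^ type_D_length m \<tau>) * F (coset_rep (Suc m) k \<circ> tail_shift \<tau>)))"
proof -
  have "(\<Sum>\<sigma>\<in>type_D (Suc m). of_real (q ^ type_D_length (Suc m) \<sigma>) * F \<sigma>) =
    (\<Sum>(k, \<tau>)\<in>coset_index (Suc m) \<times> type_D m.
      of_real (q ^ (coset_length (Suc m) k + type_D_length m \<tau>)) * F (coset_rep (Suc m) k \<circ> tail_shift \<tau>))"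
    unfolding sum.reindex_bij_betw[OF bij_betw_coset_decomposition, symmetric]
    by (rule sum.cong) (auto simp: type_D_length_coset)
  then show ?thesis
    by (simp add: sum.cartesian_product[symmetric] sum_distrib_left power_add mult.assoc)
qed

text \<open>The representatives of positive index have the lengths \<open>0,\<dots>,n-1\<close> and those of negative index the
lengths \<open>n-1,\<dots>,2n-2\<close>. For \<open>n = 1\<close> the group is trivial and only \<open>k = 1\<close> occurs, which is why the first
Jacobi parameter is \<open>1\<close> instead of \<open>2\<close>.\<close>

lemma sum_coset_length:
  "(\<Sum>k\<in>coset_index n. q ^ coset_length n k) = (if n = 1 then 1 else q_number q n * (1 + q ^ (n - 1)))"
proof (cases "n = 1")
  case True
  then show ?thesis by (simp add: coset_index_def coset_length_def)
next
  case False
  have *: "coset_index n = (\<lambda>i. int i + 1) ` {..<n} \<union> (\<lambda>i. int i - int n) ` {..<n}"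
  proof (intro equalityI subsetI)
    fix k assume k: "k \<in> coset_index n"
    show "k \<in> (\<lambda>i. int i + 1) ` {..<n} \<union> (\<lambda>i. int i - int n) ` {..<n}"
    proof (cases "0 < k")
      case True
      then have "k = int (nat (k - 1)) + 1" "nat (k - 1) < n" using k by (auto simp: coset_index_def split: if_splits)
      then show ?thesis by blast
    next
      case False
      then have "k = int (nat (k + int n)) - int n" "nat (k + int n) < n"
        using k by (auto simp: coset_index_def split: if_splits)
      then show ?thesis by blast
    qed
  qed (use False in \<open>auto simp: coset_index_def\<close>)
  have "(\<Sum>k\<in>coset_index n. q ^ coset_length n k) =
    (\<Sum>k\<in>(\<lambda>i. int i + 1) ` {..<n}. q ^ coset_length n k) + (\<Sum>k\<in>(\<lambda>i. int i - int n) ` {..<n}. q ^ coset_length n k)"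
    unfolding * by (rule sum.union_disjoint) auto
  also have "\<dots> = (\<Sum>i<n. q ^ i) + (\<Sum>i<n. q ^ ((n - 1) + i))"
  proof -
    have "coset_length n (int i - int n) = n - 1 + i" "coset_length n (int i + 1) = i" if "i < n" for i
      using that by (auto simp: coset_length_def)
    then show ?thesis
      by (subst (1 2) sum.reindex) (auto intro!: inj_onI)
  qed
  finally have "(\<Sum>k\<in>coset_index n. q ^ coset_length n k) = (\<Sum>i<n. q ^ i) + (\<Sum>i<n. q ^ i) * q ^ (n - 1)"
    by (simp only: power_add sum_distrib_right mult.commute)
  then show ?thesis
    using False by (simp add: q_number_def distrib_left)
qed


section \<open>Weighted paths of a Jacobi recursion\<close>

text \<open>The number of nearest-neighbour paths on the naturals from \<open>0\<close> to \<open>k\<close> in \<open>n\<close> steps, where a step down from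
\<open>j\<close> has weight \<open>a j\<close>; equivalently, the \<open>k\<close>-th entry of the \<open>n\<close>-th power of the Jacobi matrix applied to the
first basis vector.\<close>

fun path_weight :: "(nat \<Rightarrow> real) \<Rightarrow> nat \<Rightarrow> nat \<Rightarrow> real"
  where
    "path_weight a 0 k = (if k = 0 then 1 else 0)"
  | "path_weight a (Suc n) k =
      (if k = 0 then 0 else path_weight a n (k - 1)) + a (Suc k) * path_weight a n (Suc k)"

lemma path_weight_eq_0: "n < k \<Longrightarrow> path_weight a n k = 0"
  by (induction a n k rule: path_weight.induct) auto

text \<open>If \<open>X\<close> satisfies a three-term recursion with parameters \<open>a\<close>, its recursion step turns path weights for \<open>n\<close> into
path weights for \<open>n + 1\<close>. It is applied to inner products with tensor powers of a vector and to the values of orthogonal polynomials.\<close>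

lemma sum_path_weight_Suc:
  fixes X :: "nat \<Rightarrow> 'b::real_vector"
  shows "(\<Sum>k\<le>Suc n. path_weight a (Suc n) k *\<^sub>R X k) =
    (\<Sum>k\<le>n. path_weight a n k *\<^sub>R (X (Suc k) + (if k = 0 then 0 else a k *\<^sub>R X (k - 1))))"
proof -
  have up: "(\<Sum>k\<le>Suc n. (if k = 0 then 0 else path_weight a n (k - 1)) *\<^sub>R X k) =
      (\<Sum>k\<le>n. path_weight a n k *\<^sub>R X (Suc k))"
    by (subst sum.atMost_Suc_shift) simp
  have "(\<Sum>k\<le>Suc n. (a (Suc k) * path_weight a n (Suc k)) *\<^sub>R X k) =
      (\<Sum>k\<in>{..Suc n}. path_weight a n (Suc k) *\<^sub>R (if Suc k = 0 then 0 else a (Suc k) *\<^sub>R X (Suc k - 1)))"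
    by (simp add: mult.commute)
  also have "\<dots> = (\<Sum>k\<in>{..Suc (Suc n)}. path_weight a n k *\<^sub>R (if k = 0 then 0 else a k *\<^sub>R X (k - 1)))"
    by (subst sum.atMost_Suc_shift[of _ "Suc n"]) simp
  also have "\<dots> = (\<Sum>k\<le>n. path_weight a n k *\<^sub>R (if k = 0 then 0 else a k *\<^sub>R X (k - 1)))"
    by (simp add: path_weight_eq_0)
  finally show ?thesis
    using up by (simp only: path_weight.simps scaleR_left_distrib sum.distrib scaleR_right_distrib)
qed


section \<open>The deformed inner product and the vacuum moments\<close>

lemma inner_words_Cons: "inner_words (y # ys) (z # zs) = cinner y z * inner_words ys zs"
  by (simp add: inner_words_def prod.lessThan_Suc_shift del: prod.lessThan_Suc)

lemma signed_perm_position: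
  assumes "\<sigma> \<in> carrier (signed_perms n)" "i < n"
  shows "nat \<bar>\<sigma> (int i + 1)\<bar> - 1 < n" "int (nat \<bar>\<sigma> (int i + 1)\<bar> - 1) + 1 = \<bar>\<sigma> (int i + 1)\<bar>"
proof -
  have "\<sigma> permutes ({- int n..int n} - {0})" using assms by (simp add: signed_perms_def)
  moreover have "int i + 1 \<in> {- int n..int n} - {0}" using assms by simp
  ultimately have "\<sigma> (int i + 1) \<in> {- int n..int n} - {0}" by (simp only: permutes_in_image)
  then show "nat \<bar>\<sigma> (int i + 1)\<bar> - 1 < n" "int (nat \<bar>\<sigma> (int i + 1)\<bar> - 1) + 1 = \<bar>\<sigma> (int i + 1)\<bar>"
    by auto
qed

lemma signed_perm_inverse:
  assumes "\<sigma> \<in> carrier (signed_perms n)"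
  shows "\<sigma> (inv_into UNIV \<sigma> j) = j" "inv_into UNIV \<sigma> (\<sigma> j) = j"
  using assms by (auto simp: signed_perms_def permutes_inverses)

text \<open>The word \<open>\<sigma>\<inverse> ys\<close>: letter \<open>i\<close> of the result is letter \<open>\<sigma>(i)\<close> of \<open>ys\<close>. In this form \<open>\<sigma>\<close> itself
is evaluated, so a left coset decomposition of \<open>\<sigma>\<close> separates the first letter.\<close>

definition pull_word :: "('h \<Rightarrow> 'h) \<Rightarrow> (int \<Rightarrow> int) \<Rightarrow> 'h list \<Rightarrow> 'h list"
  where "pull_word J \<sigma> ys = map (\<lambda>i. signed_letter J ys (\<sigma> (int i + 1))) [0..<length ys]"

lemma length_pull_word [simp]: "length (pull_word J \<sigma> ys) = length ys"
  by (simp add: pull_word_def)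

lemma act_word_inv:
  assumes "bij \<sigma>"
  shows "act_word J (inv_into UNIV \<sigma>) ys = pull_word J \<sigma> ys"
  by (simp add: act_word_def pull_word_def inv_inv_eq[OF assms])

text \<open>The action is unitary: the factor at position \<open>i\<close> on one side is the factor at position \<open>\<bar>\<sigma>\<inverse>(i)\<bar>\<close> on the other,
and a sign change may sit on either argument because \<open>J\<close> is a selfadjoint involution.\<close>

lemma inner_words_act_word:
  fixes J :: "'h::complex_hilbert \<Rightarrow> 'h"
  assumes J: "selfadjoint_involution J" and \<sigma>: "\<sigma> \<in> carrier (signed_perms (length zs))"
    and len: "length ys = length zs"
  shows "inner_words ys (act_word J \<sigma> zs) = inner_words (pull_word J \<sigma> ys) zs"
proof -
  let ?n = "length zs"
  let ?\<tau> = "inv_into UNIV \<sigma>"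
  have JJ: "J (J x) = x" and Jadj: "cinner (J x) y = cinner x (J y)" for x y
    using J by (auto simp: selfadjoint_involution_def)
  define T where "T i k = cinner (signed_letter J ys i) (signed_letter J zs k)" for i k
  have T_neg: "T (- i) (- k) = T i k" if "i \<noteq> 0" "k \<noteq> 0" for i k
    unfolding T_def using that by (simp add: signed_letter_uminus[OF JJ] Jadj JJ)
  have \<tau>: "?\<tau> \<in> carrier (signed_perms ?n)" using \<sigma> by (rule signed_perm_inv)
  have odd: "\<sigma> (- j) = - \<sigma> j" "?\<tau> (- j) = - ?\<tau> j" for j
    using \<sigma> \<tau> by (auto simp: signed_perms_def)
  note inv = signed_perm_inverse[OF \<sigma>]
  note posn = signed_perm_position[OF \<sigma>] signed_perm_position[OF \<tau>]
  have abs1: "\<sigma> \<bar>?\<tau> (int i + 1)\<bar> = (if ?\<tau> (int i + 1) > 0 then int i + 1 else - (int i + 1))" for i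
    using odd(1)[of "?\<tau> (int i + 1)"] inv(1)[of "int i + 1"] by (auto simp: abs_if)
  have abs2: "?\<tau> \<bar>\<sigma> (int i + 1)\<bar> = (if \<sigma> (int i + 1) > 0 then int i + 1 else - (int i + 1))" for i
    using odd(2)[of "\<sigma> (int i + 1)"] inv(2)[of "int i + 1"] by (auto simp: abs_if)
  have "inner_words ys (act_word J \<sigma> zs) = (\<Prod>i<?n. T (int i + 1) (?\<tau> (int i + 1)))"
    using len by (auto simp: inner_words_def act_word_def T_def signed_letter_def nat_add_distrib intro!: prod.cong)
  also have "\<dots> = (\<Prod>j<?n. T (\<sigma> (int j + 1)) (int j + 1))"
  \<comment> \<open>The image of a position under a signed permutation is a position up to sign; indices of lists start at zero, positions at one.\<close>
  proof (rule prod.reindex_bij_witness[of _ "\<lambda>j. nat \<bar>\<sigma> (int j + 1)\<bar> - 1" "\<lambda>i. nat \<bar>?\<tau> (int i + 1)\<bar> - 1"])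
    fix i assume i: "i \<in> {..<?n}"
    then have i': "i < ?n" by simp
    show "nat \<bar>\<sigma> (int (nat \<bar>?\<tau> (int i + 1)\<bar> - 1) + 1)\<bar> - 1 = i"
      unfolding posn(4)[OF i'] abs1 by (simp add: nat_add_distrib)
    show "nat \<bar>?\<tau> (int (nat \<bar>\<sigma> (int i + 1)\<bar> - 1) + 1)\<bar> - 1 = i"
      unfolding posn(2)[OF i'] abs2 by (simp add: nat_add_distrib)
    show "nat \<bar>?\<tau> (int i + 1)\<bar> - 1 \<in> {..<?n}" "nat \<bar>\<sigma> (int i + 1)\<bar> - 1 \<in> {..<?n}"
      using posn[OF i'] by auto
    have "?\<tau> (int i + 1) \<noteq> 0" using posn(4)[OF i'] by auto
    then show "T (\<sigma> (int (nat \<bar>?\<tau> (int i + 1)\<bar> - 1) + 1)) (int (nat \<bar>?\<tau> (int i + 1)\<bar> - 1) + 1) =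
        T (int i + 1) (?\<tau> (int i + 1))"
      unfolding posn(4)[OF i'] abs1 using T_neg[of "int i + 1" "?\<tau> (int i + 1)"] by auto
  qed
  also have "\<dots> = inner_words (pull_word J \<sigma> ys) zs"
    using len by (auto simp: inner_words_def pull_word_def T_def signed_letter_def nat_add_distrib intro!: prod.cong)
  finally show ?thesis .
qed

lemma clinear_sum:
  assumes "clinear f"
  shows "f (\<Sum>i\<in>A. g i) = (\<Sum>i\<in>A. f (g i))"
proof -
  interpret Vector_Spaces.linear scaleC scaleC f by (rule assms)
  show ?thesis by (rule sum)
qed

lemma clinear_eq_on_tensors:
  assumes "clinear F" "clinear G" "\<And>xs. F (tensor xs) = G (tensor xs)"
  shows "F f = G f"
proof -
  obtain r where "f = free_extend tensor r" using fock_eq_combination by blast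
  then show ?thesis
    using assms(3) by (simp add: free_extend_def clinear_sum[OF assms(1)] clinear_sum[OF assms(2)]
        clinear_scale[OF assms(1)] clinear_scale[OF assms(2)])
qed

lemma clinear_inner_q_right:
  assumes "selfadjoint_involution J"
  shows "clinear (inner_q q J f)"
proof -
  have "clinear J" using assms by (simp add: selfadjoint_involution_def)
  then have "clinear (type_D_symmetrizer q J)"
    unfolding type_D_symmetrizer_def[abs_def] by (intro clinear_fock_extend multilinear_symmetrizer)
  then show ?thesis
    unfolding inner_q_def[abs_def]
    by (intro clinearI)
      (simp_all add: clinear_add clinear_scale clinear_add[OF clinear_inner0_right] clinear_scale[OF clinear_inner0_right])
qed

lemma inner_q_add_left: "inner_q q J (f + g) h = inner_q q J f h + inner_q q J g h"
  unfolding inner_q_def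
  using inner0_commute[of "f + g"] inner0_commute[of f] inner0_commute[of g]
  by (simp add: clinear_add[OF clinear_inner0_right])

lemma inner_q_scaleC_left: "inner_q q J (c *\<^sub>C f) h = cnj c * inner_q q J f h"
  unfolding inner_q_def
  using inner0_commute[of "c *\<^sub>C f"] inner0_commute[of f]
  by (simp add: clinear_scale[OF clinear_inner0_right] scaleC_complex_def)

lemma inner_q_zero_left: "inner_q q J 0 h = 0"
  using inner_q_scaleC_left[of q J 0 0 h] by simp

lemma inner_q_sum_left: "inner_q q J (\<Sum>i\<in>A. f i) h = (\<Sum>i\<in>A. inner_q q J (f i) h)"
  by (induction A rule: infinite_finite_induct) (simp_all add: inner_q_zero_left inner_q_add_left)

lemma inner_q_tensor:
  fixes J :: "'h::complex_hilbert \<Rightarrow> 'h"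
  assumes J: "selfadjoint_involution J"
  shows "inner_q q J (tensor ys) (tensor zs) = (if length ys = length zs then
    \<Sum>\<sigma>\<in>type_D (length zs). of_real (q ^ type_D_length (length zs) \<sigma>) * inner_words (pull_word J \<sigma> ys) zs else 0)"
proof -
  have "clinear J" using J by (simp add: selfadjoint_involution_def)
  then have "inner_q q J (tensor ys) (tensor zs) =
    (\<Sum>\<sigma>\<in>type_D (length zs). of_real (q ^ type_D_length (length zs) \<sigma>) * inner_words ys (act_word J \<sigma> zs))"
    unfolding inner_q_def
    by (simp add: type_D_symmetrizer_tensor clinear_sum[OF clinear_inner0_right]
        clinear_scale[OF clinear_inner0_right] inner0_tensor inner_words_def scaleC_complex_def)
  also have "\<dots> = (if length ys = length zs then
    \<Sum>\<sigma>\<in>type_D (length zs). of_real (q ^ type_D_length (length zs) \<sigma>) * inner_words (pull_word J \<sigma> ys) zs else 0)"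
  proof (cases "length ys = length zs")
    case True
    have "inner_words ys (act_word J \<sigma> zs) = inner_words (pull_word J \<sigma> ys) zs"
      if "\<sigma> \<in> type_D (length zs)" for \<sigma>
      using that type_D_subset by (intro inner_words_act_word[OF J _ True]) blast
    then show ?thesis using True by simp
  qed (simp add: inner_words_def)
  finally show ?thesis .
qed

text \<open>The adjoint of \<open>\<sigma>\<close> is \<open>\<sigma>\<inverse>\<close>, which has the same length, so the symmetrizer is selfadjoint.\<close>

lemma inner_q_tensor_commute:
  fixes J :: "'h::complex_hilbert \<Rightarrow> 'h"
  assumes J: "selfadjoint_involution J"
  shows "inner_q q J (tensor ys) (tensor zs) = cnj (inner_q q J (tensor zs) (tensor ys))"
proof (cases "length ys = length zs")
  case True
  let ?D = "type_D (length zs)" and ?l = "type_D_length (length zs)"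
  have "inner_q q J (tensor ys) (tensor zs) =
    (\<Sum>\<sigma>\<in>?D. of_real (q ^ ?l \<sigma>) * inner_words (pull_word J \<sigma> ys) zs)"
    using True by (simp add: inner_q_tensor[OF J])
  also have "\<dots> = (\<Sum>\<sigma>\<in>?D. of_real (q ^ ?l \<sigma>) * inner_words (act_word J \<sigma> ys) zs)"
  proof (rule sum.reindex_bij_witness[of _ "inv_into UNIV" "inv_into UNIV"])
    fix \<sigma> assume \<sigma>: "\<sigma> \<in> ?D"
    then show "inv_into UNIV (inv_into UNIV \<sigma>) = \<sigma>" using type_D_bij inv_inv_eq by blast
    then show "inv_into UNIV (inv_into UNIV \<sigma>) = \<sigma>" .
    show "inv_into UNIV \<sigma> \<in> ?D" "inv_into UNIV \<sigma> \<in> ?D" using \<sigma> by (rule type_D_inv)+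
    show "of_real (q ^ ?l (inv_into UNIV \<sigma>)) * inner_words (act_word J (inv_into UNIV \<sigma>) ys) zs =
        of_real (q ^ ?l \<sigma>) * inner_words (pull_word J \<sigma> ys) zs"
      using \<sigma> by (simp add: type_D_length_inv act_word_inv type_D_bij)
  qed
  also have "\<dots> = (\<Sum>\<sigma>\<in>?D. of_real (q ^ ?l \<sigma>) * cnj (inner_words (pull_word J \<sigma> zs) ys))"
  proof (rule sum.cong[OF refl])
    fix \<sigma> assume "\<sigma> \<in> ?D"
    then have "\<sigma> \<in> carrier (signed_perms (length ys))" using True type_D_subset by auto
    then have "inner_words zs (act_word J \<sigma> ys) = inner_words (pull_word J \<sigma> zs) ys"
      using True by (intro inner_words_act_word[OF J]) auto
    then show "of_real (q ^ ?l \<sigma>) * inner_words (act_word J \<sigma> ys) zs =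
        of_real (q ^ ?l \<sigma>) * cnj (inner_words (pull_word J \<sigma> zs) ys)"
      using inner_words_commute[of "act_word J \<sigma> ys" zs] by simp
  qed
  also have "\<dots> = cnj (inner_q q J (tensor zs) (tensor ys))"
    using True by (simp add: inner_q_tensor[OF J] cnj_sum)
  finally show ?thesis .
qed (simp add: inner_q_tensor[OF J])

lemma inner_q_commute:
  fixes J :: "'h::complex_hilbert \<Rightarrow> 'h"
  assumes J: "selfadjoint_involution J"
  shows "inner_q q J f g = cnj (inner_q q J g f)"
proof -
  have lin: "clinear (\<lambda>g. cnj (inner_q q J g f))" for f
    by (rule clinearI) (simp_all add: inner_q_add_left inner_q_scaleC_left scaleC_complex_def)
  \<comment> \<open>Hermitian symmetry passes from words to general vectors one argument at a time.\<close>
  have "inner_q q J (tensor ys) g = cnj (inner_q q J g (tensor ys))" for ys g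
    using clinear_inner_q_right[OF J] lin inner_q_tensor_commute[OF J] by (rule clinear_eq_on_tensors)
  then have "cnj (inner_q q J (tensor ys) g) = inner_q q J g (tensor ys)" for ys g by simp
  with lin clinear_inner_q_right[OF J] have "cnj (inner_q q J f g) = inner_q q J g f"
    by (rule clinear_eq_on_tensors)
  then show ?thesis by (metis complex_cnj_cnj)
qed

text \<open>What is left of \<open>ys\<close> after the minimal representative of index \<open>k\<close> has moved letter \<open>\<bar>k\<bar>\<close> to the front: the other letters in
their order, the last one conjugated if \<open>k < 0\<close>.\<close>

definition coset_remainder :: "('h \<Rightarrow> 'h) \<Rightarrow> int \<Rightarrow> 'h list \<Rightarrow> 'h list"
  where "coset_remainder J k ys =
    map (\<lambda>i. signed_letter J ys (coset_rep (length ys) k (int i + 2))) [0..<length ys - 1]"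

lemma pull_word_coset:
  assumes JJ: "\<And>x. J (J x) = x" and k: "k \<in> coset_index (Suc m)" and \<tau>: "\<tau> \<in> type_D m"
    and len: "length ys = Suc m"
  shows "pull_word J (coset_rep (Suc m) k \<circ> tail_shift \<tau>) ys =
    signed_letter J ys k # pull_word J \<tau> (coset_remainder J k ys)"
proof (rule nth_equalityI)
  let ?w = "coset_rep (Suc m) k"
  fix i assume "i < length (pull_word J (?w \<circ> tail_shift \<tau>) ys)"
  then have i: "i < Suc m" using len by simp
  have nth: "pull_word J (?w \<circ> tail_shift \<tau>) ys ! i = signed_letter J ys (?w (tail_shift \<tau> (int i + 1)))"
    using i len by (simp add: pull_word_def del: upt_Suc)
  show "pull_word J (?w \<circ> tail_shift \<tau>) ys ! i =
    (signed_letter J ys k # pull_word J \<tau> (coset_remainder J k ys)) ! i"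
  proof (cases i)
    case 0
    then show ?thesis unfolding nth by (simp add: tail_shift_def coset_rep_def)
  next
    case (Suc l)
    then have l: "l < m" using i by simp
    define t where "t = \<tau> (int l + 1)"
    have \<tau>': "\<tau> \<in> carrier (signed_perms m)" using \<tau> type_D_subset by blast
    define p where "p = nat \<bar>t\<bar> - 1"
    have p: "p < m" "int p + 1 = \<bar>t\<bar>"
      using signed_perm_position[OF \<tau>' l] by (auto simp: t_def p_def)
    have "?w \<in> carrier (signed_perms (Suc m))" using coset_rep_in_type_D[OF k] type_D_subset by blast
    then have "?w (int p + 2) \<noteq> 0" by (simp add: signed_perm_zero)
    note neg = signed_letter_uminus[OF JJ this, of ys]
    have rem: "coset_remainder J k ys ! p = signed_letter J ys (?w (int p + 2))"
      using p(1) len by (simp add: coset_remainder_def)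
    have "(signed_letter J ys k # pull_word J \<tau> (coset_remainder J k ys)) ! i =
        signed_letter J (coset_remainder J k ys) t"
      using Suc l len by (simp add: pull_word_def coset_remainder_def t_def)
    also have "\<dots> = signed_letter J ys (?w (t + sgn t))"
    proof (cases "0 < t")
      case True
      then have "t + sgn t = int p + 2" using p(2) by simp
      then show ?thesis using True rem by (simp add: signed_letter_def[of _ "coset_remainder J k ys"] p_def add.commute)
    next
      case False
      then have "t + sgn t = - (int p + 2)" using p(2) by (simp add: sgn_if)
      then have "signed_letter J ys (?w (t + sgn t)) = J (signed_letter J ys (?w (int p + 2)))"
        using neg coset_rep_odd[of "Suc m" k "int p + 2"] by simp
      moreover have "p = nat (- t) - 1" using False p by (simp add: p_def)
      ultimately show ?thesis
        using False rem by (simp add: signed_letter_def[of _ "coset_remainder J k ys"])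
    qed
    also have "t + sgn t = tail_shift \<tau> (int i + 1)" using Suc by (simp add: tail_shift_def t_def add.commute)
    finally show ?thesis unfolding nth by simp
  qed
qed (simp add: len coset_remainder_def)

text \<open>The symmetrizer of \<open>D(n)\<close> factors through the one of \<open>D(n-1)\<close> acting on the last \<open>n - 1\<close> tensor factors.\<close>

lemma inner_q_tensor_Cons:
  fixes J :: "'h::complex_hilbert \<Rightarrow> 'h"
  assumes J: "selfadjoint_involution J" and len: "length ys = Suc (length zs)"
  shows "inner_q q J (tensor ys) (tensor (z # zs)) =
    (\<Sum>k\<in>coset_index (length ys). of_real (q ^ coset_length (length ys) k) *
      (cinner (signed_letter J ys k) z * inner_q q J (tensor (coset_remainder J k ys)) (tensor zs)))"
proof -
  have JJ: "J (J x) = x" for x using J by (simp add: selfadjoint_involution_def)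
  let ?m = "length zs"
  have "inner_q q J (tensor ys) (tensor (z # zs)) = (\<Sum>\<sigma>\<in>type_D (Suc ?m).
      of_real (q ^ type_D_length (Suc ?m) \<sigma>) * inner_words (pull_word J \<sigma> ys) (z # zs))"
    using len by (simp add: inner_q_tensor[OF J])
  also have "\<dots> = (\<Sum>k\<in>coset_index (Suc ?m). of_real (q ^ coset_length (Suc ?m) k) *
      (\<Sum>\<tau>\<in>type_D ?m. of_real (q ^ type_D_length ?m \<tau>) *
        inner_words (pull_word J (coset_rep (Suc ?m) k \<circ> tail_shift \<tau>) ys) (z # zs)))"
    by (rule sum_type_D_Suc)
  also have "\<dots> = (\<Sum>k\<in>coset_index (Suc ?m). of_real (q ^ coset_length (Suc ?m) k) *
      (\<Sum>\<tau>\<in>type_D ?m. of_real (q ^ type_D_length ?m \<tau>) *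
        (cinner (signed_letter J ys k) z * inner_words (pull_word J \<tau> (coset_remainder J k ys)) zs)))"
    by (intro sum.cong arg_cong2[of _ _ _ _ "(*)"] refl)
      (simp add: pull_word_coset[OF JJ _ _ len] inner_words_Cons)
  also have "\<dots> = (\<Sum>k\<in>coset_index (Suc ?m). of_real (q ^ coset_length (Suc ?m) k) *
      (cinner (signed_letter J ys k) z * inner_q q J (tensor (coset_remainder J k ys)) (tensor zs)))"
    using len by (simp add: inner_q_tensor[OF J] coset_remainder_def sum_distrib_left mult.left_commute)
  finally show ?thesis by (simp only: len)
qed

text \<open>The value at \<open>ys\<close> of the adjoint of the creation operator of \<open>x\<close>.\<close>

definition adjoint_word :: "real \<Rightarrow> ('h::complex_hilbert \<Rightarrow> 'h) \<Rightarrow> 'h \<Rightarrow> 'h list \<Rightarrow> 'h fock"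
  where "adjoint_word q J x ys = (if ys = [] then 0 else
    \<Sum>k\<in>coset_index (length ys). (of_real (q ^ coset_length (length ys) k) * cinner x (signed_letter J ys k)) *\<^sub>C
      tensor (coset_remainder J k ys))"

lemma clinear_creation: "clinear (creation x)"
  unfolding creation_def[abs_def] by (rule clinear_fock_extend[OF multilinear_creation])

lemma inner_q_adjoint_word:
  fixes J :: "'h::complex_hilbert \<Rightarrow> 'h"
  assumes J: "selfadjoint_involution J"
  shows "inner_q q J (adjoint_word q J x ys) g = inner_q q J (tensor ys) (creation x g)"
proof (rule clinear_eq_on_tensors[OF clinear_inner_q_right[OF J]])
  show "clinear (\<lambda>g. inner_q q J (tensor ys) (creation x g))"
    by (rule clinearI)
      (simp_all add: clinear_add[OF clinear_creation] clinear_scale[OF clinear_creation]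
        clinear_add[OF clinear_inner_q_right[OF J]] clinear_scale[OF clinear_inner_q_right[OF J]])
  fix zs :: "'h list"
  have exp: "inner_q q J (adjoint_word q J x ys) (tensor zs) =
      (\<Sum>k\<in>coset_index (length ys). of_real (q ^ coset_length (length ys) k) *
      (cinner (signed_letter J ys k) x * inner_q q J (tensor (coset_remainder J k ys)) (tensor zs)))"
    if "ys \<noteq> []"
    using that by (simp add: adjoint_word_def inner_q_sum_left inner_q_scaleC_left mult.assoc
        flip: cinner_commute)
  show "inner_q q J (adjoint_word q J x ys) (tensor zs) = inner_q q J (tensor ys) (creation x (tensor zs))"
  proof (cases "length ys = Suc (length zs)")
    case True
    then have "ys \<noteq> []" by auto
    then show ?thesis using exp inner_q_tensor_Cons[OF J True] by (simp add: creation_tensor)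
  next
    case False
    then have "inner_q q J (tensor ys) (creation x (tensor zs)) = 0"
      by (simp add: creation_tensor inner_q_tensor[OF J])
    moreover have "inner_q q J (adjoint_word q J x ys) (tensor zs) = 0"
    proof (cases "ys = []")
      case True
      then show ?thesis by (simp add: adjoint_word_def inner_q_zero_left)
    next
      case ne: False
      then have "length (coset_remainder J k ys) \<noteq> length zs" for k
        using False by (cases ys) (auto simp: coset_remainder_def)
      then show ?thesis by (simp add: exp[OF ne] inner_q_tensor[OF J])
    qed
    ultimately show ?thesis by simp
  qed
qed

text \<open>The annihilation operator is a choice among all adjoints, so an adjoint has to be exhibited. Only the
existence of a suitable vector for each \<open>f\<close> matters, hence any expansion of \<open>f\<close> in words serves.\<close>

lemma annihilation_adjoint:
  fixes J :: "'h::complex_hilbert \<Rightarrow> 'h"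
  assumes J: "selfadjoint_involution J"
  shows "inner_q q J (annihilation q J x f) g = inner_q q J f (creation x g)"
proof -
  have "\<exists>h. \<forall>g. inner_q q J h g = inner_q q J f (creation x g)" for f
  proof -
    obtain r where r: "f = free_extend tensor r" using fock_eq_combination by blast
    show ?thesis
      by (rule exI[of _ "\<Sum>ys\<in>Poly_Mapping.keys r. Poly_Mapping.lookup r ys *\<^sub>C adjoint_word q J x ys"])
        (simp add: r free_extend_def inner_q_sum_left inner_q_scaleC_left inner_q_adjoint_word[OF J])
  qed
  then have "\<exists>d. \<forall>f g. inner_q q J (d f) g = inner_q q J f (creation x g)" by metis
  from someI_ex[OF this] show ?thesis unfolding annihilation_def by blast
qed

lemma gaussian_symmetric:
  fixes J :: "'h::complex_hilbert \<Rightarrow> 'h"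
  assumes J: "selfadjoint_involution J"
  shows "inner_q q J (gaussian q J x f) g = inner_q q J f (gaussian q J x g)"
proof -
  have "inner_q q J (creation x f) g = cnj (inner_q q J (annihilation q J x g) f)"
    unfolding annihilation_adjoint[OF J] by (rule inner_q_commute[OF J])
  also have "\<dots> = inner_q q J f (annihilation q J x g)" by (rule inner_q_commute[OF J, symmetric])
  finally show ?thesis
    by (simp add: gaussian_def inner_q_add_left clinear_add[OF clinear_inner_q_right[OF J]]
        annihilation_adjoint[OF J])
qed

definition jacobi_q :: "real \<Rightarrow> nat \<Rightarrow> real"
  where "jacobi_q q n = (if n = 1 then 1 else q_number q n * (1 + q ^ (n - 1)))"

text \<open>This is where \<open>J x = \<plusminus>x\<close> enters: a term with negative index contains the sign twice, once from the
removed letter and once from the conjugated last letter of the remainder, so all terms are multiples of one vector.\<close>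

lemma adjoint_word_replicate:
  fixes J :: "'h::complex_hilbert \<Rightarrow> 'h"
  assumes J: "selfadjoint_involution J" and x: "norm x = 1" "J x = x \<or> J x = - x"
  shows "adjoint_word q J x (replicate (Suc m) x) = of_real (jacobi_q q (Suc m)) *\<^sub>C tensor (replicate m x)"
proof -
  define n where "n = Suc m"
  \<comment> \<open>The eigenvalue of \<open>x\<close> under \<open>J\<close>, whose square is one.\<close>
  define \<epsilon> :: complex where "\<epsilon> = (if J x = x then 1 else - 1)"
  have \<epsilon>: "J x = \<epsilon> *\<^sub>C x" "\<epsilon> * \<epsilon> = 1"
    using x(2) by (auto simp: \<epsilon>_def scaleC_one)
  have xx: "cinner x x = 1" using x(1) by (simp add: cinner_self)
  have letter: "signed_letter J (replicate n x) j = (if 0 < j then x else J x)" if "\<bar>j\<bar> \<le> int n" "j \<noteq> 0" for j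
  proof -
    have "nat j - 1 < n \<and> nat (- j) - 1 < n" using that by (auto simp: n_def)
    then show ?thesis by (simp add: signed_letter_def)
  qed
  have summand: "cinner x (signed_letter J (replicate n x) k) *\<^sub>C tensor (coset_remainder J k (replicate n x))
      = tensor (replicate m x)" if k: "k \<in> coset_index n" for k
  proof (cases "0 < k")
    case True
    then have "k \<le> int n" using k by (auto simp: coset_index_def split: if_splits)
    have "coset_remainder J k (replicate n x) = replicate m x"
    proof (rule nth_equalityI)
      fix i assume "i < length (coset_remainder J k (replicate n x))"
      then have i: "i < m" by (simp add: coset_remainder_def n_def)
      then have "0 < coset_rep n k (int i + 2)" "\<bar>coset_rep n k (int i + 2)\<bar> \<le> int n"
        using True \<open>k \<le> int n\<close> by (auto simp: coset_rep_def coset_tail_def n_def)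
      then show "coset_remainder J k (replicate n x) ! i = replicate m x ! i"
        using i letter[of "coset_rep n k (int i + 2)"] by (simp add: coset_remainder_def n_def)
    qed (simp add: coset_remainder_def n_def)
    then show ?thesis using letter[of k] True \<open>k \<le> int n\<close> by (simp add: xx scaleC_one)
  next
    case False
    then have k: "k < 0" "- int n \<le> k" "n \<ge> 2" using k by (auto simp: coset_index_def split: if_splits)
    then obtain l where l: "m = Suc l" by (cases m) (auto simp: n_def)
    have "coset_remainder J k (replicate n x) = replicate l x @ [J x] @ []"
    proof (rule nth_equalityI)
      fix i assume "i < length (coset_remainder J k (replicate n x))"
      then have i: "i < m" by (simp add: coset_remainder_def n_def)
      then have "coset_rep n k (int i + 2) \<noteq> 0" "\<bar>coset_rep n k (int i + 2)\<bar> \<le> int n"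
        "0 < coset_rep n k (int i + 2) \<longleftrightarrow> i < l"
        using k by (auto simp: coset_rep_def coset_tail_def n_def l)
      then show "coset_remainder J k (replicate n x) ! i = (replicate l x @ [J x] @ []) ! i"
        using i letter[of "coset_rep n k (int i + 2)"]
        by (auto simp: coset_remainder_def n_def nth_append nth_Cons' l less_Suc_eq)
    qed (simp add: coset_remainder_def n_def l)
    moreover have "tensor (replicate l x @ [J x] @ []) = \<epsilon> *\<^sub>C tensor (replicate l x @ [x] @ [])"
      unfolding \<epsilon>(1)
      using multilinear_tensor[unfolded multilinear_def, rule_format, of "replicate l x" "[]"]
      by (rule clinear_scale)
    moreover have "cinner x (signed_letter J (replicate n x) k) = \<epsilon>"
      using letter[of k] k by (simp add: \<epsilon>(1) cinner_scaleC_right xx)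
    ultimately show ?thesis
      by (simp add: l scaleC_scaleC \<epsilon>(2) scaleC_one replicate_append_same)
  qed
  have "adjoint_word q J x (replicate n x) =
      (\<Sum>k\<in>coset_index n. of_real (q ^ coset_length n k) *\<^sub>C tensor (replicate m x))"
  proof -
    have "replicate n x \<noteq> []" by (simp add: n_def)
    then show ?thesis
      unfolding adjoint_word_def
      by (simp only: if_False length_replicate scaleC_scaleC[symmetric] summand cong: sum.cong)
  qed
  also have "\<dots> = (\<Sum>k\<in>coset_index n. complex_of_real (q ^ coset_length n k)) *\<^sub>C tensor (replicate m x)"
    by (simp add: complex_vector.scale_sum_left)
  also have "(\<Sum>k\<in>coset_index n. complex_of_real (q ^ coset_length n k)) = of_real (jacobi_q q n)"
    unfolding of_real_sum[symmetric] sum_coset_length jacobi_q_def ..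
  finally show ?thesis by (simp only: n_def)
qed

lemma inner_q_gaussian_replicate:
  fixes J :: "'h::complex_hilbert \<Rightarrow> 'h"
  assumes J: "selfadjoint_involution J" and x: "norm x = 1" "J x = x \<or> J x = - x"
  shows "inner_q q J (gaussian q J x (tensor (replicate k x))) h =
    inner_q q J (tensor (replicate (Suc k) x)) h +
    (if k = 0 then 0 else jacobi_q q k *\<^sub>R inner_q q J (tensor (replicate (k - 1) x)) h)"
proof -
  have "inner_q q J (gaussian q J x (tensor (replicate k x))) h =
    inner_q q J (adjoint_word q J x (replicate k x)) h + inner_q q J (tensor (replicate (Suc k) x)) h"
    by (simp add: gaussian_def inner_q_add_left annihilation_adjoint[OF J] inner_q_adjoint_word[OF J] creation_tensor)
  moreover have "inner_q q J (adjoint_word q J x (replicate k x)) h =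
    (if k = 0 then 0 else jacobi_q q k *\<^sub>R inner_q q J (tensor (replicate (k - 1) x)) h)"
  proof (cases k)
    case 0
    then show ?thesis by (simp add: adjoint_word_def inner_q_zero_left)
  next
    case (Suc m)
    show ?thesis
      unfolding Suc adjoint_word_replicate[OF J x] inner_q_scaleC_left by (simp add: scaleR_conv_of_real)
  qed
  ultimately show ?thesis by simp
qed

text \<open>Moving one factor \<open>G\<close> at a time to the other side of the inner product, where the induction hypothesis for
arbitrary \<open>h\<close> applies to it.\<close>

lemma inner_q_gaussian_power:
  fixes J :: "'h::complex_hilbert \<Rightarrow> 'h"
  assumes J: "selfadjoint_involution J" and x: "norm x = 1" "J x = x \<or> J x = - x"
  shows "inner_q q J ((gaussian q J x ^^ n) \<Omega>) h =
    (\<Sum>k\<le>n. path_weight (jacobi_q q) n k *\<^sub>R inner_q q J (tensor (replicate k x)) h)"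
proof (induction n arbitrary: h)
  case 0
  show ?case by simp
next
  case (Suc n)
  have "inner_q q J ((gaussian q J x ^^ Suc n) \<Omega>) h = inner_q q J ((gaussian q J x ^^ n) \<Omega>) (gaussian q J x h)"
    by (simp add: gaussian_symmetric[OF J])
  also have "\<dots> = (\<Sum>k\<le>n. path_weight (jacobi_q q) n k *\<^sub>R inner_q q J (gaussian q J x (tensor (replicate k x))) h)"
    by (simp only: Suc.IH gaussian_symmetric[OF J])
  also have "\<dots> = (\<Sum>k\<le>Suc n. path_weight (jacobi_q q) (Suc n) k *\<^sub>R inner_q q J (tensor (replicate k x)) h)"
    unfolding inner_q_gaussian_replicate[OF J x] by (rule sum_path_weight_Suc[symmetric])
  finally show ?case .
qed

lemma vacuum_moment:
  fixes J :: "'h::complex_hilbert \<Rightarrow> 'h"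
  assumes J: "selfadjoint_involution J" and x: "norm x = 1" "J x = x \<or> J x = - x"
  shows "inner_q q J \<Omega> ((gaussian q J x ^^ n) \<Omega>) = of_real (path_weight (jacobi_q q) n 0)"
proof -
  have D0: "type_D 0 = {id}"
    by (auto simp: type_D_iff_word type_D_generators_def intro: exI[of _ "[]"])
  have "inner_q q J (tensor (replicate k x)) \<Omega> = (if k = 0 then 1 else 0)" for k
    by (simp add: inner_q_tensor[OF J] D0 type_D_length_id pull_word_def inner_words_def)
  then have "inner_q q J ((gaussian q J x ^^ n) \<Omega>) \<Omega> = of_real (path_weight (jacobi_q q) n 0)"
    unfolding inner_q_gaussian_power[OF J x]
    by (simp add: scaleR_conv_of_real if_distrib[of "(*) _"] cong: if_cong)
  then show ?thesis by (subst inner_q_commute[OF J]) simp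
qed


section \<open>Jacobi polynomials and the positivity of their moment functional\<close>

fun jacobi_poly :: "(nat \<Rightarrow> real) \<Rightarrow> nat \<Rightarrow> real poly"
  where
    "jacobi_poly a 0 = 1"
  | "jacobi_poly a (Suc 0) = [:0, 1:]"
  | "jacobi_poly a (Suc (Suc n)) = [:0, 1:] * jacobi_poly a (Suc n) - smult (a (Suc n)) (jacobi_poly a n)"

lemma degree_lead_coeff_jacobi_poly:
  "degree (jacobi_poly a n) = n \<and> lead_coeff (jacobi_poly a n) = 1"
proof (induction a n rule: jacobi_poly.induct)
  case (3 a n)
  let ?p = "jacobi_poly a (Suc n)" and ?r = "smult (a (Suc n)) (jacobi_poly a n)"
  have p: "?p \<noteq> 0" using 3(1) by auto
  have deg: "degree (pCons 0 ?p) = Suc (Suc n)" using 3 p by simp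
  have r: "degree ?r < Suc (Suc n)"
    using 3(2) degree_smult_le[of "a (Suc n)" "jacobi_poly a n"] by simp
  have eq: "jacobi_poly a (Suc (Suc n)) = pCons 0 ?p - ?r" by simp
  have "coeff (pCons 0 ?p - ?r) (Suc (Suc n)) = 1"
  proof -
    have "coeff ?p (Suc n) = 1" using 3(1) by (metis (no_types))
    then show ?thesis by (simp only: coeff_diff coeff_pCons_Suc coeff_eq_0[OF r] diff_zero)
  qed
  moreover have "degree (pCons 0 ?p - ?r) \<le> Suc (Suc n)"
    using deg r by (intro degree_diff_le) auto
  ultimately have "degree (pCons 0 ?p - ?r) = Suc (Suc n)"
    by (metis le_antisym le_degree zero_neq_one)
  with \<open>coeff (pCons 0 ?p - ?r) (Suc (Suc n)) = 1\<close> show ?case unfolding eq by simp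
qed simp_all

lemma degree_jacobi_poly: "degree (jacobi_poly a n) = n"
  and lead_coeff_jacobi_poly: "coeff (jacobi_poly a n) n = 1"
  using degree_lead_coeff_jacobi_poly[of a n] by metis+

lemma power_eq_sum_jacobi_poly:
  "t ^ n = (\<Sum>k\<le>n. path_weight a n k * poly (jacobi_poly a k) t)"
proof (induction n)
  case (Suc n)
  have rec: "t * poly (jacobi_poly a k) t = poly (jacobi_poly a (Suc k)) t +
      (if k = 0 then 0 else a k *\<^sub>R poly (jacobi_poly a (k - 1)) t)" for k
    by (cases k) simp_all
  have "t ^ Suc n = (\<Sum>k\<le>n. path_weight a n k *\<^sub>R (t * poly (jacobi_poly a k) t))"
    by (simp add: Suc sum_distrib_left mult.left_commute)
  also have "\<dots> = (\<Sum>k\<le>Suc n. path_weight a (Suc n) k *\<^sub>R poly (jacobi_poly a k) t)"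
    unfolding rec by (rule sum_path_weight_Suc[symmetric])
  finally show ?case by simp
qed simp

text \<open>The \<open>k\<close>-th coefficient of \<open>p\<close> in the basis of the Jacobi polynomials (see \<open>coord_jacobi_poly\<close>), written without
reference to a basis. The coefficient \<open>coord a 0\<close> is the moment functional of the orthogonality measure.\<close>

definition coord :: "(nat \<Rightarrow> real) \<Rightarrow> nat \<Rightarrow> real poly \<Rightarrow> real"
  where "coord a k p = (\<Sum>n\<le>degree p. coeff p n * path_weight a n k)"

lemma coord_superset:
  assumes "degree p \<le> N"
  shows "coord a k p = (\<Sum>n\<le>N. coeff p n * path_weight a n k)"
  unfolding coord_def using assms
  by (intro sum.mono_neutral_left) (auto simp: coeff_eq_0)

lemma coord_add: "coord a k (p + r) = coord a k p + coord a k r"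
proof -
  let ?N = "max (degree p) (degree r)"
  have "degree (p + r) \<le> ?N" by (rule degree_add_le_max)
  then show ?thesis
    by (simp add: coord_superset[of _ ?N] sum.distrib distrib_right)
qed

lemma coord_smult: "coord a k (smult c p) = c * coord a k p"
  using degree_smult_le[of c p]
  by (simp add: coord_superset[of _ "degree p"] sum_distrib_left mult.assoc)

lemma coord_diff: "coord a k (p - r) = coord a k p - coord a k r"
  using coord_add[of a k p "smult (-1) r"] coord_smult[of a k "-1" r] by simp

text \<open>Up to the constant term, \<open>pCons c p\<close> is the product of \<open>p\<close> with the variable, which acts on coordinates by the
transposed recursion.\<close>

lemma coord_pCons: "coord a k (pCons c p) = (if k = 0 then c else 0) +
    (if k = 0 then 0 else coord a (k - 1) p) + a (Suc k) * coord a (Suc k) p"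
proof -
  have "coord a k (pCons c p) = (\<Sum>n\<le>Suc (degree p). coeff (pCons c p) n * path_weight a n k)"
    by (rule coord_superset) (rule degree_pCons_le)
  also have "\<dots> = c * path_weight a 0 k + (\<Sum>n\<le>degree p. coeff p n * path_weight a (Suc n) k)"
    by (simp add: sum.atMost_Suc_shift del: sum.atMost_Suc path_weight.simps)
  also have "(\<Sum>n\<le>degree p. coeff p n * path_weight a (Suc n) k) =
    (if k = 0 then 0 else coord a (k - 1) p) + a (Suc k) * coord a (Suc k) p"
    by (simp add: coord_def distrib_left sum.distrib sum_distrib_left mult.left_commute)
  finally show ?thesis by (simp add: add.assoc)
qed

lemma coord_one: "coord a k 1 = (if k = 0 then 1 else 0)"
  by (simp add: coord_def)

lemma coord_eq_0: "degree p < k \<Longrightarrow> coord a k p = 0"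
  unfolding coord_def by (intro sum.neutral) (auto simp: path_weight_eq_0)

lemma coord_zero [simp]: "coord a k 0 = 0"
  by (simp add: coord_def)

lemma coord_jacobi_poly: "coord a k (jacobi_poly a n) = (if k = n then 1 else 0)"
proof (induction a n arbitrary: k rule: jacobi_poly.induct)
  case (1 a)
  then show ?case by (simp add: coord_one)
next
  case (2 a)
  have "[:0, 1:] = pCons 0 (1::real poly)" by simp
  then show ?case by (simp only: jacobi_poly.simps coord_pCons coord_one) auto
next
  case (3 a n)
  have "jacobi_poly a (Suc (Suc n)) = pCons 0 (jacobi_poly a (Suc n)) - smult (a (Suc n)) (jacobi_poly a n)"
    by simp
  then show ?case
    by (simp only: coord_diff coord_smult coord_pCons 3) auto
qed

text \<open>The squared length of the \<open>n\<close>-th monic orthogonal polynomial.\<close>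

definition sq_norm :: "(nat \<Rightarrow> real) \<Rightarrow> nat \<Rightarrow> real"
  where "sq_norm a n = (\<Prod>i<n. a (Suc i))"

lemma sq_norm_simps [simp]: "sq_norm a 0 = 1" "sq_norm a (Suc n) = a (Suc n) * sq_norm a n"
  by (simp_all add: sq_norm_def)

text \<open>Multiplication by the variable is symmetric for the inner product with weights \<open>sq_norm\<close>; this is what makes the weights
satisfy \<open>h\<^sub>n\<^sub>+\<^sub>1 = a\<^sub>n\<^sub>+\<^sub>1 h\<^sub>n\<close>. The bounds on the degrees make the term cut off at \<open>N\<close> vanish.\<close>

lemma coord_pCons_symmetric:
  assumes "degree p < N" "degree r < N"
  shows "(\<Sum>k\<le>N. sq_norm a k * coord a k (pCons 0 p) * coord a k r) =
    (\<Sum>k\<le>N. sq_norm a k * coord a k p * coord a k (pCons 0 r))"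
proof -
  have *: "(\<Sum>k\<le>N. sq_norm a k * coord a k (pCons 0 p) * coord a k r) =
      (\<Sum>k<N. sq_norm a (Suc k) * coord a k p * coord a (Suc k) r) +
      (\<Sum>k<N. sq_norm a (Suc k) * coord a (Suc k) p * coord a k r)"
    if "degree p < N" "degree r < N" for p r
  proof -
    have "(\<Sum>k\<le>N. sq_norm a k * coord a k (pCons 0 p) * coord a k r) =
      (\<Sum>k\<le>N. sq_norm a k * (if k = 0 then 0 else coord a (k - 1) p) * coord a k r) +
      (\<Sum>k\<le>N. sq_norm a (Suc k) * coord a (Suc k) p * coord a k r)"
      unfolding coord_pCons by (simp add: sum.distrib[symmetric] algebra_simps)
    also have "(\<Sum>k\<le>N. sq_norm a k * (if k = 0 then 0 else coord a (k - 1) p) * coord a k r) =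
      (\<Sum>k<N. sq_norm a (Suc k) * coord a k p * coord a (Suc k) r)"
      by (subst sum.atMost_shift) simp
    also have "(\<Sum>k\<le>N. sq_norm a (Suc k) * coord a (Suc k) p * coord a k r) =
      (\<Sum>k<N. sq_norm a (Suc k) * coord a (Suc k) p * coord a k r)"
      using that by (simp add: lessThan_Suc_atMost[symmetric] coord_eq_0)
    finally show ?thesis .
  qed
  have "(\<Sum>k\<le>N. sq_norm a k * coord a k (pCons 0 p) * coord a k r) =
      (\<Sum>k\<le>N. sq_norm a k * coord a k (pCons 0 r) * coord a k p)"
    unfolding *[OF assms] *[OF assms(2,1)] by (simp add: mult_ac)
  then show ?thesis by (simp add: mult_ac)
qed

text \<open>The moment functional of a product is the weighted inner product of the coordinates: the factor \<open>p\<close> is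
moved to the other side one power of the variable at a time.\<close>

lemma coord_mult:
  assumes "degree p + degree r < N"
  shows "coord a 0 (p * r) = (\<Sum>k\<le>N. sq_norm a k * coord a k p * coord a k r)"
  using assms
proof (induction p arbitrary: r)
  case (pCons c p)
  have c: "(\<Sum>k\<le>N. sq_norm a k * coord a k [:c:] * coord a k r) = c * coord a 0 r"
    by (subst sum.atMost_shift) (simp add: coord_pCons)
  show ?case
  proof (cases "p = 0")
    case True
    then show ?thesis using c by (simp add: coord_smult)
  next
    case False
    then have d: "degree p + degree (pCons 0 r) < N" "degree p < N" "degree r < N"
      using pCons.prems degree_pCons_le[of 0 r] by (auto intro: le_less_trans)
    have "coord a 0 (pCons c p * r) = c * coord a 0 r + coord a 0 (p * pCons 0 r)"
      by (simp add: coord_add coord_smult)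
    also have "coord a 0 (p * pCons 0 r) = (\<Sum>k\<le>N. sq_norm a k * coord a k (pCons 0 p) * coord a k r)"
      using pCons.IH[OF d(1)] coord_pCons_symmetric[OF d(2,3)] by simp
    also have "c * coord a 0 r + \<dots> =
        (\<Sum>k\<le>N. sq_norm a k * (coord a k [:c:] + coord a k (pCons 0 p)) * coord a k r)"
      unfolding c[symmetric] by (simp add: sum.distrib[symmetric] algebra_simps)
    also have "\<dots> = (\<Sum>k\<le>N. sq_norm a k * coord a k (pCons c p) * coord a k r)"
      by (simp add: coord_add[symmetric])
    finally show ?thesis .
  qed
qed simp

text \<open>The condition on \<open>C\<close> says that the symmetric Jacobi matrix with off-diagonal entries \<open>sqrt (a n)\<close> has norm at most \<open>C\<close>.\<close>

locale bounded_jacobi =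
  fixes a :: "nat \<Rightarrow> real" and C :: real
  assumes a_pos: "\<And>n. 0 < a (Suc n)" and a_le: "\<And>n. 4 * a (Suc n) \<le> C\<^sup>2" and C_pos: "0 < C"
begin

abbreviation (input) L :: "real poly \<Rightarrow> real" where "L \<equiv> coord a 0"

lemma sq_norm_pos: "0 < sq_norm a n"
  unfolding sq_norm_def by (intro prod_pos) (simp add: a_pos)

lemma L_jacobi_mult: "L (jacobi_poly a m * jacobi_poly a n) = (if m = n then sq_norm a n else 0)"
proof -
  have "L (jacobi_poly a m * jacobi_poly a n) =
    (\<Sum>k\<le>Suc (m + n). sq_norm a k * (if k = m then 1 else 0) * (if k = n then 1 else 0))"
    using coord_mult[of "jacobi_poly a m" "jacobi_poly a n" "Suc (m + n)" a]
    by (simp add: degree_jacobi_poly coord_jacobi_poly del: sum.atMost_Suc)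
  also have "\<dots> = (\<Sum>k\<in>{..Suc (m + n)}. if k = n then (if m = n then sq_norm a n else 0) else 0)"
    by (intro sum.cong) auto
  finally show ?thesis by (simp del: sum.atMost_Suc)
qed

lemma L_square_nonneg: "0 \<le> L (s * s)"
proof -
  have "L (s * s) = (\<Sum>k\<le>Suc (degree s + degree s). sq_norm a k * coord a k s * coord a k s)"
    by (rule coord_mult) simp
  also have "\<dots> \<ge> 0"
    by (intro sum_nonneg) (simp add: mult.assoc less_imp_le[OF sq_norm_pos])
  finally show ?thesis .
qed

text \<open>In coordinates the variable is the sum of a step up and a step down, and each of the two has squared norm at most \<open>C\<^sup>2 / 4\<close>.\<close>

lemma L_x_square_le: "L (pCons 0 s * pCons 0 s) \<le> C\<^sup>2 * L (s * s)"
proof -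
  define N where "N = degree s + degree s + 3"
  define u where "u k = coord a k s" for k
  have u0: "u k = 0" if "k \<ge> N" for k using that coord_eq_0[of s k] by (simp add: u_def N_def)
  have le: "4 * (a (Suc k) * (sq_norm a k * (u k)\<^sup>2)) \<le> C\<^sup>2 * (sq_norm a k * (u k)\<^sup>2)"
    "4 * (a (Suc k) * (sq_norm a (Suc k) * (u (Suc k))\<^sup>2)) \<le> C\<^sup>2 * (sq_norm a (Suc k) * (u (Suc k))\<^sup>2)" for k
    using mult_right_mono[OF a_le[of k]] sq_norm_pos
    unfolding mult.assoc[symmetric, of 4] by (simp_all only: zero_le_mult_iff zero_le_power2 less_imp_le simp_thms)
  have "degree (pCons 0 s) + degree (pCons 0 s) < N"
    using degree_pCons_le[of 0 s] by (simp add: N_def)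
  then have "L (pCons 0 s * pCons 0 s) = (\<Sum>k\<le>N. sq_norm a k * (coord a k (pCons 0 s))\<^sup>2)"
    using coord_mult[of "pCons 0 s" "pCons 0 s" N a] by (simp add: power2_eq_square mult.assoc)
  also have "\<dots> \<le> (\<Sum>k\<le>N. 2 * (sq_norm a k * (if k = 0 then 0 else u (k - 1))\<^sup>2) +
      2 * (a (Suc k) * (sq_norm a (Suc k) * (u (Suc k))\<^sup>2)))"
  proof (rule sum_mono)
    fix k
    have sq: "(v + w)\<^sup>2 \<le> 2 * v\<^sup>2 + 2 * w\<^sup>2" for v w :: real
      using sum_squares_bound[of v w] by (simp add: power2_sum)
    have "coord a k (pCons 0 s) = (if k = 0 then 0 else u (k - 1)) + a (Suc k) * u (Suc k)"
      by (simp add: coord_pCons u_def)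
    then have "sq_norm a k * (coord a k (pCons 0 s))\<^sup>2 \<le>
        sq_norm a k * (2 * (if k = 0 then 0 else u (k - 1))\<^sup>2 + 2 * (a (Suc k) * u (Suc k))\<^sup>2)"
      using sq sq_norm_pos[of k] by (simp only: mult_le_cancel_left_pos)
    then show "sq_norm a k * (coord a k (pCons 0 s))\<^sup>2 \<le>
        2 * (sq_norm a k * (if k = 0 then 0 else u (k - 1))\<^sup>2) +
        2 * (a (Suc k) * (sq_norm a (Suc k) * (u (Suc k))\<^sup>2))"
      by (simp add: distrib_left power_mult_distrib power2_eq_square mult_ac del: power2_sum)
  qed
  also have "\<dots> = 2 * (\<Sum>k\<le>N. sq_norm a k * (if k = 0 then 0 else u (k - 1))\<^sup>2) +
      2 * (\<Sum>k\<le>N. a (Suc k) * (sq_norm a (Suc k) * (u (Suc k))\<^sup>2))"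
    by (simp only: sum.distrib sum_distrib_left)
  also have "\<dots> \<le> 2 * (C\<^sup>2 / 4 * L (s * s)) + 2 * (C\<^sup>2 / 4 * L (s * s))"
  proof -
    have norm: "(\<Sum>k\<le>N. sq_norm a k * (u k)\<^sup>2) = L (s * s)"
      using coord_mult[of s s N a] by (simp add: N_def u_def power2_eq_square mult.assoc)
    have "(\<Sum>k\<le>N. sq_norm a k * (if k = 0 then 0 else u (k - 1))\<^sup>2) =
        (\<Sum>k<N. a (Suc k) * (sq_norm a k * (u k)\<^sup>2))"
      by (subst sum.atMost_shift) (simp add: mult.assoc)
    also have "\<dots> \<le> C\<^sup>2 / 4 * (\<Sum>k<N. sq_norm a k * (u k)\<^sup>2)"
      unfolding sum_distrib_left by (rule sum_mono) (use le(1) in \<open>simp add: field_simps\<close>)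
    also have "(\<Sum>k<N. sq_norm a k * (u k)\<^sup>2) = L (s * s)"
      unfolding norm[symmetric] by (simp add: lessThan_Suc_atMost[symmetric] u0)
    finally have first: "(\<Sum>k\<le>N. sq_norm a k * (if k = 0 then 0 else u (k - 1))\<^sup>2) \<le> C\<^sup>2 / 4 * L (s * s)" .
    have "(\<Sum>k\<le>N. a (Suc k) * (sq_norm a (Suc k) * (u (Suc k))\<^sup>2)) \<le>
        C\<^sup>2 / 4 * (\<Sum>k\<le>N. sq_norm a (Suc k) * (u (Suc k))\<^sup>2)"
      unfolding sum_distrib_left by (rule sum_mono) (use le(2) in \<open>simp add: field_simps\<close>)
    also have "\<dots> \<le> C\<^sup>2 / 4 * (\<Sum>k\<le>Suc N. sq_norm a k * (u k)\<^sup>2)"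
      by (intro mult_left_mono)
        (simp_all only: sum.atMost_Suc_shift[of _ N] le_add_same_cancel2 zero_le_mult_iff
          zero_le_power2 less_imp_le[OF sq_norm_pos] simp_thms zero_le_divide_iff zero_le_numeral)
    also have "(\<Sum>k\<le>Suc N. sq_norm a k * (u k)\<^sup>2) = L (s * s)"
      unfolding norm[symmetric] by (simp add: u0)
    finally show ?thesis using first by linarith
  qed
  finally show ?thesis by simp
qed

text \<open>This follows from \<open>0 \<le> L((C \<plusminus> t)\<^sup>2 s\<^sup>2)\<close> by estimating the term with \<open>t\<^sup>2\<close> by the one with \<open>C\<^sup>2\<close>.\<close>

lemma L_linear_times_square:
  assumes "\<bar>c\<bar> = 1"
  shows "0 \<le> L ([:C, c:] * (s * s))"
proof -
  have cc: "c * c = 1" using assms by (metis abs_mult_self_eq mult_1)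
  \<comment> \<open>\<open>pCons 0 s\<close> is the variable times \<open>s\<close>, so the square below is \<open>(C + c t)\<^sup>2 s\<^sup>2\<close>.\<close>
  have "0 \<le> L ((smult C s + smult c (pCons 0 s)) * (smult C s + smult c (pCons 0 s)))"
    by (rule L_square_nonneg)
  also have "(smult C s + smult c (pCons 0 s)) * (smult C s + smult c (pCons 0 s)) =
      smult (C\<^sup>2) (s * s) + smult (2 * C * c) (pCons 0 (s * s)) + smult (c * c) (pCons 0 s * pCons 0 s)"
    by (subst poly_eq_poly_eq_iff[symmetric], rule ext) (simp add: algebra_simps power2_eq_square)
  also have "L \<dots> = C\<^sup>2 * L (s * s) + 2 * C * c * L (pCons 0 (s * s)) + L (pCons 0 s * pCons 0 s)"
    by (simp only: coord_add coord_smult cc mult_1)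
  also have "\<dots> \<le> C\<^sup>2 * L (s * s) + 2 * C * c * L (pCons 0 (s * s)) + C\<^sup>2 * L (s * s)"
    using L_x_square_le[of s] by simp
  also have "\<dots> = 2 * C * (C * L (s * s) + c * L (pCons 0 (s * s)))"
    by (simp add: algebra_simps power2_eq_square)
  also have "C * L (s * s) + c * L (pCons 0 (s * s)) = L ([:C, c:] * (s * s))"
    by (simp add: coord_add coord_smult flip: coord_smult)
  finally show ?thesis using C_pos by (simp add: zero_le_mult_iff)
qed

lemma L_quadratic_times_square: "0 \<le> L ([:C, 1:] * [:C, - 1:] * (s * s))"
proof -
  have "[:C, 1:] * [:C, - 1:] * (s * s) = smult (C\<^sup>2) (s * s) - pCons 0 s * pCons 0 s"
    by (simp add: algebra_simps power2_eq_square)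
  then show ?thesis using L_x_square_le[of s] by (simp add: coord_diff coord_smult)
qed

lemma L_even_moment_le: "L ([:0, 1:] ^ (2 * n)) \<le> C ^ (2 * n)"
proof (induction n)
  case 0
  show ?case by (simp add: coord_one)
next
  case (Suc n)
  have pow: "[:0, 1:] ^ (2 * m) = ([:0, 1:] ^ m * [:0, 1:] ^ m :: real poly)" for m
    by (simp add: mult_2 power_add)
  have "[:0, 1:] ^ Suc n = pCons 0 ([:0, 1:] ^ n :: real poly)" by simp
  then have "L ([:0, 1:] ^ (2 * Suc n)) \<le> C\<^sup>2 * L ([:0, 1:] ^ (2 * n))"
    unfolding pow using L_x_square_le[of "[:0, 1:] ^ n"] by simp
  also have "\<dots> \<le> C\<^sup>2 * C ^ (2 * n)" using Suc by (simp add: mult_left_mono)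
  finally show ?case by (simp add: power_add power2_eq_square mult.assoc)
qed

text \<open>The even parts of the exponents form a square, which leaves one of the factors \<open>1\<close>, \<open>C + t\<close>, \<open>C - t\<close> and \<open>C\<^sup>2 - t\<^sup>2\<close>.\<close>

lemma L_bernstein_nonneg: "0 \<le> L ([:C, 1:] ^ k * [:C, - 1:] ^ l)"
proof -
  define s where "s = [:C, 1:] ^ (k div 2) * [:C, - 1:] ^ (l div 2)"
  have half: "p ^ k = p ^ (k mod 2) * (p ^ (k div 2) * p ^ (k div 2))" for p :: "real poly" and k
    by (metis mult_2 power_add mod_mult_div_eq mult.commute)
  have eq: "[:C, 1:] ^ k * [:C, - 1:] ^ l = [:C, 1:] ^ (k mod 2) * [:C, - 1:] ^ (l mod 2) * (s * s)"
    unfolding s_def by (subst half[of _ k], subst half[of _ l]) (simp only: mult_ac)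
  have "k mod 2 = 0 \<or> k mod 2 = 1" "l mod 2 = 0 \<or> l mod 2 = 1" by auto
  then show ?thesis
    unfolding eq
    using L_square_nonneg[of s] L_linear_times_square[of 1 s] L_linear_times_square[of "-1" s]
      L_quadratic_times_square[of s]
    by (elim disjE) (simp_all only: power_0 power_one_right mult_1 mult_1_right abs_one abs_minus_cancel simp_thms)
qed

end


section \<open>The Hausdorff moment problem and moment determinacy\<close>

text \<open>The ratio is the product of the \<open>(k - i) / (N - i)\<close> for \<open>i < j\<close>, each of which is close to \<open>k / N\<close> uniformly in \<open>k\<close>.\<close>

lemma choose_ratio_diff_le:
  assumes "k \<le> N" "2 * j \<le> N" "0 < N"
  shows "\<bar>real (k choose j) / real (N choose j) - (real k / real N) ^ j\<bar> \<le> real j * (real j / (real N - real j))"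
proof (cases "j = 0")
  case False
  have Nj: "real N - real j > 0" using assms False by linarith
  have prod: "real (m choose j) = (\<Prod>i\<in>{0..<j}. real m - real i) / fact j" for m
    using gbinomial_prod_rev[of "real m" j] by (simp add: binomial_gbinomial)
  have "real (k choose j) / real (N choose j) = (\<Prod>i\<in>{0..<j}. (real k - real i) / (real N - real i))"
    unfolding prod by (simp add: prod_dividef)
  moreover have "(real k / real N) ^ j = (\<Prod>i\<in>{0..<j}. real k / real N)" by simp
  ultimately have "\<bar>real (k choose j) / real (N choose j) - (real k / real N) ^ j\<bar> =
      norm ((\<Prod>i\<in>{0..<j}. (real k - real i) / (real N - real i)) - (\<Prod>i\<in>{0..<j}. real k / real N))"
    by simp
  also have "\<dots> \<le> (\<Sum>i\<in>{0..<j}. norm ((real k - real i) / (real N - real i) - real k / real N))"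
  proof (rule norm_prod_diff)
    fix i assume "i \<in> {0..<j}"
    then have "real i < real j" by simp
    moreover have "2 * real j \<le> real N" using assms(2) by linarith
    ultimately have "\<bar>real k - real i\<bar> \<le> real N - real i" "0 < real N - real i"
      using assms(1) by linarith+
    then show "norm ((real k - real i) / (real N - real i)) \<le> 1" by simp
    show "norm (real k / real N) \<le> 1" using assms by simp
  qed
  also have "\<dots> \<le> (\<Sum>i\<in>{0..<j}. real j / (real N - real j))"
  proof (rule sum_mono)
    fix i assume "i \<in> {0..<j}"
    then have i: "real i < real j" by simp
    have Ni: "0 < real N - real i" using i Nj by linarith
    have "(real k - real i) / (real N - real i) - real k / real N =
        - (real i / (real N - real i) * ((real N - real k) / real N))"
      using Ni assms(3) by (simp add: divide_simps) (simp add: algebra_simps)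
    then have "norm ((real k - real i) / (real N - real i) - real k / real N) =
        real i / (real N - real i) * ((real N - real k) / real N)"
      using Ni assms(1) by (simp add: abs_mult)
    also have "\<dots> \<le> real i / (real N - real i) * 1"
      using Ni assms by (intro mult_left_mono) auto
    also have "\<dots> \<le> real j / (real N - real j)"
      using i Nj by (simp add: frac_le)
    finally show "norm ((real k - real i) / (real N - real i) - real k / real N) \<le> real j / (real N - real j)" .
  qed
  also have "\<dots> = real j * (real j / (real N - real j))" by simp
  finally show ?thesis .
qed simp

text \<open>A moment functional on \<open>[0, 1]\<close>: the last condition is Hausdorff's complete monotonicity of the moment sequence.\<close>

locale unit_interval_functional =
  fixes \<Lambda> :: "real poly \<Rightarrow> real"
  assumes add: "\<Lambda> (p + r) = \<Lambda> p + \<Lambda> r" and smult: "\<Lambda> (smult c p) = c * \<Lambda> p"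
    and one: "\<Lambda> 1 = 1" and nonneg: "0 \<le> \<Lambda> ([:0, 1:] ^ k * [:1, - 1:] ^ l)"
begin

lemma zero: "\<Lambda> 0 = 0"
  using smult[of 0 0] by simp

lemma sum: "\<Lambda> (\<Sum>i\<in>A. f i) = (\<Sum>i\<in>A. \<Lambda> (f i))"
  by (induction A rule: infinite_finite_induct) (simp_all add: zero add)

text \<open>The value of the functional at the \<open>k\<close>-th Bernstein polynomial of degree \<open>N\<close>.\<close>

definition weight :: "nat \<Rightarrow> nat \<Rightarrow> real"
  where "weight N k = real (N choose k) * \<Lambda> ([:0, 1:] ^ k * [:1, - 1:] ^ (N - k))"

lemma weight_nonneg: "0 \<le> weight N k"
  by (simp add: weight_def nonneg)

text \<open>Up to normalisation the Bernstein weights have the same factorial moments as the functional itself,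
by the binomial theorem for \<open>t + (1 - t) = 1\<close>. This makes the limit of the ordinary moments accessible.\<close>

lemma sum_weight_choose:
  assumes "j \<le> N"
  shows "(\<Sum>k\<le>N. weight N k * (real (k choose j) / real (N choose j))) = \<Lambda> ([:0, 1:] ^ j)"
proof -
  define b :: "nat \<Rightarrow> real poly" where "b k = [:0, 1:] ^ k * [:1, - 1:] ^ (N - k)" for k :: nat
  have pos: "real (N choose j) > 0" using assms by simp
  have one: "[:0, 1:] + [:1, - 1:] = (1 :: real poly)" by (simp add: one_pCons)
  have "(\<Sum>k\<le>N. weight N k * (real (k choose j) / real (N choose j))) =
      (\<Sum>k\<in>{j..N}. weight N k * (real (k choose j) / real (N choose j)))"
    by (rule sum.mono_neutral_right) (auto simp: binomial_eq_0)
  also have "\<dots> = (\<Sum>k\<in>{j..N}. real (N - j choose (k - j)) * \<Lambda> (b k))"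
  proof (rule sum.cong[OF refl])
    fix k assume "k \<in> {j..N}"
    then have "(N choose k) * (k choose j) = (N choose j) * ((N - j) choose (k - j))"
      by (intro choose_mult) auto
    then have "real (N choose k) * real (k choose j) = real (N choose j) * real ((N - j) choose (k - j))"
      by (metis of_nat_mult)
    then show "weight N k * (real (k choose j) / real (N choose j)) = real (N - j choose (k - j)) * \<Lambda> (b k)"
      using pos by (simp add: weight_def b_def field_simps)
  qed
  also have "\<dots> = (\<Sum>i\<le>N - j. real (N - j choose i) * \<Lambda> (b (i + j)))"
    using assms by (intro sum.reindex_bij_witness[of _ "\<lambda>i. i + j" "\<lambda>k. k - j"]) auto
  also have "\<dots> = \<Lambda> (\<Sum>i\<le>N - j. smult (real (N - j choose i)) (b (i + j)))"
    by (simp add: sum smult)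
  also have "(\<Sum>i\<le>N - j. smult (real (N - j choose i)) (b (i + j))) =
      [:0, 1:] ^ j * (\<Sum>i\<le>N - j. of_nat (N - j choose i) * [:0, 1:] ^ i * [:1, - 1:] ^ (N - j - i))"
    unfolding sum_distrib_left
    by (intro sum.cong) (auto simp: b_def power_add of_nat_poly mult_ac add.commute)
  also have "\<dots> = [:0, 1:] ^ j"
    unfolding binomial_ring[symmetric] one by simp
  finally show ?thesis .
qed

lemma sum_weight: "(\<Sum>k\<le>N. weight N k) = 1"
  using sum_weight_choose[of 0 N] by (simp add: one)

definition atoms :: "nat \<Rightarrow> nat pmf"
  where "atoms N = embed_pmf (\<lambda>k. if k \<le> N then weight N k else 0)"

lemma pmf_atoms: "pmf (atoms N) k = (if k \<le> N then weight N k else 0)"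
  unfolding atoms_def
proof (rule pmf_embed_pmf)
  show "0 \<le> (if k \<le> N then weight N k else 0)" for k by (simp add: weight_nonneg)
  have "(\<integral>\<^sup>+ k. ennreal (if k \<le> N then weight N k else 0) \<partial>count_space UNIV) =
      (\<Sum>k\<le>N. ennreal (weight N k))"
    by (subst nn_integral_count_space'[of "{..N}"]) auto
  also have "\<dots> = 1" by (simp add: sum_ennreal weight_nonneg sum_weight)
  finally show "(\<integral>\<^sup>+ k. ennreal (if k \<le> N then weight N k else 0) \<partial>count_space UNIV) = 1" .
qed

text \<open>The degree is \<open>n + 1\<close>, so that the atoms \<open>k / (n + 1)\<close> are defined for every \<open>n\<close>.\<close>

definition bernstein_measure :: "nat \<Rightarrow> real measure"
  where "bernstein_measure n = distr (atoms (Suc n)) borel (\<lambda>k. real k / real (Suc n))"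

lemma real_distribution_bernstein: "real_distribution (bernstein_measure n)"
  unfolding bernstein_measure_def
  by (intro prob_space.real_distribution_distr) (auto simp: measure_pmf.prob_space_axioms)

lemma integral_bernstein:
  assumes "f \<in> borel_measurable borel"
  shows "integral\<^sup>L (bernstein_measure n) f = (\<Sum>k\<le>Suc n. weight (Suc n) k * f (real k / real (Suc n)))"
proof -
  have "integral\<^sup>L (bernstein_measure n) f = (\<integral>k. f (real k / real (Suc n)) \<partial>atoms (Suc n))"
    unfolding bernstein_measure_def using assms by (subst integral_distr) auto
  also have "\<dots> = (\<Sum>k\<in>{..Suc n}. pmf (atoms (Suc n)) k *\<^sub>R f (real k / real (Suc n)))"
    by (rule integral_measure_pmf) (auto simp: set_pmf_iff pmf_atoms split: if_splits)
  finally show ?thesis by (simp add: pmf_atoms del: sum.atMost_Suc)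
qed

text \<open>Weak convergence only controls integrals of bounded functions; on \<open>[0, 1]\<close>, where all the Bernstein measures
live, powers may be replaced by powers of the clamped variable.\<close>

definition clamp01 :: "real \<Rightarrow> real"
  where "clamp01 t = max 0 (min 1 t)"

lemma clamp01_bounds: "0 \<le> clamp01 t" "clamp01 t \<le> 1" "0 \<le> t \<Longrightarrow> t \<le> 1 \<Longrightarrow> clamp01 t = t"
  by (auto simp: clamp01_def)

lemma continuous_clamp01: "continuous_on UNIV clamp01"
  unfolding clamp01_def[abs_def] by (intro continuous_intros)

lemma measurable_clamp01 [measurable]: "clamp01 \<in> borel_measurable borel"
  by (rule borel_measurable_continuous_onI[OF continuous_clamp01])

lemma moment_bernstein_tendsto:
  "(\<lambda>n. integral\<^sup>L (bernstein_measure n) (\<lambda>t. clamp01 t ^ j)) \<longlonglongrightarrow> \<Lambda> ([:0, 1:] ^ j)"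
proof -
  have bound: "\<bar>integral\<^sup>L (bernstein_measure n) (\<lambda>t. clamp01 t ^ j) - \<Lambda> ([:0, 1:] ^ j)\<bar>
      \<le> real j * (real j / (real (Suc n) - real j))" if n: "2 * j \<le> Suc n" for n
  proof -
    let ?N = "Suc n"
    have "integral\<^sup>L (bernstein_measure n) (\<lambda>t. clamp01 t ^ j) = (\<Sum>k\<le>?N. weight ?N k * (real k / real ?N) ^ j)"
      by (subst integral_bernstein) (auto intro!: sum.cong simp: clamp01_bounds(3) simp del: sum.atMost_Suc)
    then have "\<bar>integral\<^sup>L (bernstein_measure n) (\<lambda>t. clamp01 t ^ j) - \<Lambda> ([:0, 1:] ^ j)\<bar> =
        \<bar>\<Sum>k\<le>?N. weight ?N k * (real (k choose j) / real (?N choose j) - (real k / real ?N) ^ j)\<bar>"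
      using sum_weight_choose[of j ?N] n
      by (simp add: right_diff_distrib sum_subtractf abs_minus_commute del: sum.atMost_Suc binomial_Suc_Suc)
    also have "\<dots> \<le> (\<Sum>k\<le>?N. weight ?N k * (real j * (real j / (real ?N - real j))))"
      by (rule order_trans[OF sum_abs])
        (intro sum_mono, simp only: abs_mult abs_of_nonneg[OF weight_nonneg],
          intro mult_left_mono choose_ratio_diff_le weight_nonneg, use n in auto)
    also have "\<dots> = real j * (real j / (real ?N - real j))"
      by (simp only: sum_distrib_right[symmetric] sum_weight mult_1)
    finally show ?thesis .
  qed
  have "(\<lambda>n. real j * (real j / (real (Suc n) - real j))) \<longlonglongrightarrow> 0" by real_asymp
  then have "(\<lambda>n. integral\<^sup>L (bernstein_measure n) (\<lambda>t. clamp01 t ^ j) - \<Lambda> ([:0, 1:] ^ j)) \<longlonglongrightarrow> 0"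
    by (rule Lim_null_comparison[rotated]) (use bound in \<open>auto simp: eventually_at_top_linorder intro!: exI[of _ "2 * j"]\<close>)
  then show ?thesis by (rule LIM_zero_cancel)
qed

lemma tight_bernstein: "tight bernstein_measure"
  unfolding tight_def
proof (intro conjI allI impI)
  fix \<epsilon> :: real assume "0 < \<epsilon>"
  \<comment> \<open>The half-open interval has to contain the atom at zero, hence an endpoint below zero.\<close>
  have "measure (bernstein_measure n) {-1<..1} = 1" for n
  proof -
    interpret real_distribution "bernstein_measure n" by (rule real_distribution_bernstein)
    have "measure (bernstein_measure n) {-1<..1} = integral\<^sup>L (bernstein_measure n) (indicator {-1<..1})"
      by simp
    also have "\<dots> = (\<Sum>k\<le>Suc n. weight (Suc n) k)"
      by (subst integral_bernstein) (auto intro!: sum.cong simp: indicator_def field_simps simp del: sum.atMost_Suc)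
    finally show ?thesis by (simp only: sum_weight)
  qed
  then show "\<exists>a b. a < b \<and> (\<forall>n. 1 - \<epsilon> < measure (bernstein_measure n) {a<..b})"
    using \<open>0 < \<epsilon>\<close> by (intro exI[of _ "-1"] exI[of _ 1]) auto
qed (rule real_distribution_bernstein)

text \<open>Helly's theorem gives a weak limit of a subsequence of the Bernstein measures. Its image under \<open>clamp01\<close> lives on
\<open>[0, 1]\<close> by construction, and its moments are integrals of bounded continuous functions against the limit.\<close>

theorem hausdorff_moment_problem:
  "\<exists>M. real_distribution M \<and> (AE t in M. 0 \<le> t \<and> t \<le> 1) \<and> (\<forall>n. (\<integral>t. t ^ n \<partial>M) = \<Lambda> ([:0, 1:] ^ n))"
proof -
  obtain r M where r: "strict_mono (r :: nat \<Rightarrow> nat)" and M: "real_distribution M"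
    and conv: "weak_conv_m (bernstein_measure \<circ> id \<circ> r) M"
    using tight_imp_convergent_subsubsequence[OF tight_bernstein strict_mono_id] by blast
  interpret M: real_distribution M by (rule M)
  have lim: "(\<integral>t. clamp01 t ^ j \<partial>M) = \<Lambda> ([:0, 1:] ^ j)" for j
  proof (rule LIMSEQ_unique)
    show "(\<lambda>n. integral\<^sup>L ((bernstein_measure \<circ> id \<circ> r) n) (\<lambda>t. clamp01 t ^ j)) \<longlonglongrightarrow> (\<integral>t. clamp01 t ^ j \<partial>M)"
    proof (rule weak_conv_imp_integral_bdd_continuous_conv[where B = 1])
      show "real_distribution ((bernstein_measure \<circ> id \<circ> r) n)" for n
        by (simp add: real_distribution_bernstein)
      show "isCont (\<lambda>t. clamp01 t ^ j) t" for t
        using continuous_clamp01 by (intro continuous_intros) (simp add: continuous_on_eq_continuous_at)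
      show "norm (clamp01 t ^ j) \<le> 1" for t
        using clamp01_bounds[of t] by (simp add: power_le_one)
    qed (fact M conv)+
    show "(\<lambda>n. integral\<^sup>L ((bernstein_measure \<circ> id \<circ> r) n) (\<lambda>t. clamp01 t ^ j)) \<longlonglongrightarrow> \<Lambda> ([:0, 1:] ^ j)"
      using LIMSEQ_subseq_LIMSEQ[OF moment_bernstein_tendsto r] by (simp add: o_def)
  qed
  have "real_distribution (distr M borel clamp01)" by (intro M.real_distribution_distr) simp
  moreover have "AE t in distr M borel clamp01. 0 \<le> t \<and> t \<le> 1"
    by (subst AE_distr_iff) (auto simp: clamp01_bounds)
  moreover have "(\<integral>t. t ^ n \<partial>distr M borel clamp01) = \<Lambda> ([:0, 1:] ^ n)" for n
    by (subst integral_distr) (auto simp: lim)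
  ultimately show ?thesis by blast
qed

end

text \<open>Moments of at most geometric growth determine the distribution: the Taylor expansion of the characteristic
function converges, its error being controlled by even moments and factorials.\<close>

lemma moment_determinate:
  assumes M: "real_distribution M" and M': "real_distribution M'"
    and int: "\<And>n. integrable M (\<lambda>t. t ^ n)" "\<And>n. integrable M' (\<lambda>t. t ^ n)"
    and eq: "\<And>n. (\<integral>t. t ^ n \<partial>M) = (\<integral>t. t ^ n \<partial>M')"
    and bound: "\<And>n. (\<integral>t. t ^ (2 * n) \<partial>M) \<le> K ^ (2 * n)"
  shows "M = M'"
proof (rule Levy_uniqueness[OF M M'])
  show "char M = char M'"
  proof
    fix t
    \<comment> \<open>Both characteristic functions have the same Taylor polynomials, since the moments agree.\<close>
    define S where "S n = (\<Sum>k\<le>n. (\<i> * complex_of_real t) ^ k / fact k * complex_of_real (\<integral>x. x ^ k \<partial>M))" for n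
    have le: "cmod (char M t - char M' t) \<le> 4 * ((\<bar>t\<bar> * K) ^ (2 * n) / fact (2 * n))" for n
    proof -
      have even: "(\<integral>x. \<bar>x\<bar> ^ (2 * n) \<partial>N) = (\<integral>x. x ^ (2 * n) \<partial>N)" for N :: "real measure"
        by (simp add: power_even_abs)
      have "cmod (char M t - S (2 * n)) \<le> 2 * \<bar>t\<bar> ^ (2 * n) / fact (2 * n) * (\<integral>x. x ^ (2 * n) \<partial>M)"
        using real_distribution.char_approx1[OF M, of "2 * n" t] int(1) unfolding S_def even by simp
      moreover have "cmod (char M' t - S (2 * n)) \<le> 2 * \<bar>t\<bar> ^ (2 * n) / fact (2 * n) * (\<integral>x. x ^ (2 * n) \<partial>M)"
        using real_distribution.char_approx1[OF M', of "2 * n" t] int(2) unfolding S_def even eq by simp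
      moreover have "2 * \<bar>t\<bar> ^ (2 * n) / fact (2 * n) * (\<integral>x. x ^ (2 * n) \<partial>M) \<le>
          2 * \<bar>t\<bar> ^ (2 * n) / fact (2 * n) * K ^ (2 * n)"
        by (intro mult_left_mono bound) simp
      moreover have "cmod (char M t - char M' t) \<le> cmod (char M t - S (2 * n)) + cmod (char M' t - S (2 * n))"
        using norm_triangle_ineq4[of "char M t - S (2 * n)" "char M' t - S (2 * n)"] by simp
      ultimately show ?thesis by (simp add: power_mult_distrib)
    qed
    have "(\<lambda>n. (\<bar>t\<bar> * K) ^ n / fact n) \<longlonglongrightarrow> 0"
      using summable_LIMSEQ_zero[OF summable_exp[of "\<bar>t\<bar> * K"]] by (simp add: field_simps)
    then have "(\<lambda>n. (\<bar>t\<bar> * K) ^ (2 * n) / fact (2 * n)) \<longlonglongrightarrow> 0"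
      by (rule LIMSEQ_subseq_LIMSEQ[unfolded o_def]) (simp add: strict_mono_def)
    then have "(\<lambda>n. 4 * ((\<bar>t\<bar> * K) ^ (2 * n) / fact (2 * n))) \<longlonglongrightarrow> 4 * 0"
      by (intro tendsto_intros)
    then have "cmod (char M t - char M' t) \<le> 0"
      using le by (intro LIMSEQ_le_const) auto
    then show "char M t = char M' t" by simp
  qed
qed


section \<open>Favard measures and the distribution of the Gaussian operator\<close>

lemma integrable_poly:
  assumes "\<And>n. integrable M (\<lambda>t::real. t ^ n)"
  shows "integrable M (\<lambda>t. poly p t)"
  unfolding poly_altdef by (intro Bochner_Integration.integrable_sum integrable_mult_right assms)

lemma integral_poly_eq_coord:
  assumes "\<And>n. integrable M (\<lambda>t::real. t ^ n)" "\<And>n. (\<integral>t. t ^ n \<partial>M) = path_weight a n 0"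
  shows "(\<integral>t. poly p t \<partial>M) = coord a 0 p"
  unfolding poly_altdef coord_def using assms by simp

lemma coord_power: "coord a 0 ([:0, 1:] ^ n) = path_weight a n 0"
proof -
  have "[:0, 1:] ^ n = monom (1::real) n" by (simp add: monom_altdef)
  moreover have "coord a 0 (monom 1 n) = (\<Sum>k\<le>n. if k = n then path_weight a n 0 else 0)"
    unfolding coord_def by (intro sum.cong) (auto simp: degree_monom_eq)
  ultimately show ?thesis by simp
qed

context bounded_jacobi
begin

text \<open>Hausdorff's theorem on \<open>[0, 1]\<close>, transported to \<open>[- C, C]\<close> by the affine map \<open>t = 2 C s - C\<close>.\<close>

lemma exists_measure_with_path_moments:
  "\<exists>\<mu>. real_distribution \<mu> \<and> (\<forall>n. integrable \<mu> (\<lambda>t. t ^ n)) \<and> (\<forall>n. (\<integral>t. t ^ n \<partial>\<mu>) = path_weight a n 0)"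
proof -
  \<comment> \<open>The map \<open>s = (t + C) / (2 C)\<close> from \<open>[- C, C]\<close> onto \<open>[0, 1]\<close>, whose inverse is \<open>?\<psi>\<close> below.\<close>
  let ?\<phi> = "[:1 / 2, 1 / (2 * C):]"
  have \<phi>: "[:0, 1:] \<circ>\<^sub>p ?\<phi> = smult (1 / (2 * C)) [:C, 1:]" "[:1, - 1:] \<circ>\<^sub>p ?\<phi> = smult (1 / (2 * C)) [:C, - 1:]"
    using C_pos by (simp_all add: pcompose_pCons)
  have pow: "(p ^ k) \<circ>\<^sub>p r = (p \<circ>\<^sub>p r) ^ k" for p r :: "real poly" and k
    by (induction k) (simp_all add: pcompose_mult pcompose_1)
  interpret unit_interval_functional "\<lambda>p. coord a 0 (p \<circ>\<^sub>p ?\<phi>)"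
  proof
    show "0 \<le> coord a 0 (([:0, 1:] ^ k * [:1, - 1:] ^ l) \<circ>\<^sub>p ?\<phi>)" for k l
    proof -
      have "([:0, 1:] ^ k * [:1, - 1:] ^ l) \<circ>\<^sub>p ?\<phi> =
          smult ((1 / (2 * C)) ^ l * (1 / (2 * C)) ^ k) ([:C, 1:] ^ k * [:C, - 1:] ^ l)"
        unfolding pcompose_mult pow \<phi>
        by (simp only: smult_power mult_smult_left mult_smult_right smult_smult)
      then show ?thesis using L_bernstein_nonneg[of k l] C_pos by (simp add: coord_smult)
    qed
  qed (simp_all add: pcompose_add pcompose_smult coord_add coord_smult coord_one pcompose_1)
  obtain M where M: "real_distribution M" "AE t in M. 0 \<le> t \<and> t \<le> 1"
    and mom: "\<And>n. (\<integral>t. t ^ n \<partial>M) = coord a 0 (([:0, 1:] ^ n) \<circ>\<^sub>p ?\<phi>)"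
    using hausdorff_moment_problem by blast
  interpret M: real_distribution M by (rule M(1))
  have int: "integrable M (\<lambda>t. t ^ n)" for n
    by (rule M.integrable_const_bound[where B = 1]) (use M(2) in \<open>auto simp: power_le_one\<close>)
  have poly_M: "(\<integral>t. poly p t \<partial>M) = coord a 0 (p \<circ>\<^sub>p ?\<phi>)" for p
  proof -
    have "(\<integral>t. poly p t \<partial>M) = (\<Sum>i\<le>degree p. coord a 0 (smult (coeff p i) ([:0, 1:] ^ i) \<circ>\<^sub>p ?\<phi>))"
      unfolding poly_altdef using int by (simp add: mom pcompose_smult coord_smult)
    also have "\<dots> = coord a 0 ((\<Sum>i\<le>degree p. smult (coeff p i) ([:0, 1:] ^ i)) \<circ>\<^sub>p ?\<phi>)"
      by (simp only: sum)
    also have "(\<Sum>i\<le>degree p. smult (coeff p i) ([:0, 1:] ^ i)) = p"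
      by (simp add: poly_as_sum_of_monoms flip: monom_altdef)
    finally show ?thesis .
  qed
  let ?\<psi> = "[:- C, 2 * C:]"
  let ?\<mu> = "distr M borel (\<lambda>t. poly ?\<psi> t)"
  have meas: "(\<lambda>t. poly ?\<psi> t) \<in> borel_measurable M" by simp
  have "real_distribution ?\<mu>" by (intro M.real_distribution_distr meas)
  moreover have "integrable ?\<mu> (\<lambda>t. t ^ n)" for n
    using integrable_poly[OF int, of "?\<psi> ^ n"]
    by (subst integrable_distr_eq[OF meas]) (simp_all add: poly_power)
  moreover have "(\<integral>t. t ^ n \<partial>?\<mu>) = path_weight a n 0" for n
  proof -
    have "(\<integral>t. t ^ n \<partial>?\<mu>) = (\<integral>t. (poly ?\<psi> t) ^ n \<partial>M)"
      by (rule integral_distr[OF meas]) simp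
    also have "\<dots> = (\<integral>t. poly (?\<psi> ^ n) t \<partial>M)"
      by (rule Bochner_Integration.integral_cong[OF refl]) (simp only: poly_power)
    also have "\<dots> = coord a 0 ((?\<psi> \<circ>\<^sub>p ?\<phi>) ^ n)" by (simp only: poly_M pow)
    also have "?\<psi> \<circ>\<^sub>p ?\<phi> = [:0, 1:]" using C_pos by (simp add: pcompose_pCons)
    finally show ?thesis by (simp only: coord_power)
  qed
  ultimately show ?thesis by blast
qed

text \<open>Orthogonality to \<open>P\<^sub>0 = 1\<close> says that every other \<open>P\<^sub>k\<close> has integral zero, which fixes all moments through the expansion of
\<open>t\<^sup>n\<close>. Conversely, integration is then the functional \<open>L\<close>, for which the \<open>P\<^sub>k\<close> are orthogonal.\<close>

lemma monic_orthogonal_iff_path_moments: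
  assumes "prob_space \<mu>" and int: "\<And>n. integrable \<mu> (\<lambda>t. t ^ n)"
  shows "monic_orthogonal_polynomials \<mu> (jacobi_poly a) \<longleftrightarrow> (\<forall>n. (\<integral>t. t ^ n \<partial>\<mu>) = path_weight a n 0)"
proof
  interpret prob_space \<mu> by (rule assms)
  assume orth: "monic_orthogonal_polynomials \<mu> (jacobi_poly a)"
  have P: "(\<integral>t. poly (jacobi_poly a k) t \<partial>\<mu>) = (if k = 0 then 1 else 0)" for k
  proof (cases "k = 0")
    case True
    then show ?thesis by (simp add: prob_space)
  next
    case False
    then have "(\<integral>t. poly (jacobi_poly a k) t * poly (jacobi_poly a 0) t \<partial>\<mu>) = 0"
      using orth unfolding monic_orthogonal_polynomials_def by blast
    then show ?thesis using False by simp
  qed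
  show "\<forall>n. (\<integral>t. t ^ n \<partial>\<mu>) = path_weight a n 0"
  proof
    fix n
    have "(\<integral>t. t ^ n \<partial>\<mu>) = (\<Sum>k\<le>n. path_weight a n k * (\<integral>t. poly (jacobi_poly a k) t \<partial>\<mu>))"
      unfolding power_eq_sum_jacobi_poly[of _ n a] using integrable_poly[OF int] by simp
    also have "\<dots> = (\<Sum>k\<in>{..n}. if k = 0 then path_weight a n 0 else 0)"
      unfolding P by (intro sum.cong) auto
    finally show "(\<integral>t. t ^ n \<partial>\<mu>) = path_weight a n 0" by simp
  qed
next
  assume "\<forall>n. (\<integral>t. t ^ n \<partial>\<mu>) = path_weight a n 0"
  then have "(\<integral>t. poly (p * r) t \<partial>\<mu>) = coord a 0 (p * r)" for p r
    by (intro integral_poly_eq_coord int) auto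
  then have "(\<integral>t. poly (jacobi_poly a m) t * poly (jacobi_poly a n) t \<partial>\<mu>) = (if m = n then sq_norm a n else 0)" for m n
    using L_jacobi_mult[of m n] by simp
  then show "monic_orthogonal_polynomials \<mu> (jacobi_poly a)"
    using int sq_norm_pos
    by (simp add: degree_jacobi_poly lead_coeff_jacobi_poly monic_orthogonal_polynomials_def power2_eq_square)
qed

text \<open>Favard's theorem for bounded Jacobi parameters with vanishing diagonal. By the previous lemma it is a
statement about a moment sequence, whose even entries grow at most like \<open>C\<^bsup>2n\<^esup>\<close>.\<close>

theorem favard:
  "\<exists>!\<mu>. prob_space \<mu> \<and> sets \<mu> = sets borel \<and> monic_orthogonal_polynomials \<mu> (jacobi_poly a)"
proof -
  let ?P = "\<lambda>\<mu>. prob_space \<mu> \<and> sets \<mu> = sets borel \<and> monic_orthogonal_polynomials \<mu> (jacobi_poly a)"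
  have P: "real_distribution \<mu> \<and> (\<forall>n. integrable \<mu> (\<lambda>t. t ^ n)) \<and> (\<forall>n. (\<integral>t. t ^ n \<partial>\<mu>) = path_weight a n 0)"
    if "?P \<mu>" for \<mu>
  proof -
    have "integrable \<mu> (\<lambda>t. t ^ n)" for n
      using that by (simp add: monic_orthogonal_polynomials_def)
    then show ?thesis
      using that monic_orthogonal_iff_path_moments[of \<mu>]
      by (simp add: real_distribution_def real_distribution_axioms_def)
  qed
  show ?thesis
  proof (rule ex_ex1I)
    obtain \<mu> where \<mu>: "real_distribution \<mu>" "\<And>n. integrable \<mu> (\<lambda>t. t ^ n)"
      "\<And>n. (\<integral>t. t ^ n \<partial>\<mu>) = path_weight a n 0"
      using exists_measure_with_path_moments by blast
    then show "\<exists>\<mu>. ?P \<mu>"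
      using monic_orthogonal_iff_path_moments[of \<mu>]
      by (auto simp: real_distribution_def real_distribution_axioms_def)
  next
    fix \<mu> \<nu> assume "?P \<mu>" "?P \<nu>"
    note \<mu> = P[OF \<open>?P \<mu>\<close>] and \<nu> = P[OF \<open>?P \<nu>\<close>]
    show "\<mu> = \<nu>"
    proof (rule moment_determinate)
      show "(\<integral>t. t ^ (2 * n) \<partial>\<mu>) \<le> C ^ (2 * n)" for n
        using L_even_moment_le[of n] \<mu> by (simp add: coord_power)
    qed (use \<mu> \<nu> in auto)
  qed
qed

end

lemma orth_poly_eq_jacobi_poly: "orth_poly q n = jacobi_poly (jacobi_q q) n"
proof (induction q n rule: orth_poly.induct)
  case (3 q)
  show ?case by (simp add: jacobi_q_def power2_eq_square one_pCons)
next
  case (4 q n)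
  then show ?case by (simp add: jacobi_q_def)
qed simp_all

text \<open>For \<open>n \<ge> 2\<close> the \<open>n\<close>-th parameter is at most \<open>2 / (1 - \<bar>q\<bar>)\<close>; the summand \<open>1\<close> accounts for the first one.\<close>

lemma bounded_jacobi_q:
  assumes "\<bar>q\<bar> < 1"
  shows "bounded_jacobi (jacobi_q q) (sqrt (4 * (1 + 2 / (1 - \<bar>q\<bar>))))"
proof
  fix n
  have geo: "q_number q m = (1 - q ^ m) / (1 - q)" for m
    using assms by (auto simp: q_number_def sum_gp_strict)
  have small: "\<bar>q ^ m\<bar> < 1" if "m \<noteq> 0" for m
    using assms that by (simp add: power_abs power_less_one_iff)
  have qn: "0 < q_number q (Suc n)"
    unfolding geo using small[of "Suc n"] assms by (intro divide_pos_pos) auto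
  show pos: "0 < jacobi_q q (Suc n)"
    using qn small[of n] by (cases "n = 0") (auto simp: jacobi_q_def intro!: mult_pos_pos)
  have "q_number q (Suc n) \<le> (\<Sum>k<Suc n. \<bar>q\<bar> ^ k)"
    unfolding q_number_def by (intro sum_mono) (metis abs_ge_self power_abs)
  also have "\<dots> = (1 - \<bar>q\<bar> ^ Suc n) / (1 - \<bar>q\<bar>)" unfolding sum_gp_strict using assms by auto
  also have "\<dots> \<le> 1 / (1 - \<bar>q\<bar>)" using assms by (intro divide_right_mono) auto
  finally have "q_number q (Suc n) \<le> 1 / (1 - \<bar>q\<bar>)" .
  moreover have "1 + q ^ n \<le> 2" "0 \<le> 1 + q ^ n"
    using small[of n] by (cases "n = 0"; simp)+
  ultimately have "q_number q (Suc n) * (1 + q ^ n) \<le> 1 / (1 - \<bar>q\<bar>) * 2"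
    using qn assms by (intro mult_mono) auto
  moreover have "0 < 1 / (1 - \<bar>q\<bar>)" using assms by simp
  ultimately have "jacobi_q q (Suc n) \<le> 1 + 2 / (1 - \<bar>q\<bar>)"
    by (simp add: jacobi_q_def)
  moreover have "0 < 1 + 2 / (1 - \<bar>q\<bar>)" using assms by (intro add_pos_pos) auto
  ultimately show "4 * jacobi_q q (Suc n) \<le> (sqrt (4 * (1 + 2 / (1 - \<bar>q\<bar>))))\<^sup>2"
    "0 < sqrt (4 * (1 + 2 / (1 - \<bar>q\<bar>)))"
    by simp_all
qed

theorem theorem4p2:
  fixes J :: "'h::complex_hilbert \<Rightarrow> 'h" and x :: 'h and q :: real
  assumes "selfadjoint_involution J"
    and "- 1 < q" and "q < 1"
    and "norm x = 1"
    and "J x = x \<or> J x = - x"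
  shows "is_vacuum_distribution q J (gaussian q J x) (mu_q q)"
proof -
  interpret bounded_jacobi "jacobi_q q" "sqrt (4 * (1 + 2 / (1 - \<bar>q\<bar>)))"
    using assms(2,3) by (intro bounded_jacobi_q) simp
  have "orth_poly q = jacobi_poly (jacobi_q q)"
    by (rule ext) (rule orth_poly_eq_jacobi_poly)
  then have \<mu>: "prob_space (mu_q q)" "sets (mu_q q) = sets borel"
    "monic_orthogonal_polynomials (mu_q q) (jacobi_poly (jacobi_q q))"
    using theI'[OF favard] by (auto simp: mu_q_def)
  then have int: "integrable (mu_q q) (\<lambda>t. t ^ n)" for n
    by (simp add: monic_orthogonal_polynomials_def)
  then have "(\<integral>t. t ^ n \<partial>mu_q q) = path_weight (jacobi_q q) n 0" for n
    using monic_orthogonal_iff_path_moments[OF \<mu>(1)] \<mu>(3) by blast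
  then show ?thesis
    using \<mu> int vacuum_moment[OF assms(1,4,5)] by (simp add: is_vacuum_distribution_def)
qed

end
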